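(* Let $\nu$ be a divisorial valuation of $\mathbb{P}^2$ (centered at a closed point $p$) whose configuration of centers is $\mathcal{C}_\nu=\{p_1,\ldots,p_n\}$. Let $m_1,\ldots,m_n$ be non-negative integers and let $C$ be a curve of $\mathbb{P}^2$ passing through $(\mathcal{C}_\nu,(m_i)_{i=1}^n)$. Then $$\deg(C)\geq \frac{1}{\overline{\beta}_0(\nu)+\left(1+\delta_0(\nu)\right)t(\nu)}\sum_{i=1}^n v_i m_i,$$ where $(v_i)_{i=1}^n$ is the sequence of multiplicities of $\nu$, $\delta_0(\nu)=-1$ if $\nu$ is the $\mathfrak{m}$-adic valuation ($\mathfrak{m}$ being the maximal ideal of $\mathcal{O}_{\mathbb{P}^2,p}$) and, otherwise, $$\delta_0(\nu):=\left\lceil\frac{\mathrm{vol}(\nu)^{-1}-2\overline{\beta}_0(\nu)t(\nu)}{t(\nu)^2}\right\rceil^+.$$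
   Context: Let $\Bbbk$ be an algebraically closed field of arbitrary characteristic and $\mathbb{P}^2$ the projective plane over $\Bbbk$. Divisorial valuations. A divisorial valuation $\nu$ of $\mathbb{P}^2$ centered at a closed point $p$ is the valuation of the function field of $\mathbb{P}^2$ given by the order of vanishing along the last exceptional divisor $E_n$ ($n\ge 1$) of a finite simple sequence of point blowups $X_\nu=X_n\xrightarrow{\pi_n}X_{n-1}\to\cdots\to X_1\xrightarrow{\pi_1}X_0=\mathbb{P}^2$, where $\pi_i$ is the blowup at a closed point $p_i\in X_{i-1}$ with exceptional divisor $E_i$, $p_1=p$, and $p_{i+1}\in E_i$ for $1\le i\le n-1$. The set $\mathcal{C}_\nu=\{p_1,\ldots,p_n\}$ is the configuration of centers of $\nu$. Put $\mathfrak{m}$ for the maximal ideal of $\mathcal{O}_{\mathbb{P}^2,p}$; $\nu$ is the $\mathfrak{m}$-adic valuation exactly when $n=1$. For an ideal $I$, $\nu(I):=\min\{\nu(x)\mid x\in I\setminus\{0\}\}$. The sequence of multiplicities of $\nu$ is $(v_i)_{i=1}^n$, where $v_i$ is the value under $\nu$ of the maximal ideal of $\mathcal{O}_{X_{i-1},p_i}$. Set $\overline{\beta}_0(\nu):=\nu(\mathfrak{m})$ $(=v_1)$. The volume is $\mathrm{vol}(\nu):=\limsup_{m\to\infty}\frac{2\,\mathrm{length}(\mathcal{O}_{\mathbb{P}^2,p}/\mathcal{P}_m)}{m^2}$, where $\mathcal{P}_m=\{h\in\mathcal{O}_{\mathbb{P}^2,p}\mid \nu(h)\ge m\}\cup\{0\}$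 (it is known that $\mathrm{vol}(\nu)^{-1}=\sum_{i=1}^n v_i^2$). For a curve $S$ of $\mathbb{P}^2$, $\varphi_S\in\mathcal{O}_{\mathbb{P}^2,p}$ denotes a local equation of $S$ at $p$. Set $t(\nu):=\max\{\nu(\varphi_S)\mid S \text{ a line of }\mathbb{P}^2\}$. (If $\nu$ is $\mathfrak{m}$-adic then $t(\nu)=1$; otherwise there is a unique line $H$, the tangent line of $\nu$, with $\nu(\varphi_H)>\overline{\beta}_0(\nu)$, and $t(\nu)=\nu(\varphi_H)$.) For a rational number $x$, $\lceil x\rceil^+$ is the ceiling of $x$ if $x\ge 0$, and $0$ otherwise. Passing through. A curve $C$ of $\mathbb{P}^2$ passes through $(\mathcal{C}_\nu,(m_i)_{i=1}^n)$ if the divisor $C^*-\sum_{i=1}^n m_iE_i^*$ on $X_\nu$ is effective (i.e. $\geq 0$), where $C^*$ and $E_i^*$ are the total transforms (pull-backs) on $X_\nu$ of $C$ and $E_i$. *)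

theory Defs
  imports
    "HOL-Algebra.QuotRing"
    "HOL-Algebra.Generated_Rings"
    "HOL-Algebra.Ideal_Product"
    "HOL-Computational_Algebra.Polynomial_Factorial"
    "HOL-Library.Extended_Real"
    "HOL-Library.Liminf_Limsup"
begin

text \<open>
  Surfaces birational to the projective plane over \<open>k\<close> are treated as models in the sense of
  Zariski: a point (closed or not) of an integral separated scheme is identified with its local
  ring, a subring of the function field \<open>K = k(x, y)\<close>, and a surface is identified with the set
  of these local rings. A point \<open>S\<close> lies in the closure of a point \<open>R\<close> iff \<open>S \<subseteq> R\<close>.
\<close>

type_synonym 'k ratfun = "'k poly poly fract"
type_synonym 'k point = "'k ratfun set"
type_synonym 'k model = "'k point set"

section \<open>Subrings of a field and their localizations\<close>

definition ring_on :: "'a::field set \<Rightarrow> 'a ring" where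
  "ring_on A = \<lparr>carrier = A, monoid.mult = (*), one = 1, zero = 0, add = (+)\<rparr>"

definition localization :: "'a::field set \<Rightarrow> 'a set \<Rightarrow> 'a set" where
  "localization A P = {a / b | a b. a \<in> A \<and> b \<in> A - P}"

definition affine_model :: "'a::field set \<Rightarrow> 'a set set" where
  "affine_model A = {localization A P | P. primeideal P (ring_on A)}"

text \<open>Only meant for local rings, where the non-units form the maximal ideal.\<close>

definition max_ideal :: "'a::field set \<Rightarrow> 'a set" where
  "max_ideal R = R - Units (ring_on R)"

definition dominates :: "'a::field set \<Rightarrow> 'a set \<Rightarrow> bool" where
  "dominates S R \<longleftrightarrow> R \<subseteq> S \<and> max_ideal R \<subseteq> max_ideal S"

definition closed_point :: "'a set set \<Rightarrow> 'a set \<Rightarrow> bool" where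
  "closed_point X R \<longleftrightarrow> R \<in> X \<and> (\<forall>S\<in>X. S \<subseteq> R \<longrightarrow> S = R)"

definition generic_point :: "'a set set \<Rightarrow> 'a set" where
  "generic_point Z = (THE S. S \<in> Z \<and> (\<forall>T\<in>Z. T \<subseteq> S))"

section \<open>The projective plane\<close>

definition const :: "'k::field \<Rightarrow> 'k ratfun" where
  "const c = to_fract [:[:c:]:]"

text \<open>Homogeneous coordinates \<open>(1 : x : y)\<close> of the generic point; \<open>hcoord i / hcoord j\<close> is the
  rational function \<open>X\<^sub>i / X\<^sub>j\<close> on the plane.\<close>

definition hcoord :: "nat \<Rightarrow> 'k::field ratfun" where
  "hcoord i = (if i = 0 then 1 else if i = 1 then to_fract [:[:0, 1:]:] else to_fract [:0, 1:])"

definition chart_ring :: "nat \<Rightarrow> 'k::field ratfun set" where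
  "chart_ring i = generate_ring (ring_on UNIV) (range const \<union> {hcoord j / hcoord i | j. j < 3})"

definition proj_plane :: "'k::field model" where
  "proj_plane = (\<Union>i<3. affine_model (chart_ring i))"

text \<open>Ternary forms are elements of \<open>k[X\<^sub>2][X\<^sub>1][X\<^sub>0]\<close>. A plane curve (an effective divisor, so
  possibly reducible or non-reduced) of degree \<open>d\<close> is given by a nonzero form of degree \<open>d \<ge> 1\<close>.\<close>

definition plane_curve :: "nat \<Rightarrow> 'k::field poly poly poly \<Rightarrow> bool" where
  "plane_curve d F \<longleftrightarrow> d \<ge> 1 \<and> F \<noteq> 0 \<and>
     (\<forall>i j l. Polynomial.coeff (Polynomial.coeff (Polynomial.coeff F i) j) l \<noteq> 0
        \<longrightarrow> i + j + l = d)"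

definition generic_value :: "'k::field poly poly poly \<Rightarrow> 'k ratfun" where
  "generic_value F =
     poly (map_poly (\<lambda>G. poly (map_poly (\<lambda>H. poly (map_poly const H) (hcoord 2)) G) (hcoord 1)) F)
       (hcoord 0)"

section \<open>Divisors\<close>

text \<open>A (Cartier) divisor on a model is given by a choice of a local equation at each of its
  points; local equations only matter up to units of the local ring.\<close>

type_synonym 'k divisor = "'k point \<Rightarrow> 'k ratfun"

definition effective :: "'k::field model \<Rightarrow> 'k divisor \<Rightarrow> bool" where
  "effective X D \<longleftrightarrow> (\<forall>S\<in>X. D S \<in> S)"

text \<open>At a point of the chart \<open>X\<^sub>i \<noteq> 0\<close> the curve \<open>F = 0\<close> of degree \<open>d\<close> has the local equation
  \<open>F / X\<^sub>i\<^sup>d\<close>.\<close>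

definition curve_divisor :: "nat \<Rightarrow> 'k::field poly poly poly \<Rightarrow> 'k divisor" where
  "curve_divisor d F R =
     generic_value F / hcoord (SOME i. i < 3 \<and> R \<in> affine_model (chart_ring i)) ^ d"

section \<open>Point blowups\<close>

text \<open>The blowup of \<open>Spec R\<close> at its closed point is covered by the spectra of the rings
  \<open>R[m/u]\<close> with \<open>0 \<noteq> u \<in> m\<close>; its exceptional divisor consists of the points lying over the
  closed point, i.e. of the local rings that dominate \<open>R\<close>.\<close>

definition blowup_chart :: "'a::field set \<Rightarrow> 'a \<Rightarrow> 'a set" where
  "blowup_chart R u = generate_ring (ring_on UNIV) (R \<union> {x / u | x. x \<in> max_ideal R})"

definition exceptional :: "'a::field set \<Rightarrow> 'a set set" where
  "exceptional R =
     {S \<in> (\<Union>u\<in>max_ideal R - {0}. affine_model (blowup_chart R u)). dominates S R}"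

definition blowup :: "'a::field set set \<Rightarrow> 'a set \<Rightarrow> 'a set set" where
  "blowup X R = (X - {R}) \<union> exceptional R"

definition blowdown :: "'a::field set \<Rightarrow> 'a set \<Rightarrow> 'a set" where
  "blowdown R S = (if S \<in> exceptional R then R else S)"

text \<open>The exceptional divisor has ideal sheaf \<open>m\<^sub>R O\<close>, which is locally principal.\<close>

definition exceptional_divisor :: "'k::field point \<Rightarrow> 'k divisor" where
  "exceptional_divisor R S =
     (if S \<in> exceptional R
      then SOME e. e \<in> S \<and> PIdl\<^bsub>ring_on S\<^esub> e = Idl\<^bsub>ring_on S\<^esub> (max_ideal R)
      else 1)"

text \<open>A sequence of centers is a function \<open>p\<close> of which only \<open>p 1, \<dots>, p n\<close> matter;
  \<open>surface p i\<close> is the surface \<open>X\<^sub>i\<close> obtained by blowing up \<open>p 1, \<dots>, p i\<close>.\<close>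

primrec surface :: "(nat \<Rightarrow> 'k::field point) \<Rightarrow> nat \<Rightarrow> 'k model" where
  "surface p 0 = proj_plane"
| "surface p (Suc i) = blowup (surface p i) (p (Suc i))"

definition simple_configuration :: "nat \<Rightarrow> (nat \<Rightarrow> 'k::field point) \<Rightarrow> bool" where
  "simple_configuration n p \<longleftrightarrow> n \<ge> 1 \<and>
     (\<forall>i\<in>{1..n}. closed_point (surface p (i - 1)) (p i)) \<and>
     (\<forall>i\<in>{1..<n}. p (i + 1) \<in> exceptional (p i))"

text \<open>The morphism \<open>X\<^sub>n \<rightarrow> X\<^sub>i\<close> on points, for \<open>i \<le> n\<close>, and the pull-back of divisors along it.\<close>

primrec contraction :: "(nat \<Rightarrow> 'k::field point) \<Rightarrow> nat \<Rightarrow> nat \<Rightarrow> 'k point \<Rightarrow> 'k point" where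
  "contraction p i 0 S = S"
| "contraction p i (Suc n) S =
     (if Suc n \<le> i then S else contraction p i n (blowdown (p (Suc n)) S))"

definition total_transform ::
    "(nat \<Rightarrow> 'k::field point) \<Rightarrow> nat \<Rightarrow> nat \<Rightarrow> 'k divisor \<Rightarrow> 'k divisor" where
  "total_transform p i n D = D \<circ> contraction p i n"

text \<open>Local equations of \<open>C\<^sup>* - \<Sum> m\<^sub>i E\<^sub>i\<^sup>*\<close>; divisors are written multiplicatively.\<close>

definition passes_through ::
    "nat \<Rightarrow> 'k::field poly poly poly \<Rightarrow> nat \<Rightarrow> (nat \<Rightarrow> 'k point) \<Rightarrow> (nat \<Rightarrow> nat) \<Rightarrow> bool" where
  "passes_through d F n p m \<longleftrightarrow>
     effective (surface p n)
       (\<lambda>S. total_transform p 0 n (curve_divisor d F) S /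
            (\<Prod>i=1..n. total_transform p i n (exceptional_divisor (p i)) S ^ m i))"

section \<open>Divisorial valuations and their invariants\<close>

text \<open>Order of a nonzero rational function with respect to a discrete valuation ring \<open>V\<close>.\<close>

definition order_along :: "'a::field set \<Rightarrow> 'a \<Rightarrow> int" where
  "order_along V f =
     (THE k. \<exists>z u. z \<in> V \<and> PIdl\<^bsub>ring_on V\<^esub> z = max_ideal V \<and>
        u \<in> Units (ring_on V) \<and> f = u * z powi k)"

text \<open>Valuations take values in \<open>int\<close>; the value at 0 is irrelevant.\<close>

definition divisorial_valuation ::
    "nat \<Rightarrow> (nat \<Rightarrow> 'k::field point) \<Rightarrow> ('k ratfun \<Rightarrow> int) \<Rightarrow> bool" where
  "divisorial_valuation n p \<nu> \<longleftrightarrow> simple_configuration n p \<and>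
     (\<forall>f. f \<noteq> 0 \<longrightarrow> \<nu> f = order_along (generic_point (exceptional (p n))) f)"

definition ideal_value :: "('a::field \<Rightarrow> int) \<Rightarrow> 'a set \<Rightarrow> int" where
  "ideal_value \<nu> I = (LEAST k. \<exists>x\<in>I - {0}. k = \<nu> x)"

definition multiplicity_at :: "('k::field ratfun \<Rightarrow> int) \<Rightarrow> (nat \<Rightarrow> 'k point) \<Rightarrow> nat \<Rightarrow> int" where
  "multiplicity_at \<nu> p i = ideal_value \<nu> (max_ideal (p i))"

text \<open>In the following, \<open>R\<close> is the local ring of the plane at the center of \<open>\<nu>\<close>.\<close>

definition beta0 :: "('k::field ratfun \<Rightarrow> int) \<Rightarrow> 'k point \<Rightarrow> int" where
  "beta0 \<nu> R = ideal_value \<nu> (max_ideal R)"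

definition valuation_ideal :: "('a::field \<Rightarrow> int) \<Rightarrow> 'a set \<Rightarrow> nat \<Rightarrow> 'a set" where
  "valuation_ideal \<nu> R m = {h \<in> R. \<nu> h \<ge> int m} \<union> {0}"

text \<open>Length of a ring as a module over itself. The submodules of the \<open>R\<close>-module \<open>R/I\<close> are the
  ideals of the ring \<open>R/I\<close>, so this is also the length of \<open>R/I\<close> over \<open>R\<close>.\<close>

definition ring_length :: "('a, 'b) ring_scheme \<Rightarrow> enat" where
  "ring_length Q = Sup {enat r | r. \<exists>J :: nat \<Rightarrow> 'a set.
     (\<forall>i\<le>r. ideal (J i) Q) \<and> (\<forall>i<r. J i \<subset> J (Suc i))}"

definition volume :: "('k::field ratfun \<Rightarrow> int) \<Rightarrow> 'k point \<Rightarrow> real" where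
  "volume \<nu> R = real_of_ereal (limsup (\<lambda>m.
     2 * ereal_of_enat (ring_length (ring_on R Quot valuation_ideal \<nu> R m)) / ereal (real m ^ 2)))"

definition tangency :: "('k::field ratfun \<Rightarrow> int) \<Rightarrow> 'k point \<Rightarrow> int" where
  "tangency \<nu> R = Max {\<nu> (curve_divisor 1 L R) | L. plane_curve 1 L}"

primrec ideal_pow :: "('a, 'b) ring_scheme \<Rightarrow> 'a set \<Rightarrow> nat \<Rightarrow> 'a set" where
  "ideal_pow Q I 0 = carrier Q"
| "ideal_pow Q I (Suc n) = I \<cdot>\<^bsub>Q\<^esub> ideal_pow Q I n"

definition is_adic :: "('a::field \<Rightarrow> int) \<Rightarrow> 'a set \<Rightarrow> bool" where
  "is_adic \<nu> R \<longleftrightarrow> (\<forall>f\<in>R - {0}. \<forall>k::nat.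
     int k \<le> \<nu> f \<longleftrightarrow> f \<in> ideal_pow (ring_on R) (max_ideal R) k)"

definition ceiling_plus :: "real \<Rightarrow> int" where
  "ceiling_plus x = (if x \<ge> 0 then \<lceil>x\<rceil> else 0)"

definition delta0 :: "('k::field ratfun \<Rightarrow> int) \<Rightarrow> 'k point \<Rightarrow> int" where
  "delta0 \<nu> R =
     (if is_adic \<nu> R then -1
      else ceiling_plus ((inverse (volume \<nu> R)
             - 2 * real_of_int (beta0 \<nu> R) * real_of_int (tangency \<nu> R))
           / real_of_int (tangency \<nu> R) ^ 2))"

end

theory Submission
  imports Defs
begin

text \<open>
  Evaluating the effective divisor \<open>C\<^sup>* - \<Sum> m\<^sub>i E\<^sub>i\<^sup>*\<close> at the generic point of \<open>E\<^sub>n\<close> gives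
  \<open>\<nu>(\<phi>\<^sub>C) \<ge> \<Sum> v\<^sub>i m\<^sub>i\<close>, so \<open>\<nu>(\<phi>\<^sub>C)\<close> has to be bounded in terms of \<open>d = deg C\<close>.

  Let \<open>u = 0\<close> be a line of maximal value \<open>t\<close> and \<open>v\<close> a second coordinate at \<open>p\<close>. After splitting off a
  power of \<open>u\<close>, an equation \<open>f\<close> of degree \<open>d\<close> meets the line \<open>u = 0\<close> at \<open>p\<close> with multiplicity
  \<open>r \<le> d\<close>, whence the local ring is \<open>\<langle>1, v, \<dots>, v\<^sup>r\<^sup>-\<^sup>1\<rangle> + (f, u)\<close>. Iterating, the classes of \<open>v\<^sup>l f\<^sup>i u\<^sup>j\<close> with
  \<open>l < r\<close> and \<open>i \<nu>(f) + j t < m\<close> span the quotient by the valuation ideal of level \<open>m\<close>, so that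
  \<open>vol(\<nu>) \<nu>(f) t \<le> r\<close>. Since \<open>vol(\<nu>)\<^sup>-\<^sup>1 \<le> 2 \<beta>\<^sub>0 t + \<delta>\<^sub>0 t\<^sup>2\<close> by the choice of \<open>\<delta>\<^sub>0\<close>, and \<open>\<beta>\<^sub>0 \<le> t\<close>, this
  yields \<open>\<nu>(f) \<le> d (2 \<beta>\<^sub>0 + \<delta>\<^sub>0 t) \<le> d (\<beta>\<^sub>0 + (1 + \<delta>\<^sub>0) t)\<close>. The division requires \<open>vol(\<nu>) > 0\<close>, which holds
  because the residue field of \<open>\<nu>\<close> contains an element that is transcendental over \<open>k\<close>. For the
  \<open>m\<close>-adic valuation, \<open>\<nu>(f) \<le> d\<close> since the multiplicity of a curve is at most its degree.
\<close>


section \<open>Evaluation of bivariate polynomials\<close>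

text \<open>Charts and blowups are given by rings and primes, but the estimates need coordinates.
  Hence each center is shown to be \<open>pt x y\<close>, the local ring of the origin for a pair of
  free generators of the function field, and the last exceptional divisor to have the generic point
  \<open>dv x (y / x)\<close>; a two-variable Nullstellensatz makes closed points rational. From
  then on everything is evaluation of bivariate polynomials.

  Lengths over the local ring at \<open>p\<close> take the place of intersection numbers on the
  blown-up surface: \<open>f\<close> restricted to the line \<open>u = 0\<close> is a polynomial in
  \<open>v\<close>, and its order at the origin bounds the growth of the quotients. This breaks down
  if the curve contains that line, which is why powers of \<open>u\<close> are split off. Each such
  factor costs one degree and contributes \<open>t\<close> to the value, and \<open>t\<close> is at
  most the constant of the theorem.

  A further obstacle is \<open>t\<close> itself: it is a \<open>Max\<close> over infinitely many
  lines and has content only once their values are known to form a finite set.\<close>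

definition rhom :: "('a::comm_ring_1 \<Rightarrow> 'b::comm_ring_1) \<Rightarrow> bool" where
  "rhom \<phi> \<longleftrightarrow> \<phi> 1 = 1 \<and> (\<forall>a b. \<phi> (a + b) = \<phi> a + \<phi> b) \<and> (\<forall>a b. \<phi> (a * b) = \<phi> a * \<phi> b)"

lemma rhom_simps:
  assumes "rhom \<phi>"
  shows "\<phi> 0 = 0" "\<phi> 1 = 1" "\<phi> (a + b) = \<phi> a + \<phi> b" "\<phi> (a * b) = \<phi> a * \<phi> b"
    "\<phi> (- a) = - \<phi> a" "\<phi> (a - b) = \<phi> a - \<phi> b" "\<phi> (a ^ n) = \<phi> a ^ n"
proof -
  show 0: "\<phi> 0 = 0" using assms unfolding rhom_def by (metis add_cancel_right_left add_0)
  show "\<phi> 1 = 1" "\<phi> (a + b) = \<phi> a + \<phi> b" "\<phi> (a * b) = \<phi> a * \<phi> b"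
    using assms unfolding rhom_def by auto
  show m: "\<phi> (- a) = - \<phi> a" for a
    using 0 assms unfolding rhom_def by (metis add.right_inverse add_eq_0_iff)
  show "\<phi> (a - b) = \<phi> a - \<phi> b"
    using m assms unfolding rhom_def by (metis diff_conv_add_uminus)
  show "\<phi> (a ^ n) = \<phi> a ^ n"
    using assms unfolding rhom_def by (induction n) auto
qed

text \<open>The universal property of the polynomial ring: the extension of \<open>\<phi>\<close>
  that sends the variable to \<open>x\<close>.\<close>

definition hev :: "('a::comm_ring_1 \<Rightarrow> 'b::comm_ring_1) \<Rightarrow> 'b \<Rightarrow> 'a poly \<Rightarrow> 'b" where
  "hev \<phi> x p = poly (map_poly \<phi> p) x"

lemma hev_0 [simp]: "hev \<phi> x 0 = 0"
  by (simp add: hev_def)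

lemma hev_pCons: "rhom \<phi> \<Longrightarrow> hev \<phi> x (pCons a p) = \<phi> a + x * hev \<phi> x p"
  by (simp add: hev_def map_poly_pCons rhom_simps)

lemma hev_add: "rhom \<phi> \<Longrightarrow> hev \<phi> x (p + q) = hev \<phi> x p + hev \<phi> x q"
  by (induction p q rule: poly_induct2) (simp_all add: hev_pCons rhom_simps algebra_simps)

lemma hev_smult: "rhom \<phi> \<Longrightarrow> hev \<phi> x (smult a p) = \<phi> a * hev \<phi> x p"
  by (induction p) (simp_all add: hev_pCons rhom_simps algebra_simps)

lemma hev_mult: "rhom \<phi> \<Longrightarrow> hev \<phi> x (p * q) = hev \<phi> x p * hev \<phi> x q"
  by (induction p) (simp_all add: hev_pCons hev_add hev_smult rhom_simps algebra_simps)

lemma rhom_hev: "rhom \<phi> \<Longrightarrow> rhom (hev \<phi> x)"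
  unfolding rhom_def[of "hev \<phi> x"]
  by (simp add: hev_add hev_mult) (simp add: hev_def rhom_simps)

lemma hev_1: "rhom \<phi> \<Longrightarrow> hev \<phi> x 1 = 1"
  using rhom_hev unfolding rhom_def by blast

lemma rhom_const: "rhom const"
  unfolding rhom_def const_def by (auto simp flip: to_fract_mult to_fract_add one_pCons)

lemmas const_simps [simp] = rhom_simps[OF rhom_const]

lemma const_eq_0_iff [simp]: "const c = 0 \<longleftrightarrow> c = 0"
  by (simp add: const_def)

lemma const_inverse: "inverse (const c) = const (inverse c)"
proof (cases "c = 0")
  case False
  then have "const c * const (inverse c) = 1"
    by (simp flip: const_simps(4))
  then show ?thesis by (metis inverse_unique)
qed simp

text \<open>A polynomial over \<open>k[Y]\<close> in the variable \<open>X\<close>: \<open>x\<close> is substituted for the outer variable \<open>X\<close> and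
  \<open>y\<close> for the inner variable \<open>Y\<close>.\<close>

definition ev :: "'k::field ratfun \<Rightarrow> 'k ratfun \<Rightarrow> 'k poly poly \<Rightarrow> 'k ratfun" where
  "ev x y = hev (hev const y) x"

lemma rhom_ev: "rhom (ev x y)"
  unfolding ev_def by (intro rhom_hev rhom_const)

lemmas ev_simps [simp] = rhom_simps[OF rhom_ev]

definition pX :: "'k::field poly poly" where "pX = [:0, 1:]"
definition pY :: "'k::field poly poly" where "pY = [:[:0, 1:]:]"
definition pC :: "'k::field \<Rightarrow> 'k poly poly" where "pC c = [:[:c:]:]"

lemma rhom_pC: "rhom pC"
  by (simp add: rhom_def one_pCons pC_def)

lemmas pC_simps [simp] = rhom_simps(1,2)[OF rhom_pC]

lemma pX_mult: "pX * p = pCons 0 p"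
  by (simp add: pX_def)

lemma poly_gen [simp]: "poly pX h = h" "poly pY h = [:0, 1:]" "poly (pC c) h = [:c:]"
  by (simp_all add: pX_def pY_def pC_def)

lemma gen_neq_0 [simp]: "pX \<noteq> 0" "pY \<noteq> 0"
  by (simp_all add: pX_def pY_def)

lemma ev_gen [simp]: "ev x y pX = x" "ev x y pY = y" "ev x y (pC c) = const c"
  by (simp_all add: ev_def pX_def pY_def pC_def hev_pCons rhom_hev rhom_const hev_1)

lemma ev_pCons: "ev x y (pCons a p) = ev x y [:a:] + x * ev x y p"
  by (simp add: ev_def hev_pCons rhom_hev rhom_const)

lemma ev_inner: "ev x y [:a:] = hev const y a"
  by (simp add: ev_def hev_pCons rhom_hev rhom_const)

lemma bipoly_induct [case_names const X Y add mult]: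
  assumes "\<And>c. P (pC c)" "P pX" "P pY" "\<And>a b. P a \<Longrightarrow> P b \<Longrightarrow> P (a + b)"
    "\<And>a b. P a \<Longrightarrow> P b \<Longrightarrow> P (a * b)"
  shows "P (g :: 'k::field poly poly)"
proof -
  have in0: "P [:h:]" for h
  proof (induction h)
    case 0 show ?case using assms(1)[of 0] by simp
  next
    case (pCons c q)
    have "[:pCons c q:] = pC c + pY * [:q:]" by (simp add: pC_def pY_def)
    with pCons assms show ?case by metis
  qed
  show ?thesis
  proof (induction g)
    case 0 show ?case using assms(1)[of 0] by simp
  next
    case (pCons a q)
    have "pCons a q = [:a:] + pX * q" by (simp add: pX_def)
    with pCons assms in0 show ?case by metis
  qed
qed

section \<open>Substitution of polynomials for the variables\<close>

definition subst :: "'k::field poly poly \<Rightarrow> 'k poly poly \<Rightarrow> 'k poly poly \<Rightarrow> 'k poly poly" where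
  "subst a b = hev (hev pC b) a"

lemma rhom_subst: "rhom (subst a b)"
  unfolding subst_def by (intro rhom_hev rhom_pC)

lemmas subst_simps [simp] = rhom_simps[OF rhom_subst]

lemma subst_gen [simp]: "subst a b pX = a" "subst a b pY = b" "subst a b (pC c) = pC c"
  by (simp_all add: subst_def pX_def pY_def pC_def[of c] hev_pCons rhom_hev rhom_pC hev_1)

lemma rhom_eqI:
  assumes "rhom \<phi>" "rhom \<psi>" "\<And>c. \<phi> (pC c) = \<psi> (pC c)" "\<phi> pX = \<psi> pX" "\<phi> pY = \<psi> pY"
  shows "\<phi> g = \<psi> g"
  by (induction g rule: bipoly_induct) (use assms in \<open>simp_all add: rhom_simps\<close>)

lemma rhom_comp: "rhom \<phi> \<Longrightarrow> rhom \<psi> \<Longrightarrow> rhom (\<lambda>g. \<phi> (\<psi> g))"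
  by (simp add: rhom_def)

lemma ev_subst: "ev x y (subst a b g) = ev (ev x y a) (ev x y b) g"
  by (rule rhom_eqI) (auto intro: rhom_comp rhom_ev rhom_subst)

lemma poly2_subst: "poly (poly (subst a b g) [:s:]) t =
    poly (poly g [:poly (poly a [:s:]) t:]) (poly (poly b [:s:]) t)"
proof -
  have 1: "rhom (\<lambda>p :: 'a poly poly. poly (poly p [:s:]) t)" for s t
    by (simp add: rhom_def)
  show ?thesis
    by (rule rhom_eqI[OF rhom_comp[OF 1 rhom_subst] 1]) auto
qed

section \<open>Algebraically independent pairs\<close>

definition indep :: "'k::field ratfun \<Rightarrow> 'k ratfun \<Rightarrow> bool" where
  "indep x y \<longleftrightarrow> (\<forall>g. ev x y g = 0 \<longrightarrow> g = 0)"

lemma indep_ev_eq_iff: "indep x y \<Longrightarrow> ev x y g = ev x y h \<longleftrightarrow> g = h"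
  unfolding indep_def by (metis ev_simps(6) eq_iff_diff_eq_0)

lemma indep_ev_eq_0_iff: "indep x y \<Longrightarrow> ev x y g = 0 \<longleftrightarrow> g = 0"
  unfolding indep_def by auto

lemma indep_nonzero: "indep x y \<Longrightarrow> x \<noteq> 0" "indep x y \<Longrightarrow> y \<noteq> 0"
  using indep_ev_eq_0_iff[of x y pX] indep_ev_eq_0_iff[of x y pY] by auto

text \<open>Transfer along a birational change of coordinates. The variables become images of
  \<open>subst a b\<close> after multiplication by \<open>s\<close>, and \<open>s\<close> is itself
  such an image; clearing denominators, every \<open>g\<close> satisfies
  \<open>s ^ N * g = subst a b h\<close> for some \<open>h\<close>. A relation \<open>g\<close> for
  the new pair thus gives a relation \<open>h\<close> for the old one, so \<open>h = 0\<close>, and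
  \<open>s \<noteq> 0\<close> yields \<open>g = 0\<close>.\<close>

lemma indep_transfer:
  assumes xy: "indep x y" and x: "x = ev x' y' a" and y: "y = ev x' y' b" and s: "s \<noteq> 0"
    and S: "subst a b s' = s" and hX: "subst a b h1 = s * pX" and hY: "subst a b h2 = s * pY"
  shows "indep x' y'"
proof -
  have ev: "ev x y h = ev x' y' (subst a b h)" for h
    by (simp add: ev_subst x y)
  have "\<exists>N h. s ^ N * g = subst a b h" for g
  proof (induction g rule: bipoly_induct)
    case (const c) show ?case by (intro exI[of _ 0] exI[of _ "pC c"]) simp
  next
    case X show ?case by (intro exI[of _ 1] exI[of _ h1]) (simp add: hX)
  next
    case Y show ?case by (intro exI[of _ 1] exI[of _ h2]) (simp add: hY)
  next
    case (add g1 g2)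
    then obtain N1 h1 N2 h2 where e: "s ^ N1 * g1 = subst a b h1" "s ^ N2 * g2 = subst a b h2"
      by blast
    have "s ^ (N1 + N2) * (g1 + g2) = s ^ N2 * (s ^ N1 * g1) + s ^ N1 * (s ^ N2 * g2)"
      by (simp add: power_add algebra_simps)
    also have "\<dots> = subst a b (s' ^ N2 * h1 + s' ^ N1 * h2)"
      by (simp add: S e)
    finally show ?case by blast
  next
    case (mult g1 g2)
    then obtain N1 h1 N2 h2 where e: "s ^ N1 * g1 = subst a b h1" "s ^ N2 * g2 = subst a b h2"
      by blast
    have "s ^ (N1 + N2) * (g1 * g2) = (s ^ N1 * g1) * (s ^ N2 * g2)"
      by (simp add: power_add mult_ac)
    also have "\<dots> = subst a b (h1 * h2)"
      by (simp add: e)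
    finally show ?case by blast
  qed
  then have "ev x' y' g = 0 \<Longrightarrow> g = 0" for g
  proof -
    assume g: "ev x' y' g = 0"
    obtain N h where h: "s ^ N * g = subst a b h"
      using \<open>\<And>g. \<exists>N h. s ^ N * g = subst a b h\<close> by blast
    have "ev x y h = 0" by (simp add: ev g flip: h)
    then have "h = 0" using xy by (simp add: indep_def)
    then show "g = 0" using h s by simp
  qed
  then show ?thesis by (simp add: indep_def)
qed

lemma indep_swap: "indep x y \<Longrightarrow> indep y x"
  by (rule indep_transfer[where a = pY and b = pX and s = 1 and s' = 1 and ?h1.0 = pY and ?h2.0 = pX])
    auto

lemma indep_shift: "indep x y \<Longrightarrow> indep (x - const a) (y - const b)"
  by (rule indep_transfer[where a = "pX + pC a" and b = "pY + pC b" and s = 1 and s' = 1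
        and ?h1.0 = "pX - pC a" and ?h2.0 = "pY - pC b"])
    auto

lemma indep_blowup:
  assumes "indep x y"
  shows "indep x (y / x - const c)"
proof (rule indep_transfer[OF assms, where a = pX and b = "pX * (pY + pC c)" and s = pX and s' = pX
        and ?h1.0 = "pX * pX" and ?h2.0 = "pY - pC c * pX"])
  show "y = ev x (y / x - const c) (pX * (pY + pC c))"
    using indep_nonzero[OF assms] by simp
qed (simp_all add: algebra_simps)

lemma indep_linear:
  assumes "indep x y" "a \<noteq> 0"
  shows "indep (const a * x + const b * y) y"
proof (rule indep_transfer[OF assms(1), where a = "pC (inverse a) * (pX - pC b * pY)" and b = pY
        and s = 1 and s' = 1 and ?h1.0 = "pC a * pX + pC b * pY" and ?h2.0 = pY])
  have "const (inverse a) * const a = 1"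
    using assms(2) by (simp only: flip: const_simps(4)) simp
  then show "x = ev (const a * x + const b * y) y (pC (inverse a) * (pX - pC b * pY))"
    by (simp flip: mult.assoc)
  have "pC a * pC (inverse a) = 1" using assms by (simp flip: rhom_simps(4)[OF rhom_pC])
  then show "subst (pC (inverse a) * (pX - pC b * pY)) pY (pC a * pX + pC b * pY) = 1 * pX"
    by (simp flip: mult.assoc)
qed auto

text \<open>Reversing the coefficients in the outer variable turns a relation for
  \<open>inverse x\<close> into one for \<open>x\<close>. The passage to \<open>inverse x\<close> is
  not polynomial, so \<open>indep_transfer\<close> does not cover it.\<close>

lemma indep_inverse:
  assumes "indep x y"
  shows "indep (inverse x) y"
  unfolding indep_def
proof safe
  fix g assume g: "ev (inverse x) y g = 0"
  define \<phi> where "\<phi> = hev const y"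
  have \<phi>: "rhom \<phi>" unfolding \<phi>_def by (intro rhom_hev rhom_const)
  have inj: "\<phi> a = 0 \<longleftrightarrow> a = 0" for a
    using indep_ev_eq_0_iff[OF assms, of "[:a:]"] by (simp add: \<phi>_def ev_inner)
  define G where "G = map_poly \<phi> g"
  have "poly G (inverse x) = 0" using g by (simp add: ev_def hev_def G_def \<phi>_def)
  then have "poly (reflect_poly G) x = 0"
    using poly_reflect_poly_nz[of x G] indep_nonzero[OF assms] by simp
  moreover have "reflect_poly G = map_poly \<phi> (reflect_poly g)"
    by (intro poly_eqI)
      (simp add: G_def coeff_reflect_poly coeff_map_poly inj degree_map_poly rhom_simps[OF \<phi>])
  ultimately have "ev x y (reflect_poly g) = 0"
    by (simp add: ev_def hev_def \<phi>_def)
  then have "reflect_poly g = 0" using indep_ev_eq_0_iff[OF assms] by blast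
  then show "g = 0" by simp
qed

text \<open>The order of the coordinates is forced by the type: \<open>hcoord 2\<close> is the outer
  variable and \<open>hcoord 1\<close> the inner one.\<close>

lemma ev_hcoord: "ev (hcoord 2) (hcoord 1) g = to_fract (g :: 'k::field poly poly)"
proof (rule rhom_eqI[OF rhom_ev])
  show "rhom (to_fract :: 'k poly poly \<Rightarrow> _)" by (simp add: rhom_def)
qed (simp_all, simp_all add: hcoord_def const_def pX_def pY_def pC_def)

lemma indep_coords: "indep (hcoord 1) (hcoord 2 :: 'k::field ratfun)"
proof -
  have "indep (hcoord 2) (hcoord 1 :: 'k ratfun)"
    unfolding indep_def ev_hcoord by simp
  then show ?thesis by (rule indep_swap)
qed

section \<open>Local rings in the function field\<close>

text \<open>Since -1 is a constant, closure under sums and products already gives a subring.\<close>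

definition subalg :: "'k::field ratfun set \<Rightarrow> bool" where
  "subalg A \<longleftrightarrow> range const \<subseteq> A \<and> (\<forall>a\<in>A. \<forall>b\<in>A. a + b \<in> A \<and> a * b \<in> A)"

lemma subalgD:
  assumes "subalg A"
  shows "const c \<in> A" "0 \<in> A" "1 \<in> A" "a \<in> A \<Longrightarrow> b \<in> A \<Longrightarrow> a + b \<in> A"
    "a \<in> A \<Longrightarrow> b \<in> A \<Longrightarrow> a * b \<in> A" "a \<in> A \<Longrightarrow> - a \<in> A"
    "a \<in> A \<Longrightarrow> b \<in> A \<Longrightarrow> a - b \<in> A" "a \<in> A \<Longrightarrow> a ^ n \<in> A"
proof -
  show c: "const c \<in> A" for c
    using assms by (auto simp: subalg_def)
  show "0 \<in> A" "1 \<in> A"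
    using c[of 0] c[of 1] by auto
  show add: "a \<in> A \<Longrightarrow> b \<in> A \<Longrightarrow> a + b \<in> A" for a b
    using assms by (auto simp: subalg_def)
  show mult: "a \<in> A \<Longrightarrow> b \<in> A \<Longrightarrow> a * b \<in> A" for a b
    using assms by (auto simp: subalg_def)
  show uminus: "a \<in> A \<Longrightarrow> - a \<in> A" for a
    using mult[OF c[of "-1"], of a] by simp
  show "a \<in> A \<Longrightarrow> b \<in> A \<Longrightarrow> a - b \<in> A"
    using add[of a "- b"] uminus by simp
  show "a \<in> A \<Longrightarrow> a ^ n \<in> A"
    using \<open>1 \<in> A\<close> mult by (induction n) auto
qed

lemma ev_in_subalg:
  assumes "subalg A" "x \<in> A" "y \<in> A"
  shows "ev x y g \<in> A"
  by (induction g rule: bipoly_induct) (use assms subalgD in \<open>auto\<close>)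

lemma subalg_range_ev: "subalg (range (ev x y))"
  unfolding subalg_def
proof safe
  show "const c \<in> range (ev x y)" for c
    by (rule range_eqI[of _ _ "pC c"]) simp
qed (auto intro!: range_eqI simp flip: ev_simps)

lemma gen_in_range_ev: "x \<in> range (ev x y)" "y \<in> range (ev x y)"
  by (metis ev_gen(1) rangeI, metis ev_gen(2) rangeI)

lemma range_ev_swap: "range (ev x y) = range (ev y x)"
  using ev_in_subalg[OF subalg_range_ev gen_in_range_ev(2,1)] by blast

lemma range_ev_shift: "range (ev (x - const a) (y - const b)) = range (ev x y)"
proof
  have "x - const a \<in> range (ev x y)" "y - const b \<in> range (ev x y)"
    using subalgD[OF subalg_range_ev] gen_in_range_ev by metis+
  then show "range (ev (x - const a) (y - const b)) \<subseteq> range (ev x y)"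
    using ev_in_subalg[OF subalg_range_ev] by blast
  let ?A = "range (ev (x - const a) (y - const b))"
  have "(x - const a) + const a \<in> ?A" "(y - const b) + const b \<in> ?A"
    by (intro subalgD(1,4)[OF subalg_range_ev] gen_in_range_ev)+
  then have "x \<in> ?A" "y \<in> ?A" by (simp_all only: diff_add_cancel)
  then show "range (ev x y) \<subseteq> ?A"
    using ev_in_subalg[OF subalg_range_ev] by blast
qed

lemma ring_on_simps [simp]:
  "carrier (ring_on A) = A" "\<one>\<^bsub>ring_on A\<^esub> = 1" "\<zero>\<^bsub>ring_on A\<^esub> = 0"
  "a \<otimes>\<^bsub>ring_on A\<^esub> b = a * b" "a \<oplus>\<^bsub>ring_on A\<^esub> b = a + b"
  by (simp_all add: ring_on_def)

lemma cring_ring_on: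
  assumes "subalg A"
  shows "cring (ring_on A)"
proof (rule cringI)
  show "abelian_group (ring_on A)"
  proof (rule abelian_groupI)
    fix x assume "x \<in> carrier (ring_on A)"
    then show "\<exists>y\<in>carrier (ring_on A). y \<oplus>\<^bsub>ring_on A\<^esub> x = \<zero>\<^bsub>ring_on A\<^esub>"
      using subalgD[OF assms] by (auto intro!: bexI[of _ "- x"])
  qed (use subalgD[OF assms] in \<open>auto simp: algebra_simps\<close>)
  show "Group.comm_monoid (ring_on A)"
    by (rule comm_monoidI) (use subalgD[OF assms] in \<open>auto simp: algebra_simps\<close>)
qed (auto simp: algebra_simps)

lemma uminus_ring_on:
  assumes "subalg A" "a \<in> A"
  shows "\<ominus>\<^bsub>ring_on A\<^esub> a = - a"
proof -
  interpret cring "ring_on A" by (rule cring_ring_on) fact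
  show ?thesis
    using minus_equality[of "- a" a] subalgD[OF assms(1)] assms by simp
qed

lemma ideal_ring_on_iff:
  assumes A: "subalg A"
  shows "ideal I (ring_on A) \<longleftrightarrow>
    I \<subseteq> A \<and> 0 \<in> I \<and> (\<forall>a\<in>I. \<forall>b\<in>I. a + b \<in> I) \<and> (\<forall>a\<in>A. \<forall>b\<in>I. a * b \<in> I)" (is "_ \<longleftrightarrow> ?R")
proof
  interpret cring "ring_on A" by (rule cring_ring_on) fact
  assume "ideal I (ring_on A)"
  then interpret ideal I "ring_on A" .
  show ?R
    using a_subset I_l_closed zero_closed a_closed by auto
next
  interpret cring "ring_on A" by (rule cring_ring_on) fact
  assume R: ?R
  show "ideal I (ring_on A)"
  proof (rule idealI[OF ring_axioms])
    have "- b \<in> I" if "b \<in> I" for b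
    proof -
      have "- 1 \<in> A" using subalgD[OF A] by metis
      with R that have "- 1 * b \<in> I" by blast
      then show ?thesis by simp
    qed
    then show "subgroup I (add_monoid (ring_on A))"
      using R by (intro add.subgroupI) (auto simp: uminus_ring_on[OF A] subset_iff simp flip: a_inv_def)
    show "a \<otimes>\<^bsub>ring_on A\<^esub> x \<in> I" if "a \<in> I" "x \<in> carrier (ring_on A)" for a x
    proof -
      have "x * a \<in> I" using R that by auto
      then show ?thesis by (simp add: mult.commute)
    qed
  qed (use R in auto)
qed

definition unit_in :: "'k::field ratfun set \<Rightarrow> 'k ratfun \<Rightarrow> bool" where
  "unit_in A a \<longleftrightarrow> a \<noteq> 0 \<and> a \<in> A \<and> inverse a \<in> A"

lemma Units_ring_on: "subalg A \<Longrightarrow> Units (ring_on A) = {a. unit_in A a}"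
  by (auto simp: Units_def unit_in_def intro!: bexI[of _ "inverse _"] dest: inverse_unique)

lemma max_ideal_eq: "subalg A \<Longrightarrow> max_ideal A = {a \<in> A. \<not> unit_in A a}"
  by (auto simp: max_ideal_def Units_ring_on)

lemma unit_in_mult_iff:
  assumes "subalg A" "a \<in> A" "b \<in> A"
  shows "unit_in A (a * b) \<longleftrightarrow> unit_in A a \<and> unit_in A b"
proof
  assume u: "unit_in A (a * b)"
  have "b * inverse (a * b) \<in> A" "a * inverse (a * b) \<in> A"
    using u assms subalgD(5)[OF assms(1)] by (auto simp: unit_in_def)
  moreover have "b * inverse (a * b) = inverse a" "a * inverse (a * b) = inverse b"
    using u by (auto simp: unit_in_def field_simps)
  ultimately have "inverse a \<in> A" "inverse b \<in> A" by (simp_all only:)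
  then show "unit_in A a \<and> unit_in A b"
    using u assms by (auto simp: unit_in_def)
qed (use subalgD(5)[OF assms(1)] in \<open>auto simp: unit_in_def\<close>)

lemma unit_in_inverse: "unit_in A a \<Longrightarrow> unit_in A (inverse a)"
  by (auto simp: unit_in_def)

lemma unit_in_const: "subalg A \<Longrightarrow> c \<noteq> 0 \<Longrightarrow> unit_in A (const c)"
  using subalgD(1) by (auto simp: unit_in_def const_inverse)

lemma unit_in_mono: "A \<subseteq> B \<Longrightarrow> unit_in A a \<Longrightarrow> unit_in B a"
  by (auto simp: unit_in_def)

text \<open>Equivalent to the non-units being closed under addition. Stated with units, the
  condition can be applied directly to an equation whose one side is a unit.\<close>

definition local_subalg :: "'k::field ratfun set \<Rightarrow> bool" where
  "local_subalg S \<longleftrightarrow> subalg S \<and> (\<forall>a\<in>S. \<forall>b\<in>S. unit_in S (a + b) \<longrightarrow> unit_in S a \<or> unit_in S b)"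

lemma local_subalgD: "local_subalg S \<Longrightarrow> subalg S"
  by (simp add: local_subalg_def)

lemma max_ideal_closed:
  assumes "local_subalg S"
  shows "0 \<in> max_ideal S" "a \<in> max_ideal S \<Longrightarrow> b \<in> max_ideal S \<Longrightarrow> a + b \<in> max_ideal S"
    "a \<in> S \<Longrightarrow> b \<in> max_ideal S \<Longrightarrow> a * b \<in> max_ideal S"
  using assms subalgD[OF local_subalgD[OF assms]] unit_in_mult_iff[OF local_subalgD[OF assms]]
  unfolding local_subalg_def
  by (auto simp: max_ideal_eq) (auto simp: unit_in_def)

lemma unit_plus_max:
  assumes "local_subalg S" "unit_in S a" "b \<in> max_ideal S"
  shows "unit_in S (a + b)"
proof (rule ccontr)
  note S = local_subalgD[OF assms(1)]
  assume n: "\<not> unit_in S (a + b)"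
  have b: "b \<in> S" "\<not> unit_in S b"
    using assms(3) by (auto simp: max_ideal_eq[OF S])
  have a: "a \<in> S" using assms(2) by (simp add: unit_in_def)
  have "unit_in S ((a + b) + (- 1) * b)"
    using assms(2) by simp
  moreover have "a + b \<in> S" "(- 1) * b \<in> S"
    using subalgD[OF S] a b by auto
  ultimately have "unit_in S ((- 1) * b)"
    using assms(1) n unfolding local_subalg_def by blast
  then show False
    using b unit_in_mult_iff[OF S, of "-1" b] subalgD[OF S] by auto
qed

text \<open>\<open>S\<close> is the localization of \<open>A\<close> at the prime \<open>A \<inter> max_ideal S\<close>.\<close>

definition local_over :: "'k::field ratfun set \<Rightarrow> 'k ratfun set \<Rightarrow> bool" where
  "local_over A S \<longleftrightarrow> local_subalg S \<and> A \<subseteq> S \<and> (\<forall>z\<in>S. \<exists>a\<in>A. \<exists>b\<in>A. unit_in S b \<and> z = a / b)"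

text \<open>Removes primes from the description of points: the prime is recovered from
  \<open>S\<close> as the trace of its maximal ideal on \<open>A\<close>. What remains is a
  condition on \<open>S\<close> in which the ring \<open>A\<close> can be exchanged.\<close>

lemma affine_model_iff:
  assumes A: "subalg A"
  shows "S \<in> affine_model A \<longleftrightarrow> local_over A S"
proof
  assume "S \<in> affine_model A"
  then obtain P where P: "primeideal P (ring_on A)" and S: "S = localization A P"
    by (auto simp: affine_model_def)
  interpret primeideal P "ring_on A" by fact
  have id: "P \<subseteq> A" "0 \<in> P" "\<And>a b. a \<in> P \<Longrightarrow> b \<in> P \<Longrightarrow> a + b \<in> P"
    "\<And>a b. a \<in> A \<Longrightarrow> b \<in> P \<Longrightarrow> a * b \<in> P"
    using is_ideal by (auto simp: ideal_ring_on_iff[OF A])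
  have pr: "a \<in> P \<or> b \<in> P" if "a \<in> A" "b \<in> A" "a * b \<in> P" for a b
    using I_prime that by auto
  have "1 \<notin> P"
    using I_notcarr id(1,4) by (metis mult.right_neutral ring_on_simps(1) subset_antisym subsetI)
  note cl = subalgD[OF A]
  have S: "z \<in> S \<longleftrightarrow> (\<exists>a b. a \<in> A \<and> b \<in> A \<and> b \<notin> P \<and> z = a / b)" for z
    by (auto simp: S localization_def)
  have AS: "A \<subseteq> S"
  proof
    fix a assume "a \<in> A"
    then show "a \<in> S" using \<open>1 \<notin> P\<close> cl(3) S by (metis div_by_1)
  qed
  have nz: "b \<noteq> 0" if "b \<notin> P" for b
    using that id by auto
  have subS: "subalg S"
    unfolding subalg_def
  proof safe
    show "const c \<in> S" for c using AS cl by auto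
    fix y z assume "y \<in> S" "z \<in> S"
    then obtain a b c d where *: "a \<in> A" "b \<in> A" "b \<notin> P" "y = a / b"
      "c \<in> A" "d \<in> A" "d \<notin> P" "z = c / d"
      unfolding S by blast
    have "b * d \<in> A" "b * d \<notin> P" using *(2,3,6,7) cl(5) pr[of b d] by blast+
    moreover have "y + z = (a * d + c * b) / (b * d)" "y * z = (a * c) / (b * d)"
      using nz * by (auto simp: field_simps)
    moreover have "a * d + c * b \<in> A" "a * c \<in> A" using * cl by auto
    ultimately show "y + z \<in> S" "y * z \<in> S" unfolding S by blast+
  qed
  have unit: "unit_in S b" if "b \<in> A" "b \<notin> P" for b
  proof -
    have "1 / b \<in> S" using that cl unfolding S by blast
    then show ?thesis using that AS nz by (auto simp: unit_in_def inverse_eq_divide)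
  qed
  have unitD: "a \<notin> P" if u: "unit_in S (a / b)" and "a \<in> A" "b \<in> A" "b \<notin> P" for a b
  proof
    assume "a \<in> P"
    obtain c d where *: "c \<in> A" "d \<in> A" "d \<notin> P" "inverse (a / b) = c / d"
      using u S[of "inverse (a / b)"] unfolding unit_in_def by blast
    have "b * d = a * c"
      using that(1) * nz by (auto simp: unit_in_def field_simps)
    then have "b * d \<in> P" using id(4)[OF \<open>c \<in> A\<close> \<open>a \<in> P\<close>] by (simp add: mult.commute)
    then show False using pr[of b d] * that by auto
  qed
  have "local_subalg S"
    unfolding local_subalg_def
  proof safe
    fix y z assume u: "unit_in S (y + z)" and nu: "\<not> unit_in S z" and "y \<in> S" "z \<in> S"
    obtain a b c d where *: "a \<in> A" "b \<in> A" "b \<notin> P" "y = a / b"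
      "c \<in> A" "d \<in> A" "d \<notin> P" "z = c / d"
      using \<open>y \<in> S\<close> \<open>z \<in> S\<close> unfolding S by blast
    have bd: "b * d \<in> A" "b * d \<notin> P" using *(2,3,6,7) cl(5) pr[of b d] by blast+
    have e: "y + z = (a * d + c * b) / (b * d)" using nz * by (auto simp: field_simps)
    have "a * d + c * b \<in> A" by (intro cl(4,5) *(1,2,5,6))
    then have "a * d + c * b \<notin> P"
      using u unitD[of "a * d + c * b" "b * d"] bd unfolding e by blast
    moreover have "c \<in> P"
    proof (rule ccontr)
      assume "c \<notin> P"
      then have "unit_in S c" "unit_in S (inverse d)"
        using unit[of c] unit[of d] *(5-7) unit_in_inverse by blast+
      then have "unit_in S (c * inverse d)"
        using unit_in_mult_iff[OF subS, of c "inverse d"] by (auto simp: unit_in_def)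
      then show False using nu * by (simp add: divide_inverse)
    qed
    ultimately have "a \<notin> P"
      using id(3)[of "a * d" "c * b"] id(4)[of d a] id(4)[of b c] *(2,6) by (auto simp: mult.commute)
    then have "unit_in S a" "unit_in S (inverse b)"
      using unit[of a] unit[of b] *(1-3) unit_in_inverse by blast+
    then have "unit_in S (a * inverse b)"
      using unit_in_mult_iff[OF subS, of a "inverse b"] by (auto simp: unit_in_def)
    then show "unit_in S y" using * by (simp add: divide_inverse)
  qed (fact subS)
  then show "local_over A S"
    using AS S unit unfolding local_over_def by blast
next
  assume L: "local_over A S"
  then have loc: "local_subalg S" and AS: "A \<subseteq> S"
    and fr: "\<And>z. z \<in> S \<Longrightarrow> \<exists>a\<in>A. \<exists>b\<in>A. unit_in S b \<and> z = a / b"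
    by (auto simp: local_over_def)
  note sub = local_subalgD[OF loc]
  define P where "P = A \<inter> max_ideal S"
  have mem: "a \<in> P \<longleftrightarrow> a \<in> A \<and> \<not> unit_in S a" for a
    using AS by (auto simp: P_def max_ideal_eq[OF sub])
  interpret cring "ring_on A" by (rule cring_ring_on) fact
  have "primeideal P (ring_on A)"
  proof (rule primeidealI)
    show "ideal P (ring_on A)"
      unfolding ideal_ring_on_iff[OF A]
      using max_ideal_closed[OF loc] AS subalgD[OF A] by (auto simp: P_def)
    show "cring (ring_on A)" by (rule is_cring)
    show "carrier (ring_on A) \<noteq> P"
      using subalgD[OF A] subalgD[OF sub] mem[of 1] by (auto simp: unit_in_def)
    show "a \<in> P \<or> b \<in> P" if "a \<in> carrier (ring_on A)" "b \<in> carrier (ring_on A)"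
      "a \<otimes>\<^bsub>ring_on A\<^esub> b \<in> P" for a b
      using that unit_in_mult_iff[OF sub, of a b] AS by (auto simp: mem)
  qed
  moreover have "S = localization A P"
  proof safe
    fix z assume "z \<in> S"
    then show "z \<in> localization A P"
      using fr[of z] by (auto simp: localization_def mem)
  next
    fix z assume "z \<in> localization A P"
    then obtain a b where "a \<in> A" "unit_in S b" "z = a / b"
      by (auto simp: localization_def mem)
    then show "z \<in> S"
      using subalgD(5)[OF sub, of a "inverse b"] AS by (auto simp: unit_in_def divide_inverse)
  qed
  ultimately show "S \<in> affine_model A" by (auto simp: affine_model_def)
qed

text \<open>Two rings have the same local ring at a point as soon as the elements of one are
  fractions over the other with denominators invertible at that point. This compares different
  charts of a blowup.\<close>

lemma local_over_change:
  assumes "local_over A S" "subalg B" "B \<subseteq> S"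
    and "\<And>a. a \<in> A \<Longrightarrow> \<exists>b\<in>B. \<exists>c\<in>B. unit_in S c \<and> a = b / c"
  shows "local_over B S"
  unfolding local_over_def
proof (intro conjI ballI)
  show loc: "local_subalg S" using assms(1) by (simp add: local_over_def)
  show "B \<subseteq> S" by fact
  fix z assume "z \<in> S"
  then obtain a b where *: "a \<in> A" "b \<in> A" "unit_in S b" "z = a / b"
    using assms(1) by (auto simp: local_over_def)
  obtain a1 a2 where a: "a1 \<in> B" "a2 \<in> B" "unit_in S a2" "a = a1 / a2"
    using assms(4) * by blast
  obtain b1 b2 where b: "b1 \<in> B" "b2 \<in> B" "unit_in S b2" "b = b1 / b2"
    using assms(4) * by blast
  note sub = local_subalgD[OF loc]
  have "unit_in S (b * b2)" using * b unit_in_mult_iff[OF sub] by (metis unit_in_def)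
  moreover have "b * b2 = b1" using b by (auto simp: unit_in_def)
  ultimately have b1: "unit_in S b1" by simp
  then have "unit_in S (b1 * a2)" using unit_in_mult_iff[OF sub] a by (metis unit_in_def)
  moreover have "z = (a1 * b2) / (b1 * a2)"
    using * a b b1 by (simp add: field_simps unit_in_def)
  moreover have "a1 * b2 \<in> B" "b1 * a2 \<in> B"
    using a b subalgD[OF assms(2)] by auto
  ultimately show "\<exists>a\<in>B. \<exists>b\<in>B. unit_in S b \<and> z = a / b" by blast
qed

lemma generate_ring_minimal:
  assumes "subalg A" "H \<subseteq> A"
  shows "generate_ring (ring_on UNIV) H \<subseteq> A"
proof
  have U: "subalg (UNIV :: 'a ratfun set)" by (simp add: subalg_def)
  fix z assume "z \<in> generate_ring (ring_on UNIV) H"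
  then show "z \<in> A"
    by induction (use assms subalgD[OF assms(1)] in \<open>auto simp: uminus_ring_on[OF U]\<close>)
qed

lemma subalg_generate_ring: "range const \<subseteq> H \<Longrightarrow> subalg (generate_ring (ring_on UNIV) H)"
  unfolding subalg_def
  using generate_ring.incl[of _ H] generate_ring.eng_add[of _ "ring_on UNIV" H]
    generate_ring.eng_mult[of _ "ring_on UNIV" H] by auto

section \<open>Fraction fields\<close>

text \<open>The fraction field of \<open>A\<close> inside the function field. A denominator 0 does
  no harm, because \<open>a / 0 = 0\<close>.\<close>

definition quotients :: "'k::field ratfun set \<Rightarrow> 'k ratfun set" where
  "quotients A = {a / b | a b. a \<in> A \<and> b \<in> A}"

lemma quotients_divide:
  assumes "subalg A" "y \<in> quotients A" "z \<in> quotients A"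
  shows "y / z \<in> quotients A"
proof -
  obtain a b c d where "a \<in> A" "b \<in> A" "c \<in> A" "d \<in> A" "y = a / b" "z = c / d"
    using assms(2,3) unfolding quotients_def by blast
  then have "a * d \<in> A" "b * c \<in> A" "y / z = (a * d) / (b * c)"
    using subalgD[OF assms(1)] by auto
  then show ?thesis unfolding quotients_def by blast
qed

lemma subset_quotients: "subalg A \<Longrightarrow> A \<subseteq> quotients A"
  unfolding quotients_def using subalgD(3) by (force intro: exI[of _ 1])

lemma subalg_quotients:
  assumes A: "subalg A"
  shows "subalg (quotients A)"
  unfolding subalg_def
proof safe
  show "const c \<in> quotients A" for c using subset_quotients[OF A] subalgD[OF A] by auto
  fix y z assume y: "y \<in> quotients A" and z: "z \<in> quotients A"
  show "y * z \<in> quotients A"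
    using quotients_divide[OF A y quotients_divide[OF A _ z, of 1]] subset_quotients[OF A] subalgD[OF A] by auto
  obtain a b c d where *: "a \<in> A" "b \<in> A" "c \<in> A" "d \<in> A" "y = a / b" "z = c / d"
    using y z unfolding quotients_def by blast
  show "y + z \<in> quotients A"
  proof (cases "b = 0 \<or> d = 0")
    case True then show ?thesis using * y z by auto
  next
    case False
    then have "y + z = (a * d + c * b) / (b * d)" using * by (simp add: field_simps)
    moreover have "a * d + c * b \<in> A" "b * d \<in> A" using * subalgD[OF A] by auto
    ultimately show ?thesis unfolding quotients_def by blast
  qed
qed

text \<open>Complements \<open>indep\<close>: the pair generates the function field. It ensures that
  every rational function is a power of a uniformizer times a unit along the divisors
  considered.\<close>

definition full :: "'k::field ratfun \<Rightarrow> 'k ratfun \<Rightarrow> bool" where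
  "full x y \<longleftrightarrow> quotients (range (ev x y)) = UNIV"

lemma full_imp_quotients_UNIV:
  assumes "full x y" "subalg A" "x \<in> quotients A" "y \<in> quotients A"
  shows "quotients A = UNIV"
proof -
  have "ev x y g \<in> quotients A" for g
    by (intro ev_in_subalg subalg_quotients assms)
  then have "quotients (range (ev x y)) \<subseteq> quotients A"
    using quotients_divide[OF assms(2)] unfolding quotients_def[of "range (ev x y)"] by blast
  then show ?thesis using assms(1) by (auto simp: full_def)
qed

lemma full_change:
  assumes "full x y" "x \<in> quotients (range (ev x' y'))" "y \<in> quotients (range (ev x' y'))"
  shows "full x' y'"
  using full_imp_quotients_UNIV[OF assms(1) subalg_range_ev assms(2,3)] by (simp add: full_def)

lemma gen_in_quotients: "x \<in> quotients (range (ev x y))" "y \<in> quotients (range (ev x y))"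
  by (intro subsetD[OF subset_quotients[OF subalg_range_ev]] gen_in_range_ev)+

lemma full_swap: "full x y \<Longrightarrow> full y x"
  by (simp add: full_def range_ev_swap)

lemma full_shift: "full x y \<Longrightarrow> full (x - const a) (y - const b)"
  by (simp add: full_def range_ev_shift)

lemma full_inverse:
  assumes "full x y"
  shows "full (inverse x) y"
proof (rule full_change[OF assms])
  have "1 / inverse x \<in> quotients (range (ev (inverse x) y))"
    by (intro quotients_divide subalgD(3)[OF subalg_quotients] subalg_range_ev gen_in_quotients)
  then show "x \<in> quotients (range (ev (inverse x) y))" by (simp only: inverse_eq_divide[symmetric] inverse_inverse_eq)
qed (rule gen_in_quotients)

lemma full_blowup:
  assumes "full x y" "x \<noteq> 0"
  shows "full x (y / x)"
proof (rule full_change[OF assms(1)])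
  have "x * (y / x) \<in> quotients (range (ev x (y / x)))"
    by (intro subalgD(5)[OF subalg_quotients] subalg_range_ev gen_in_quotients)
  then show "y \<in> quotients (range (ev x (y / x)))" using assms by simp
qed (rule gen_in_quotients)

lemma full_linear:
  assumes "full x y" "a \<noteq> 0"
  shows "full (const a * x + const b * y) y"
proof (rule full_change[OF assms(1)])
  let ?u = "const a * x + const b * y"
  have "(?u - const b * y) / const a \<in> quotients (range (ev ?u y))"
    by (intro quotients_divide subalgD(1,5,7)[OF subalg_quotients] subalg_range_ev gen_in_quotients)
  then show "x \<in> quotients (range (ev ?u y))" using assms by simp
qed (rule gen_in_quotients)

lemma full_coords: "full (hcoord 1) (hcoord 2 :: 'k::field ratfun)"
  unfolding full_def
proof safe
  fix z :: "'k ratfun"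
  obtain a b where "z = Fract a b" by (cases z) auto
  then have "z = ev (hcoord 2) (hcoord 1) a / ev (hcoord 2) (hcoord 1) b"
    by (simp only: ev_hcoord Fract_conv_to_fract)
  then show "z \<in> quotients (range (ev (hcoord 1) (hcoord 2)))"
    unfolding range_ev_swap[of "hcoord 1"] quotients_def by blast
qed simp

section \<open>Localizations of a bivariate polynomial ring\<close>

definition prime_compl :: "'k::field poly poly set \<Rightarrow> bool" where
  "prime_compl N \<longleftrightarrow> 1 \<in> N \<and> 0 \<notin> N \<and> (\<forall>a b. a * b \<in> N \<longleftrightarrow> a \<in> N \<and> b \<in> N) \<and>
     (\<forall>a b. a + b \<in> N \<longrightarrow> a \<in> N \<or> b \<in> N)"

definition loc_ev :: "'k::field ratfun \<Rightarrow> 'k ratfun \<Rightarrow> 'k poly poly set \<Rightarrow> 'k ratfun set" where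
  "loc_ev x y N = {ev x y g / ev x y h | g h. h \<in> N}"

lemma local_over_loc_ev:
  assumes "indep x y" and N: "prime_compl N"
  shows "local_over (range (ev x y)) (loc_ev x y N)"
proof -
  note ev_iff = indep_ev_eq_iff[OF assms(1)]
  define P where "P = ev x y ` (- N)"
  have mem: "ev x y g \<in> P \<longleftrightarrow> g \<notin> N" for g
    by (auto simp: P_def ev_iff image_iff)
  have id: "ideal P (ring_on (range (ev x y)))"
    unfolding ideal_ring_on_iff[OF subalg_range_ev]
  proof (intro conjI ballI)
    show "0 \<in> P" using N mem[of 0] by (simp add: prime_compl_def)
    fix a b
    assume "b \<in> P"
    then obtain b' where b': "b' \<notin> N" "b = ev x y b'" by (auto simp: P_def)
    show "a + b \<in> P" if "a \<in> P"
    proof -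
      from that obtain a' where a': "a' \<notin> N" "a = ev x y a'" by (auto simp: P_def)
      show ?thesis using N a' b' mem[of "a' + b'"] unfolding prime_compl_def by (metis ev_simps(3))
    qed
    show "a * b \<in> P" if "a \<in> range (ev x y)"
    proof -
      from that obtain a' where a': "a = ev x y a'" by auto
      show ?thesis using N a' b' mem[of "a' * b'"] unfolding prime_compl_def by (metis ev_simps(4))
    qed
  qed (auto simp: P_def)
  have "primeideal P (ring_on (range (ev x y)))"
  proof (rule primeidealI[OF id cring_ring_on[OF subalg_range_ev]])
    show "carrier (ring_on (range (ev x y))) \<noteq> P"
      using mem[of 1] N by (metis prime_compl_def rangeI ring_on_simps(1))
    fix a b assume "a \<in> carrier (ring_on (range (ev x y)))" "b \<in> carrier (ring_on (range (ev x y)))"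
      and ab: "a \<otimes>\<^bsub>ring_on (range (ev x y))\<^esub> b \<in> P"
    then obtain a' b' where "a = ev x y a'" "b = ev x y b'" by auto
    then show "a \<in> P \<or> b \<in> P"
      using ab mem[of "a' * b'"] N by (auto simp: mem prime_compl_def)
  qed
  moreover have "loc_ev x y N = localization (range (ev x y)) P"
    unfolding loc_ev_def localization_def using mem by blast
  ultimately show ?thesis
    unfolding affine_model_iff[OF subalg_range_ev, symmetric] affine_model_def by blast
qed

lemma unit_in_loc_ev:
  assumes "indep x y" and N: "prime_compl N"
  shows "unit_in (loc_ev x y N) (ev x y g) \<longleftrightarrow> g \<in> N"
proof
  assume u: "unit_in (loc_ev x y N) (ev x y g)"
  then obtain a h where h: "h \<in> N" "inverse (ev x y g) = ev x y a / ev x y h"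
    by (auto simp: unit_in_def loc_ev_def)
  then have "ev x y h \<noteq> 0"
    using N indep_ev_eq_0_iff[OF assms(1)] by (auto simp: prime_compl_def)
  then have "ev x y h = ev x y (a * g)"
    using h u by (auto simp: unit_in_def field_simps)
  then have "h = a * g" using indep_ev_eq_iff[OF assms(1)] by blast
  then show "g \<in> N" using h N by (auto simp: prime_compl_def)
next
  assume "g \<in> N"
  moreover have "ev x y g = ev x y g / ev x y 1" "inverse (ev x y g) = ev x y 1 / ev x y g"
    by (simp_all add: inverse_eq_divide)
  moreover have "1 \<in> N" using N by (simp add: prime_compl_def)
  ultimately have "ev x y g \<in> loc_ev x y N" "inverse (ev x y g) \<in> loc_ev x y N"
    unfolding loc_ev_def by blast+
  moreover have "ev x y g \<noteq> 0"
    using \<open>g \<in> N\<close> N indep_ev_eq_0_iff[OF assms(1)] by (auto simp: prime_compl_def)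
  ultimately show "unit_in (loc_ev x y N) (ev x y g)" by (simp add: unit_in_def)
qed

text \<open>The point \<open>x = y = 0\<close> and the generic point of the curve \<open>x = 0\<close>.\<close>

definition pt :: "'k::field ratfun \<Rightarrow> 'k ratfun \<Rightarrow> 'k point" where
  "pt x y = loc_ev x y {h. poly (poly h 0) 0 \<noteq> 0}"

definition dv :: "'k::field ratfun \<Rightarrow> 'k ratfun \<Rightarrow> 'k point" where
  "dv x y = loc_ev x y {h. poly h 0 \<noteq> 0}"

lemma prime_compl_pt: "prime_compl {h. poly (poly h 0) 0 \<noteq> 0}"
  by (auto simp: prime_compl_def)

lemma prime_compl_dv: "prime_compl {h. poly h 0 \<noteq> 0}"
  by (auto simp: prime_compl_def)

lemma local_over_pt: "indep x y \<Longrightarrow> local_over (range (ev x y)) (pt x y)"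
  unfolding pt_def by (intro local_over_loc_ev prime_compl_pt)

lemma local_over_dv: "indep x y \<Longrightarrow> local_over (range (ev x y)) (dv x y)"
  unfolding dv_def by (intro local_over_loc_ev prime_compl_dv)

lemma unit_in_pt: "indep x y \<Longrightarrow> unit_in (pt x y) (ev x y g) \<longleftrightarrow> poly (poly g 0) 0 \<noteq> 0"
  unfolding pt_def by (subst unit_in_loc_ev) (auto simp: prime_compl_pt)

lemma unit_in_dv: "indep x y \<Longrightarrow> unit_in (dv x y) (ev x y g) \<longleftrightarrow> poly g 0 \<noteq> 0"
  unfolding dv_def by (subst unit_in_loc_ev) (auto simp: prime_compl_dv)

lemma local_over_localD: "local_over A S \<Longrightarrow> local_subalg S"
  by (simp add: local_over_def)

lemma local_subalg_pt: "indep x y \<Longrightarrow> local_subalg (pt x y)"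
  using local_over_pt local_over_localD by blast

lemma local_subalg_dv: "indep x y \<Longrightarrow> local_subalg (dv x y)"
  using local_over_dv local_over_localD by blast

lemma local_over_subset: "local_over A S \<Longrightarrow> A \<subseteq> S"
  by (simp add: local_over_def)

lemma ev_in_pt: "indep x y \<Longrightarrow> ev x y g \<in> pt x y"
  using local_over_subset[OF local_over_pt] by blast

lemma ev_in_dv: "indep x y \<Longrightarrow> ev x y g \<in> dv x y"
  using local_over_subset[OF local_over_dv] by blast

lemma gen_in_max_pt:
  assumes "indep x y"
  shows "x \<in> max_ideal (pt x y)" "y \<in> max_ideal (pt x y)"
  using unit_in_pt[OF assms, of pX] unit_in_pt[OF assms, of pY]
    ev_in_pt[OF assms, of pX] ev_in_pt[OF assms, of pY]
    max_ideal_eq[OF local_subalgD[OF local_subalg_pt[OF assms]]] by auto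

lemma gen_in_max_dv: "indep x y \<Longrightarrow> x \<in> max_ideal (dv x y)"
  using unit_in_dv[of x y pX] ev_in_dv[of x y pX]
    max_ideal_eq[OF local_subalgD[OF local_subalg_dv[of x y]]] by auto

lemma bipoly_decomp: "\<exists>g1 g2. g = pC (poly (poly g 0) 0) + pX * g1 + pY * g2"
proof -
  obtain a g1 where g: "g = pCons a g1" by (cases g)
  obtain c q where a: "a = pCons c q" by (cases a)
  have "g = pC (poly (poly g 0) 0) + pX * g1 + pY * [:q:]"
    by (simp add: g a pX_def pY_def pC_def)
  then show ?thesis by blast
qed

text \<open>The residue field at the origin is the ground field: with \<open>c\<close> the value of
  the fraction at the origin, \<open>g - pC c * h\<close> has no constant term and is a combination
  of the two variables.\<close>

lemma pt_decomp:
  assumes "indep x y" "z \<in> pt x y"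
  obtains c a b where "a \<in> pt x y" "b \<in> pt x y" "z = const c + x * a + y * b"
proof -
  obtain g h where z: "z = ev x y g / ev x y h" and h: "poly (poly h 0) 0 \<noteq> 0"
    using assms(2) by (auto simp: pt_def loc_ev_def)
  define c where "c = poly (poly g 0) 0 / poly (poly h 0) 0"
  obtain g1 g2 where "g - pC c * h = pC (poly (poly (g - pC c * h) 0) 0) + pX * g1 + pY * g2"
    using bipoly_decomp by blast
  also have "poly (poly (g - pC c * h) 0) 0 = 0" using h by (simp add: c_def)
  finally have "g = pC c * h + pX * g1 + pY * g2" by (simp add: algebra_simps)
  then have "ev x y g = ev x y (pC c * h + pX * g1 + pY * g2)" by (rule arg_cong)
  then have e: "ev x y g = const c * ev x y h + x * ev x y g1 + y * ev x y g2" by simp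
  have "ev x y h \<noteq> 0" using h unit_in_pt[OF assms(1)] by (auto simp: unit_in_def)
  with e have "z = const c + x * (ev x y g1 / ev x y h) + y * (ev x y g2 / ev x y h)"
    by (simp add: z field_simps)
  moreover have "ev x y g1 / ev x y h \<in> pt x y" "ev x y g2 / ev x y h \<in> pt x y"
    using h by (auto simp: pt_def loc_ev_def)
  ultimately show ?thesis using that by blast
qed

lemma max_pt_decomp:
  assumes "indep x y" "z \<in> max_ideal (pt x y)"
  obtains a b where "a \<in> pt x y" "b \<in> pt x y" "z = x * a + y * b"
proof -
  note loc = local_subalg_pt[OF assms(1)]
  note sub = local_subalgD[OF loc]
  have z: "z \<in> pt x y" "\<not> unit_in (pt x y) z"
    using assms(2) by (auto simp: max_ideal_eq[OF sub])
  obtain c a b where *: "a \<in> pt x y" "b \<in> pt x y" "z = const c + x * a + y * b"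
    using pt_decomp[OF assms(1) z(1)] by blast
  have "a * x + b * y \<in> max_ideal (pt x y)"
    by (intro max_ideal_closed[OF loc] gen_in_max_pt * assms)
  then have "c \<noteq> 0 \<Longrightarrow> unit_in (pt x y) (const c + (a * x + b * y))"
    by (intro unit_plus_max[OF loc] unit_in_const sub) auto
  moreover have "const c + (a * x + b * y) = z" using * by (simp add: algebra_simps)
  ultimately have "c = 0" using z by auto
  then show ?thesis using that * by auto
qed

text \<open>A denominator of \<open>pt x y\<close> is a nonzero constant plus a combination of
  \<open>x\<close> and \<open>y\<close>, hence a unit in any local ring where both vanish.\<close>

lemma pt_minimal:
  assumes S: "local_subalg S" "x \<in> max_ideal S" "y \<in> max_ideal S"
  shows "pt x y \<subseteq> S"
proof
  note sub = local_subalgD[OF S(1)]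
  have xy: "x \<in> S" "y \<in> S" using S by (auto simp: max_ideal_eq[OF sub])
  fix z assume "z \<in> pt x y"
  then obtain g h where z: "z = ev x y g / ev x y h" and h: "poly (poly h 0) 0 \<noteq> 0"
    by (auto simp: pt_def loc_ev_def)
  obtain h1 h2 where "h = pC (poly (poly h 0) 0) + pX * h1 + pY * h2"
    using bipoly_decomp by blast
  then have "ev x y h = ev x y (pC (poly (poly h 0) 0) + pX * h1 + pY * h2)" by (rule arg_cong)
  then have "ev x y h = const (poly (poly h 0) 0) + (ev x y h1 * x + ev x y h2 * y)"
    by (simp add: algebra_simps)
  moreover have "ev x y h1 * x + ev x y h2 * y \<in> max_ideal S"
    by (intro max_ideal_closed[OF S(1)] S ev_in_subalg sub xy)
  ultimately have "unit_in S (ev x y h)"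
    using unit_plus_max[OF S(1) unit_in_const[OF sub h]] by simp
  then show "z \<in> S"
    using subalgD(5)[OF sub ev_in_subalg[OF sub xy], of "inverse (ev x y h)" g]
    by (auto simp: z unit_in_def divide_inverse)
qed

lemma pt_swap: "indep x y \<Longrightarrow> pt x y = pt y x"
  by (intro subset_antisym pt_minimal local_subalg_pt gen_in_max_pt) (auto intro: indep_swap)

text \<open>A denominator that vanishes on \<open>x = 0\<close> would be a multiple of
  \<open>x\<close> and could not be a unit of \<open>S\<close>. The local ring of the generic point
  is therefore the largest one, as the definition of \<open>generic_point\<close> demands.\<close>

lemma dv_minimal:
  assumes S: "local_over (range (ev x y)) S" "x \<in> max_ideal S"
  shows "S \<subseteq> dv x y"
proof
  note loc = local_over_localD[OF S(1)]
  note sub = local_subalgD[OF loc]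
  fix z assume "z \<in> S"
  then obtain g h where z: "unit_in S (ev x y h)" "z = ev x y g / ev x y h"
    using S(1) unfolding local_over_def by blast
  have "poly h 0 \<noteq> 0"
  proof
    assume "poly h 0 = 0"
    then obtain h' where "h = pX * h'"
      by (cases h) (auto simp: pX_def)
    then have e: "ev x y h = ev x y h' * x" by simp
    have "ev x y h' * x \<in> max_ideal S"
      using local_over_subset[OF S(1)] by (intro max_ideal_closed[OF loc] S) blast
    then show False using z(1) by (simp add: e max_ideal_eq[OF sub])
  qed
  then show "z \<in> dv x y" using z by (auto simp: dv_def loc_ev_def)
qed

section \<open>The exceptional divisor\<close>

lemma pt_subset:
  assumes "local_subalg S" "x \<in> max_ideal S" "y / x \<in> S" "x \<noteq> 0"
  shows "pt x y \<subseteq> S"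
proof (rule pt_minimal[OF assms(1,2)])
  have "(y / x) * x \<in> max_ideal S"
    by (intro max_ideal_closed[OF assms(1)] assms)
  then show "y \<in> max_ideal S" using assms by simp
qed

text \<open>The chart \<open>R[m/x]\<close> has the same local rings over the closed point as the
  polynomial ring in \<open>x\<close> and \<open>y / x\<close>, because an element of
  \<open>m / x\<close> has the form \<open>a + (y / x) * b\<close> with \<open>a\<close>,
  \<open>b\<close> in \<open>R\<close>.\<close>

lemma exceptionalI:
  assumes xy: "indep x y" and S: "local_over (range (ev x (y / x))) S" "x \<in> max_ideal S"
  shows "S \<in> exceptional (pt x y)"
proof -
  note loc = local_over_localD[OF S(1)]
  note sub = local_subalgD[OF loc]
  note x0 = indep_nonzero(1)[OF xy]
  let ?R = "pt x y"
  note subR = local_subalgD[OF local_subalg_pt[OF xy]]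
  have w: "y / x \<in> S" using local_over_subset[OF S(1)] gen_in_range_ev(2) by blast
  have RS: "?R \<subseteq> S" by (rule pt_subset[OF loc S(2) w x0])
  have "x * (y / x) \<in> max_ideal S"
    using max_ideal_closed(3)[OF loc w S(2)] by (simp add: mult.commute)
  then have y: "y \<in> max_ideal S" using x0 by simp
  have "max_ideal ?R \<subseteq> max_ideal S"
  proof
    fix z assume "z \<in> max_ideal ?R"
    then obtain a b where ab: "a \<in> ?R" "b \<in> ?R" "z = x * a + y * b"
      using max_pt_decomp[OF xy] by blast
    have "a * x + b * y \<in> max_ideal S"
      using ab by (intro max_ideal_closed[OF loc] S(2) y) (use RS in blast)+
    then show "z \<in> max_ideal S" using ab by (simp add: algebra_simps)
  qed
  then have dom: "dominates S ?R" using RS by (simp add: dominates_def)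
  let ?B = "blowup_chart ?R x"
  let ?H = "?R \<union> {z / x | z. z \<in> max_ideal ?R}"
  have H: "range const \<subseteq> ?H" using subalgD[OF subR] by auto
  have subB: "subalg ?B" unfolding blowup_chart_def by (rule subalg_generate_ring[OF H])
  have HB: "?H \<subseteq> ?B" unfolding blowup_chart_def using generate_ring.incl[of _ ?H] by blast
  have "?H \<subseteq> S"
  proof -
    have "z / x \<in> S" if z: "z \<in> max_ideal ?R" for z
    proof -
      obtain a b where *: "a \<in> ?R" "b \<in> ?R" "z = x * a + y * b"
        using max_pt_decomp[OF xy z] by blast
      then have "z / x = a + (y / x) * b" using x0 by (simp add: field_simps)
      moreover have "a + (y / x) * b \<in> S"
        using *(1,2) RS by (intro subalgD(4,5)[OF sub] w) auto
      ultimately show ?thesis by simp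
    qed
    then show ?thesis using RS by blast
  qed
  then have BS: "?B \<subseteq> S" unfolding blowup_chart_def by (rule generate_ring_minimal[OF sub])
  have "x \<in> ?H" "y / x \<in> ?H" using gen_in_max_pt[OF xy] by (auto simp: max_ideal_eq[OF subR])
  then have "x \<in> ?B" "y / x \<in> ?B" using HB by blast+
  then have "ev x (y / x) g \<in> ?B" for g by (rule ev_in_subalg[OF subB])
  moreover have "1 \<in> ?B" "unit_in S 1" using subalgD[OF subB] subalgD[OF sub] by (auto simp: unit_in_def)
  ultimately have "\<exists>b\<in>?B. \<exists>c\<in>?B. unit_in S c \<and> a = b / c" if "a \<in> range (ev x (y / x))" for a
    using that by (metis div_by_1 imageE)
  then have "local_over ?B S" by (rule local_over_change[OF S(1) subB BS])
  then show ?thesis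
    using dom x0 gen_in_max_pt(1)[OF xy] unfolding exceptional_def affine_model_iff[OF subB, symmetric]
    by blast
qed

text \<open>If \<open>x / u\<close> is a unit at \<open>S\<close>, then \<open>u\<close> and
  \<open>x\<close> generate the same ideal there, so the chart of \<open>u\<close> may be replaced
  by that of \<open>x\<close>.\<close>

lemma exceptionalD_aux:
  assumes xy: "indep x y" and u: "u \<in> max_ideal (pt x y)" "u \<noteq> 0"
    and S: "local_over (blowup_chart (pt x y) u) S" "dominates S (pt x y)" "unit_in S (x / u)"
  shows "local_over (range (ev x (y / x))) S \<and> x \<in> max_ideal S"
proof
  let ?R = "pt x y" and ?B = "blowup_chart (pt x y) u" and ?A = "range (ev x (y / x))"
  let ?H = "?R \<union> {z / u | z. z \<in> max_ideal ?R}"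
  note loc = local_over_localD[OF S(1)]
  note sub = local_subalgD[OF loc]
  note x0 = indep_nonzero(1)[OF xy]
  note subR = local_subalgD[OF local_subalg_pt[OF xy]]
  show x: "x \<in> max_ideal S" using S(2) gen_in_max_pt[OF xy] by (auto simp: dominates_def)
  have RS: "?R \<subseteq> S" using S(2) by (simp add: dominates_def)
  have HB: "?H \<subseteq> ?B" unfolding blowup_chart_def using generate_ring.incl[of _ ?H] by blast
  have "y / u \<in> ?H" using gen_in_max_pt[OF xy] by auto
  then have yu: "y / u \<in> S" using HB local_over_subset[OF S(1)] by blast
  have "(y / u) * inverse (x / u) \<in> S"
    using S(3) by (intro subalgD(5)[OF sub yu]) (simp add: unit_in_def)
  moreover have "(y / u) * inverse (x / u) = y / x" using u by simp
  ultimately have w: "y / x \<in> S" by (simp only:)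
  have xS: "x \<in> S" using x by (simp add: max_ideal_eq[OF sub])
  have AS: "?A \<subseteq> S" using ev_in_subalg[OF sub xS w] by blast
  \<comment> \<open>The localization of \<open>?A\<close> at those of its elements that are units of
    \<open>S\<close>. Once \<open>?B \<subseteq> T\<close> is known, \<open>S\<close> is a local
    ring of \<open>?A\<close> as well.\<close>
  define T where "T = {b / c | b c. b \<in> ?A \<and> c \<in> ?A \<and> unit_in S c}"
  have T_div: "y / z \<in> T" if yz: "y \<in> T" "z \<in> T" and zu: "unit_in S z" for y z
  proof -
    obtain a b c d where *: "a \<in> ?A" "b \<in> ?A" "unit_in S b" "c \<in> ?A" "d \<in> ?A" "unit_in S d"
      "y = a / b" "z = c / d"
      using yz unfolding T_def by blast
    have "c = z * d" using * by (auto simp: unit_in_def)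
    then have "unit_in S c" using unit_in_mult_iff[OF sub, of z d] * zu by (auto simp: unit_in_def)
    then have "unit_in S (b * c)" using unit_in_mult_iff[OF sub, of b c] * by (auto simp: unit_in_def)
    moreover have "a * d \<in> ?A" "b * c \<in> ?A" by (intro subalgD(5)[OF subalg_range_ev] *)+
    moreover have "y / z = (a * d) / (b * c)" by (simp add: *)
    ultimately show ?thesis unfolding T_def by blast
  qed
  have AT: "?A \<subseteq> T"
  proof
    fix a assume "a \<in> ?A"
    moreover have "1 \<in> ?A" "unit_in S 1"
      using subalgD(3)[OF subalg_range_ev] subalgD[OF sub] by (auto simp: unit_in_def)
    ultimately show "a \<in> T" unfolding T_def by (metis (mono_tags, lifting) div_by_1 mem_Collect_eq)
  qed
  have subT: "subalg T"
    unfolding subalg_def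
  proof safe
    show "const c \<in> T" for c using AT subalgD(1)[OF subalg_range_ev] by blast
    fix y z assume "y \<in> T" "z \<in> T"
    then obtain a b c d where *: "a \<in> ?A" "b \<in> ?A" "unit_in S b" "c \<in> ?A" "d \<in> ?A" "unit_in S d"
      "y = a / b" "z = c / d"
      unfolding T_def by blast
    have "unit_in S (b * d)" using unit_in_mult_iff[OF sub, of b d] * by (auto simp: unit_in_def)
    moreover have "a * d + c * b \<in> ?A" "a * c \<in> ?A" "b * d \<in> ?A"
      by (intro subalgD(4,5)[OF subalg_range_ev] *)+
    moreover have "y + z = (a * d + c * b) / (b * d)" "y * z = (a * c) / (b * d)"
      using * by (auto simp: field_simps unit_in_def)
    ultimately show "y + z \<in> T" "y * z \<in> T" unfolding T_def by blast+
  qed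
  have gT: "x \<in> T" "y / x \<in> T" using AT gen_in_range_ev by blast+
  have "(y / x) * x \<in> T" by (intro subalgD(5)[OF subT] gT)
  then have yT: "y \<in> T" using x0 by simp
  have RT: "?R \<subseteq> T"
  proof
    fix z assume "z \<in> ?R"
    then obtain g h where z: "z = ev x y g / ev x y h" and h: "poly (poly h 0) 0 \<noteq> 0"
      by (auto simp: pt_def loc_ev_def)
    have "unit_in S (ev x y h)" using unit_in_mono[OF RS] h unit_in_pt[OF xy] by blast
    then show "z \<in> T" unfolding z by (intro T_div ev_in_subalg subT gT yT)
  qed
  have mT: "z / x \<in> T" if z: "z \<in> max_ideal ?R" for z
  proof -
    obtain a b where *: "a \<in> ?R" "b \<in> ?R" "z = x * a + y * b"
      using max_pt_decomp[OF xy z] by blast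
    then have "z / x = a + (y / x) * b" using x0 by (simp add: field_simps)
    moreover have "a + (y / x) * b \<in> T"
      using *(1,2) RT by (intro subalgD(4,5)[OF subT] gT) auto
    ultimately show ?thesis by simp
  qed
  have "z / u \<in> T" if z: "z \<in> max_ideal ?R" for z
  proof -
    have "unit_in S (u / x)" using unit_in_inverse[OF S(3)] by simp
    then have "(z / x) / (u / x) \<in> T" by (intro T_div mT z u)
    then show ?thesis using x0 by simp
  qed
  then have "?H \<subseteq> T" using RT by blast
  then have "?B \<subseteq> T" unfolding blowup_chart_def by (rule generate_ring_minimal[OF subT])
  then show "local_over ?A S"
    by (intro local_over_change[OF S(1) subalg_range_ev AS]) (unfold T_def, blast)
qed

text \<open>Two of the infinitely many charts suffice: dividing \<open>u = x * a + y * b\<close> by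
  \<open>u\<close> writes 1 as a sum, and in the local ring \<open>S\<close> one of the summands is
  a unit, hence so is \<open>x / u\<close> or \<open>y / u\<close>.\<close>

lemma exceptionalD:
  assumes xy: "indep x y" and S: "S \<in> exceptional (pt x y)"
  shows "local_over (range (ev x (y / x))) S \<and> x \<in> max_ideal S \<or>
    local_over (range (ev y (x / y))) S \<and> y \<in> max_ideal S"
proof -
  let ?R = "pt x y"
  note subR = local_subalgD[OF local_subalg_pt[OF xy]]
  obtain u where u: "u \<in> max_ideal ?R" "u \<noteq> 0" and S1: "S \<in> affine_model (blowup_chart ?R u)"
    and dom: "dominates S ?R"
    using S by (auto simp: exceptional_def)
  let ?H = "?R \<union> {z / u | z. z \<in> max_ideal ?R}"
  have "range const \<subseteq> ?H" using subalgD[OF subR] by auto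
  then have subB: "subalg (blowup_chart ?R u)" unfolding blowup_chart_def by (rule subalg_generate_ring)
  have LS: "local_over (blowup_chart ?R u) S" using S1 by (simp add: affine_model_iff[OF subB])
  note loc = local_over_localD[OF LS]
  note sub = local_subalgD[OF loc]
  have HB: "?H \<subseteq> S"
    using local_over_subset[OF LS] generate_ring.incl[of _ ?H] unfolding blowup_chart_def by blast
  obtain a b where ab: "a \<in> ?R" "b \<in> ?R" "u = x * a + y * b"
    using max_pt_decomp[OF xy u(1)] by blast
  have "a * (x / u) + b * (y / u) = (x * a + y * b) / u"
    by (simp add: add_divide_distrib mult.commute)
  then have "a * (x / u) + b * (y / u) = 1" using u(2) by (simp flip: ab(3))
  moreover have "unit_in S 1" using subalgD[OF sub] by (simp add: unit_in_def)
  moreover have in_S: "x / u \<in> S" "y / u \<in> S" "a \<in> S" "b \<in> S"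
    using HB gen_in_max_pt[OF xy] ab by blast+
  moreover from in_S have "a * (x / u) \<in> S" "b * (y / u) \<in> S"
    by (auto intro: subalgD(5)[OF sub] simp del: times_divide_eq_right)
  ultimately have "unit_in S (a * (x / u)) \<or> unit_in S (b * (y / u))"
    using loc unfolding local_subalg_def by metis
  then have "unit_in S (x / u) \<or> unit_in S (y / u)"
    using unit_in_mult_iff[OF sub] in_S by blast
  then show ?thesis
    using exceptionalD_aux[OF xy u LS dom] exceptionalD_aux[OF indep_swap[OF xy], of u S]
      u LS dom by (auto simp: pt_swap[OF xy])
qed

lemma dv_in_exceptional: "indep x y \<Longrightarrow> dv x (y / x) \<in> exceptional (pt x y)"
  using indep_blowup[of x y 0] by (intro exceptionalI local_over_dv gen_in_max_dv) auto

lemma pt_in_exceptional: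
  assumes "indep x y"
  shows "pt x (y / x - const c) \<in> exceptional (pt x y)"
proof (rule exceptionalI[OF assms])
  have "range (ev x (y / x - const c)) = range (ev x (y / x))"
    using range_ev_shift[of x 0 "y / x" c] by simp
  then show "local_over (range (ev x (y / x))) (pt x (y / x - const c))"
    using local_over_pt[OF indep_blowup[OF assms, of c]] by simp
qed (rule gen_in_max_pt[OF indep_blowup[OF assms]])

text \<open>Both charts see the same exceptional curve. With \<open>w = y / x\<close>, a denominator
  in the second chart is a polynomial in \<open>1 / w\<close> plus a multiple of
  \<open>y = x * w\<close>; a power of \<open>w\<close> turns the first part into the reflected
  polynomial in \<open>w\<close>, which is a unit along \<open>x = 0\<close>.\<close>

lemma dv_inverse_subset:
  assumes xy: "indep x y"
  shows "dv y (x / y) \<subseteq> dv x (y / x)"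
proof
  define w where "w = y / x"
  let ?V = "dv x w"
  have xw: "indep x w" using indep_blowup[OF xy, of 0] by (simp add: w_def)
  note loc = local_subalg_dv[OF xw]
  note sub = local_subalgD[OF loc]
  have x0: "x \<noteq> 0" "w \<noteq> 0" using indep_nonzero xw by blast+
  have y: "y = x * w" and w': "x / y = inverse w" using x0 by (auto simp: w_def)
  have uw: "unit_in ?V w" using unit_in_dv[OF xw, of pY] by simp
  then have wV: "inverse w \<in> ?V" "w \<in> ?V" by (auto simp: unit_in_def)
  have ymax: "y \<in> max_ideal ?V"
    using max_ideal_closed(3)[OF loc wV(2) gen_in_max_dv[OF xw]] by (simp add: y mult.commute)
  then have yV: "y \<in> ?V" by (simp add: max_ideal_eq[OF sub])
  fix z assume "z \<in> dv y (x / y)"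
  then obtain g h where z: "z = ev y (inverse w) g / ev y (inverse w) h" and h: "poly h 0 \<noteq> 0"
    by (auto simp: dv_def loc_ev_def w')
  obtain h0 h1 where h01: "h = pCons h0 h1" by (cases h)
  have "unit_in ?V (hev const (inverse w) h0)"
  proof -
    have "map_poly const (reflect_poly h0) = reflect_poly (map_poly const h0)"
      by (intro poly_eqI) (simp add: coeff_reflect_poly coeff_map_poly degree_map_poly)
    then have "ev x w [:reflect_poly h0:] = w ^ degree h0 * hev const (inverse w) h0"
      using x0 by (simp add: ev_inner hev_def poly_reflect_poly_nz degree_map_poly)
    moreover have "unit_in ?V (ev x w [:reflect_poly h0:])"
      using h h01 by (subst unit_in_dv[OF xw]) auto
    moreover have "hev const (inverse w) h0 \<in> ?V"
      using ev_in_subalg[OF sub yV wV(1), of "[:h0:]"] by (simp add: ev_inner)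
    ultimately show ?thesis
      using unit_in_mult_iff[OF sub subalgD(8)[OF sub wV(2)]] by metis
  qed
  moreover have "ev y (inverse w) h = hev const (inverse w) h0 + ev y (inverse w) h1 * y"
    unfolding h01 ev_pCons[of _ _ h0] ev_inner by simp
  moreover have "ev y (inverse w) h1 * y \<in> max_ideal ?V"
    by (intro max_ideal_closed[OF loc] ymax ev_in_subalg sub yV wV)
  ultimately have "unit_in ?V (ev y (inverse w) h)"
    using unit_plus_max[OF loc] by metis
  then have "inverse (ev y (inverse w) h) \<in> ?V" by (simp add: unit_in_def)
  then have "ev y (inverse w) g * inverse (ev y (inverse w) h) \<in> ?V"
    using subalgD(5)[OF sub ev_in_subalg[OF sub yV wV(1)]] by blast
  then show "z \<in> dv x (y / x)"
    by (simp only: z divide_inverse[of "ev y (inverse w) g"] w_def[symmetric])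
qed

lemma generic_point_exceptional:
  assumes xy: "indep x y"
  shows "generic_point (exceptional (pt x y)) = dv x (y / x)"
proof -
  have "T \<subseteq> dv x (y / x)" if "T \<in> exceptional (pt x y)" for T
    using exceptionalD[OF xy that] dv_minimal[of x "y / x" T] dv_minimal[of y "x / y" T]
      dv_inverse_subset[OF xy] by blast
  then show ?thesis
    unfolding generic_point_def using dv_in_exceptional[OF xy] by (intro the_equality) auto
qed

section \<open>Closed points\<close>

lemma infinite_alg_closed: "infinite (UNIV :: 'k::alg_closed_field set)"
proof
  assume fin: "finite (UNIV :: 'k set)"
  define p :: "'k poly" where "p = (\<Prod>a\<in>UNIV. [:- a, 1:])"
  have "degree (p + 1) > 0"
  proof -
    have "degree p = card (UNIV :: 'k set)"
      unfolding p_def by (subst degree_prod_eq_sum_degree) auto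
    moreover have "card (UNIV :: 'k set) > 0" using fin by (simp add: card_gt_0_iff)
    ultimately show ?thesis by (subst degree_add_eq_left) auto
  qed
  then obtain x where "poly (p + 1) x = 0" using alg_closed_imp_poly_has_root by blast
  moreover have "poly p x = 0"
    using fin by (auto simp: p_def poly_prod prod_zero_iff)
  ultimately show False by simp
qed

lemma hev_pC_pY: "hev pC pY h = [:h:]"
  by (induction h) (simp_all add: hev_pCons rhom_pC, simp add: pC_def pY_def)

text \<open>Over an algebraically closed field \<open>h\<close> splits into linear factors, and a
  prime that contains the product contains one of them.\<close>

lemma prime_contains_linear:
  fixes P :: "'k::alg_closed_field poly poly set"
  assumes mult: "\<And>a b. b \<in> P \<Longrightarrow> a * b \<in> P"
    and prime: "\<And>a b. a * b \<in> P \<Longrightarrow> a \<in> P \<or> b \<in> P" and one: "1 \<notin> P"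
  shows "h \<noteq> 0 \<Longrightarrow> hev pC z h \<in> P \<Longrightarrow> \<exists>a. z - pC a \<in> P"
proof (induction "degree h" arbitrary: h)
  case 0
  then obtain c where c: "h = [:c:]" "c \<noteq> 0" by (metis degree_0_id pCons_eq_0_iff degree_eq_zeroE)
  then have "pC (inverse c) * pC c \<in> P"
    using 0 mult by (simp add: hev_pCons rhom_pC)
  then show ?case using one c by (simp flip: rhom_simps(4)[OF rhom_pC])
next
  case (Suc n)
  then obtain a where "poly h a = 0" using alg_closed_imp_poly_has_root[of h] by auto
  then obtain q where q: "h = [:- a, 1:] * q" by (meson dvd_def poly_eq_0_iff_dvd)
  have q0: "q \<noteq> 0" using Suc(3) q by auto
  then have "degree h = Suc (degree q)" unfolding q by (subst degree_mult_eq) auto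
  then have deg: "n = degree q" using Suc(2) by simp
  have "hev pC z [:- a, 1:] = z - pC a"
    by (simp add: hev_pCons rhom_pC rhom_simps(5)[OF rhom_pC] hev_1)
  then have "(z - pC a) * hev pC z q \<in> P"
    using Suc(4) unfolding q by (simp only: hev_mult[OF rhom_pC])
  then show ?case using prime Suc(1)[OF deg q0] by blast
qed

lemma bipoly_eq_eval_Y:
  fixes g :: "'k::field poly poly"
  shows "\<exists>q. g = hev pC pX (map_poly (\<lambda>h. poly h b) g) + (pY - pC b) * q"
proof (induction g)
  case (pCons h g)
  then obtain q where q: "g = hev pC pX (map_poly (\<lambda>h. poly h b) g) + (pY - pC b) * q" by blast
  obtain r where "h - [:poly h b:] = [:- b, 1:] * r"
    using poly_eq_0_iff_dvd[of "h - [:poly h b:]" b] by (auto elim: dvdE)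
  then have "[:h:] = [:[:poly h b:] + [:- b, 1:] * r:]" by (simp add: algebra_simps)
  then have r: "[:h:] = pC (poly h b) + (pY - pC b) * [:r:]" by (simp add: pC_def pY_def)
  have "pCons h g = [:h:] + pX * g" by (simp add: pX_def)
  also have "\<dots> = pC (poly h b) + pX * hev pC pX (map_poly (\<lambda>h. poly h b) g)
      + (pY - pC b) * ([:r:] + pX * q)"
    by (subst r, subst q) (simp add: algebra_simps)
  finally show ?case
    unfolding map_poly_pCons[of "\<lambda>h. poly h b", OF poly_0] hev_pCons[OF rhom_pC] by blast
qed simp

text \<open>If \<open>P\<close> contains a nonzero polynomial in the inner variable alone, it
  contains some \<open>pY - pC b\<close>, and what remains is a one-variable problem. Otherwise an
  element \<open>f\<close> of \<open>P\<close> of least degree in the outer variable divides every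
  element of \<open>P\<close> up to a power of its leading coefficient, and a zero of
  \<open>f\<close> away from the zeros of that coefficient is a common zero.\<close>

lemma prime_has_zero:
  fixes P :: "'k::alg_closed_field poly poly set"
  assumes add: "\<And>a b. a \<in> P \<Longrightarrow> b \<in> P \<Longrightarrow> a + b \<in> P"
    and mult: "\<And>a b. b \<in> P \<Longrightarrow> a * b \<in> P"
    and prime: "\<And>a b. a * b \<in> P \<Longrightarrow> a \<in> P \<or> b \<in> P" and one: "1 \<notin> P"
  shows "\<exists>a b. \<forall>g\<in>P. poly (poly g [:a:]) b = 0"
proof -
  have ev: "poly (poly g [:a:]) b = poly (map_poly (\<lambda>h. poly h b) g) a" for g :: "'k poly poly" and a b
    by (induction g) (simp_all add: map_poly_pCons)
  have diff: "a - b \<in> P" if "a \<in> P" "b \<in> P" for a b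
    using add[OF that(1) mult[OF that(2), of "-1"]] by simp
  consider (zero) "P \<subseteq> {0}" | (pure) h where "h \<noteq> 0" "[:h:] \<in> P"
    | (mixed) f where "f \<in> P" "f \<noteq> 0" "\<And>h. [:h:] \<in> P \<Longrightarrow> h = 0" by blast
  then show ?thesis
  proof cases
    case zero then show ?thesis by fastforce
  next
    case pure
    then obtain b where b: "pY - pC b \<in> P"
      using prime_contains_linear[OF mult prime one, of h pY] by (auto simp: hev_pC_pY)
    have red: "hev pC pX (map_poly (\<lambda>h. poly h b) g) \<in> P" if "g \<in> P" for g
    proof -
      obtain q where "g = hev pC pX (map_poly (\<lambda>h. poly h b) g) + (pY - pC b) * q"
        using bipoly_eq_eval_Y by blast
      then have "hev pC pX (map_poly (\<lambda>h. poly h b) g) = g - q * (pY - pC b)"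
        by (simp add: algebra_simps)
      then show ?thesis using diff[OF that mult[OF b]] by simp
    qed
    show ?thesis
    proof (cases "\<forall>g\<in>P. map_poly (\<lambda>h. poly h b) g = 0")
      case True
      then show ?thesis by (intro exI[of _ 0] exI[of _ b]) (auto simp: ev[of _ 0, simplified])
    next
      case False
      then obtain a where a: "pX - pC a \<in> P"
        using prime_contains_linear[OF mult prime one, of _ pX] red by blast
      have "poly (poly g [:a:]) b = 0" if "g \<in> P" for g
      proof (rule ccontr)
        define c where "c = poly (poly g [:a:]) b"
        assume "poly (poly g [:a:]) b \<noteq> 0"
        then have c0: "c \<noteq> 0" by (simp add: c_def)
        define r where "r = map_poly (\<lambda>h. poly h b) g"
        obtain q where q: "r - [:c:] = [:- a, 1:] * q"
          using poly_eq_0_iff_dvd[of "r - [:c:]" a] by (auto simp: c_def r_def ev elim: dvdE)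
        have "r = [:c:] + [:- a, 1:] * q" using q by (metis add.commute diff_add_cancel)
        then have "hev pC pX r = pC c + (pX - pC a) * hev pC pX q"
          by (simp only: hev_add[OF rhom_pC] hev_mult[OF rhom_pC])
            (simp add: hev_pCons rhom_pC rhom_simps(5)[OF rhom_pC] hev_1)
        then have "pC c = hev pC pX r - hev pC pX q * (pX - pC a)" by (simp add: algebra_simps)
        then have "pC c \<in> P" using diff[OF red[OF that] mult[OF a]] by (simp add: r_def)
        then have "pC (inverse c) * pC c \<in> P" by (rule mult)
        then show False using one c0 by (simp flip: rhom_simps(4)[OF rhom_pC])
      qed
      then show ?thesis by blast
    qed
  next
    case mixed
    define f where "f = arg_min degree (\<lambda>f. f \<in> P \<and> f \<noteq> 0)"
    have f: "f \<in> P" "f \<noteq> 0" and fmin: "\<And>g. g \<in> P \<Longrightarrow> g \<noteq> 0 \<Longrightarrow> degree f \<le> degree g"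
      using arg_min_nat_lemma[of "\<lambda>f. f \<in> P \<and> f \<noteq> 0" _ degree] mixed(1,2)
      unfolding f_def by blast+
    define c where "c = lead_coeff f"
    have c0: "c \<noteq> 0" using f by (simp add: c_def)
    have "\<exists>N q. smult (c ^ N) g = f * q" if g: "g \<in> P" for g
    proof -
      obtain q r where qr: "pseudo_divmod g f = (q, r)" by fastforce
      define N where "N = Suc (degree g) - degree f"
      have e: "smult (c ^ N) g = f * q + r" and r: "r = 0 \<or> degree r < degree f"
        using pseudo_divmod[OF f(2) qr] by (simp_all add: c_def N_def)
      have "r = [:c ^ N:] * g - q * f" using e by (simp add: algebra_simps)
      then have "r \<in> P"
        using diff[OF mult[OF g, of "[:c ^ N:]"] mult[OF f(1), of q]] by (simp only:)
      then have "r = 0" using r fmin by fastforce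
      then show ?thesis using e by auto
    qed
    note div = this
    \<comment> \<open>At such a \<open>b\<close> the polynomial \<open>f\<close> keeps its positive
      degree in the outer variable and so has a root \<open>a\<close>; moreover the factor
      \<open>c ^ N\<close> left over from pseudo-division can be cancelled.\<close>
    obtain b where b: "poly c b \<noteq> 0"
      using poly_roots_finite[OF c0] infinite_alg_closed
      by (metis (mono_tags, lifting) UNIV_I finite_subset mem_Collect_eq subsetI)
    have "degree f \<noteq> 0"
      using mixed(3) f by (metis degree_eq_zeroE pCons_eq_0_iff)
    moreover have "coeff (map_poly (\<lambda>h. poly h b) f) (degree f) \<noteq> 0"
      using b by (simp add: coeff_map_poly c_def)
    ultimately have "degree (map_poly (\<lambda>h. poly h b) f) > 0"
      using le_degree by fastforce
    then obtain a where a: "poly (poly f [:a:]) b = 0"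
      using alg_closed_imp_poly_has_root by (auto simp: ev)
    have "poly (poly g [:a:]) b = 0" if g: "g \<in> P" for g
    proof -
      obtain N q where "smult (c ^ N) g = f * q" using div[OF g] by blast
      then have "poly (poly (smult (c ^ N) g) [:a:]) b = poly (poly (f * q) [:a:]) b" by simp
      then show ?thesis using a b by simp
    qed
    then show ?thesis by blast
  qed
qed

text \<open>Every point of an affine chart specializes to a rational point: a common zero of the
  functions that vanish at \<open>S\<close>. The second conclusion keeps that point on the curve
  \<open>x = 0\<close> when \<open>S\<close> lies on it.\<close>

lemma local_over_contains_pt:
  fixes x y :: "'k::alg_closed_field ratfun"
  assumes S: "local_over (range (ev x y)) S"
  obtains a b where "pt (x - const a) (y - const b) \<subseteq> S" "x \<in> max_ideal S \<longrightarrow> a = 0"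
proof -
  note loc = local_over_localD[OF S]
  note sub = local_subalgD[OF loc]
  define P where "P = {g. ev x y g \<in> max_ideal S}"
  have evS: "ev x y g \<in> S" for g using local_over_subset[OF S] by blast
  have mem: "g \<in> P \<longleftrightarrow> \<not> unit_in S (ev x y g)" for g
    using evS by (simp add: P_def max_ideal_eq[OF sub])
  have "\<exists>a b. \<forall>g\<in>P. poly (poly g [:a:]) b = 0"
  proof (rule prime_has_zero)
    show "a + b \<in> P" if "a \<in> P" "b \<in> P" for a b
      using that max_ideal_closed[OF loc] by (simp add: P_def)
    show "a * b \<in> P" if "b \<in> P" for a b
      using that max_ideal_closed(3)[OF loc evS] by (simp add: P_def)
    show "a \<in> P \<or> b \<in> P" if "a * b \<in> P" for a b
      using that unit_in_mult_iff[OF sub evS evS] by (simp add: mem)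
    show "1 \<notin> P" using subalgD[OF sub] by (simp add: mem unit_in_def)
  qed
  then obtain a b where ab: "\<And>g. g \<in> P \<Longrightarrow> poly (poly g [:a:]) b = 0" by blast
  have "x \<in> max_ideal S \<longrightarrow> a = 0"
    using ab[of pX] by (auto simp: P_def)
  moreover have "pt (x - const a) (y - const b) \<subseteq> S"
  proof
    fix z assume "z \<in> pt (x - const a) (y - const b)"
    then obtain g h where h: "poly (poly h 0) 0 \<noteq> 0"
      and z: "z = ev (x - const a) (y - const b) g / ev (x - const a) (y - const b) h"
      by (auto simp: pt_def loc_ev_def)
    define \<tau> where "\<tau> = subst (pX - pC a) (pY - pC b)"
    have e: "ev (x - const a) (y - const b) g = ev x y (\<tau> g)" for g
      by (simp add: \<tau>_def ev_subst)
    have "poly (poly (\<tau> h) [:a:]) b \<noteq> 0"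
      using h by (simp add: \<tau>_def poly2_subst)
    then have "unit_in S (ev x y (\<tau> h))" using ab mem by blast
    then have "ev x y (\<tau> g) * inverse (ev x y (\<tau> h)) \<in> S"
      by (intro subalgD(5)[OF sub evS]) (simp add: unit_in_def)
    then show "z \<in> S" by (simp add: z e divide_inverse)
  qed
  ultimately show ?thesis using that by blast
qed

text \<open>The rational point found inside \<open>S\<close> again lies on the exceptional divisor
  and so belongs to \<open>X\<close>; minimality of the closed point \<open>S\<close> makes the two
  equal.\<close>

lemma closed_point_exceptional:
  fixes x y :: "'k::alg_closed_field ratfun"
  assumes xy: "indep x y" and S: "S \<in> exceptional (pt x y)"
    and X: "closed_point X S" "exceptional (pt x y) \<subseteq> X"
  shows "\<exists>c. S = pt x (y / x - const c) \<or> S = pt y (x / y - const c)"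
proof -
  have *: "\<exists>c. S = pt x (y / x - const c)"
    if xy: "indep x y" and L: "local_over (range (ev x (y / x))) S" and x: "x \<in> max_ideal S"
      and E: "exceptional (pt x y) \<subseteq> X" for x y
  proof -
    obtain a b where "pt (x - const a) (y / x - const b) \<subseteq> S" "a = 0"
      using local_over_contains_pt[OF L] x by metis
    then have "pt x (y / x - const b) \<subseteq> S" by simp
    moreover have "pt x (y / x - const b) \<in> X" using pt_in_exceptional xy E by blast
    ultimately show ?thesis using X(1) unfolding closed_point_def by blast
  qed
  show ?thesis
    using exceptionalD[OF xy S] *[OF xy] *[OF indep_swap[OF xy]] X(2) pt_swap[OF xy] by metis
qed

section \<open>Affine charts of the plane\<close>

definition plane_coords :: "nat \<Rightarrow> 'k::field ratfun \<times> 'k ratfun" where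
  "plane_coords i = (if i = 0 then (hcoord 1, hcoord 2)
     else if i = 1 then (inverse (hcoord 1), hcoord 2 / hcoord 1)
     else (inverse (hcoord 2), hcoord 1 / hcoord 2))"

lemma hcoord_0 [simp]: "hcoord 0 = 1"
  by (simp add: hcoord_def)

lemma hcoord_neq_0 [simp]: "hcoord i \<noteq> 0"
  by (simp add: hcoord_def)

lemma plane_coords_indep:
  assumes "plane_coords i = (s, t)"
  shows "indep s t" "full s t"
proof -
  have 1: "indep x (y / x)" "full x (y / x)" "indep (inverse x) (y / x)" "full (inverse x) (y / x)"
    if "indep x y" "full x y" for x y :: "'k::field ratfun"
    using indep_blowup[OF that(1), of 0] full_blowup[OF that(2) indep_nonzero(1)[OF that(1)]]
    by (simp_all add: indep_inverse full_inverse)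
  note 2 = indep_coords full_coords
  note 3 = indep_swap[OF 2(1)] full_swap[OF 2(2)]
  show "indep s t" "full s t"
    using assms 1[OF 2] 1[OF 3] 2 by (auto simp: plane_coords_def split: if_splits)
qed

lemma lt_3_cases: "i < 3 \<Longrightarrow> i = 0 \<or> i = 1 \<or> i = (2::nat)"
  by auto

lemma chart_ring_eq:
  assumes "plane_coords i = (s, t)" "i < 3"
  shows "chart_ring i = range (ev s t)"
proof
  let ?H = "range const \<union> {hcoord j / hcoord i | j. j < 3}"
  have st: "hcoord j / hcoord i \<in> {1, s, t}" if "j < 3" for j
    using lt_3_cases[OF \<open>i < 3\<close>] lt_3_cases[OF that] assms(1)
    by (auto simp: plane_coords_def inverse_eq_divide)
  then have "?H \<subseteq> range (ev s t)"
    using subalgD(1,3)[OF subalg_range_ev] gen_in_range_ev[where x = s and y = t] by fastforce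
  then show "chart_ring i \<subseteq> range (ev s t)"
    unfolding chart_ring_def by (rule generate_ring_minimal[OF subalg_range_ev])
  have sub: "subalg (chart_ring i)" unfolding chart_ring_def by (rule subalg_generate_ring) simp
  have H: "?H \<subseteq> chart_ring i" unfolding chart_ring_def using generate_ring.incl[of _ ?H] by blast
  have "\<exists>j<3. s = hcoord j / hcoord i" "\<exists>j<3. t = hcoord j / hcoord i"
    using lt_3_cases[OF \<open>i < 3\<close>] assms(1)
    by (auto simp: plane_coords_def inverse_eq_divide intro: exI[of _ 0] exI[of _ 1] exI[of _ 2])
  then have "s \<in> chart_ring i" "t \<in> chart_ring i" using H by blast+
  then show "range (ev s t) \<subseteq> chart_ring i"
    using ev_in_subalg[OF sub] by blast
qed

lemma closed_point_plane:
  fixes R :: "'k::alg_closed_field point"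
  assumes R: "closed_point proj_plane R" "R \<in> affine_model (chart_ring i)" "i < 3"
    and st: "plane_coords i = (s, t)"
  obtains a b where "R = pt (s - const a) (t - const b)"
proof -
  have L: "local_over (range (ev s t)) R"
    using R by (simp add: chart_ring_eq[OF st] affine_model_iff[OF subalg_range_ev])
  obtain a b where ab: "pt (s - const a) (t - const b) \<subseteq> R"
    using local_over_contains_pt[OF L] by blast
  have "local_over (range (ev s t)) (pt (s - const a) (t - const b))"
    using local_over_pt[OF indep_shift[OF plane_coords_indep(1)[OF st]], of a b]
    by (simp add: range_ev_shift)
  then have "pt (s - const a) (t - const b) \<in> affine_model (chart_ring i)"
    by (simp add: chart_ring_eq[OF st R(3)] affine_model_iff[OF subalg_range_ev])
  then have "pt (s - const a) (t - const b) \<in> proj_plane"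
    using R(3) unfolding proj_plane_def by blast
  then have "R = pt (s - const a) (t - const b)"
    using R(1) ab unfolding closed_point_def by blast
  then show ?thesis using that by blast
qed

section \<open>The divisorial valuation\<close>

locale const_valuation =
  fixes \<nu> :: "'k::field ratfun \<Rightarrow> int"
  assumes val_mult: "f \<noteq> 0 \<Longrightarrow> g \<noteq> 0 \<Longrightarrow> \<nu> (f * g) = \<nu> f + \<nu> g"
    and val_add: "f \<noteq> 0 \<Longrightarrow> g \<noteq> 0 \<Longrightarrow> f + g \<noteq> 0 \<Longrightarrow> min (\<nu> f) (\<nu> g) \<le> \<nu> (f + g)"
    and val_const: "c \<noteq> 0 \<Longrightarrow> \<nu> (const c) = 0"
begin

lemma val_1 [simp]: "\<nu> 1 = 0"
  using val_const[of 1] by simp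

lemma val_inverse: "f \<noteq> 0 \<Longrightarrow> \<nu> (inverse f) = - \<nu> f"
  using val_mult[of f "inverse f"] by simp

lemma val_divide: "f \<noteq> 0 \<Longrightarrow> g \<noteq> 0 \<Longrightarrow> \<nu> (f / g) = \<nu> f - \<nu> g"
  by (simp add: divide_inverse val_mult val_inverse)

lemma val_uminus: "\<nu> (- f) = \<nu> f"
proof (cases "f = 0")
  case False
  have "\<nu> (- 1 * f) = \<nu> (- 1) + \<nu> f" using False by (subst val_mult) auto
  then show ?thesis using val_const[of "- 1"] by simp
qed simp

lemma val_power: "f \<noteq> 0 \<Longrightarrow> \<nu> (f ^ n) = int n * \<nu> f"
  by (induction n) (simp_all add: val_mult algebra_simps)

lemma val_prod: "finite I \<Longrightarrow> (\<And>i. i \<in> I \<Longrightarrow> f i \<noteq> 0) \<Longrightarrow> \<nu> (\<Prod>i\<in>I. f i) = (\<Sum>i\<in>I. \<nu> (f i))"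
  by (induction I rule: finite_induct) (simp_all add: val_mult)

text \<open>The value at 0 is arbitrary, so it is treated here as infinite; this makes the condition
  stable under sums.\<close>

definition vge :: "int \<Rightarrow> 'k ratfun \<Rightarrow> bool" where
  "vge k f \<longleftrightarrow> f = 0 \<or> k \<le> \<nu> f"

lemma vge_0 [simp]: "vge k 0"
  by (simp add: vge_def)

lemma vge_add: "vge k f \<Longrightarrow> vge k g \<Longrightarrow> vge k (f + g)"
  using val_add[of f g] by (fastforce simp: vge_def)

lemma vge_mult: "vge k f \<Longrightarrow> vge l g \<Longrightarrow> vge (k + l) (f * g)"
  using val_mult[of f g] by (cases "f = 0"; cases "g = 0") (auto simp: vge_def)

lemma vge_mono: "vge k f \<Longrightarrow> l \<le> k \<Longrightarrow> vge l f"
  by (auto simp: vge_def)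

lemma val_add_eq:
  assumes "f \<noteq> 0" "g \<noteq> 0" "\<nu> f < \<nu> g"
  shows "f + g \<noteq> 0" "\<nu> (f + g) = \<nu> f"
proof -
  show *: "f + g \<noteq> 0"
    using assms(3) val_uminus[of f] by (auto simp: add_eq_0_iff)
  have "min (\<nu> (f + g)) (\<nu> g) \<le> \<nu> f"
    using val_add[of "f + g" "- g"] assms * by (simp add: val_uminus)
  then show "\<nu> (f + g) = \<nu> f" using val_add[OF assms(1,2) *] assms(3) by linarith
qed

end

lemma pX_power_decomp:
  assumes "g \<noteq> (0 :: 'k::field poly poly)"
  obtains n q where "g = pX ^ n * q" "poly q 0 \<noteq> 0"
  using order_decomp[OF assms, of 0] that by (auto simp: pX_def poly_eq_0_iff_dvd)

lemma max_ideal_dv: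
  assumes "indep x y"
  shows "max_ideal (dv x y) = {s * x | s. s \<in> dv x y}"
proof safe
  note loc = local_subalg_dv[OF assms]
  note sub = local_subalgD[OF loc]
  fix z assume z: "z \<in> max_ideal (dv x y)"
  then obtain g h where gh: "z = ev x y g / ev x y h" "poly h 0 \<noteq> 0"
    unfolding max_ideal_eq[OF sub] by (auto simp: dv_def loc_ev_def)
  have u: "unit_in (dv x y) (ev x y h)" using gh(2) unit_in_dv[OF assms] by simp
  have "ev x y g = ev x y h * z" using gh(1) u by (simp add: unit_in_def)
  then have "\<not> unit_in (dv x y) (ev x y g)"
    using unit_in_mult_iff[OF sub, of "ev x y h" z] z u by (auto simp: max_ideal_eq[OF sub] unit_in_def)
  then have "poly g 0 = 0" using unit_in_dv[OF assms] by simp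
  then obtain g' where "g = pX * g'" by (cases g) (auto simp: pX_def)
  then have "z = (ev x y g' / ev x y h) * x" by (simp add: gh(1))
  moreover have "ev x y g' / ev x y h \<in> dv x y" using gh(2) by (auto simp: dv_def loc_ev_def)
  ultimately show "\<exists>s. z = s * x \<and> s \<in> dv x y" by blast
next
  fix s assume "s \<in> dv x y"
  then show "s * x \<in> max_ideal (dv x y)"
    by (intro max_ideal_closed[OF local_subalg_dv[OF assms]] gen_in_max_dv assms)
qed

lemma dv_uniformize:
  assumes "indep x y" "full x y" "f \<noteq> 0"
  obtains u k where "unit_in (dv x y) u" "f = u * x powi k"
proof -
  note x0 = indep_nonzero(1)[OF assms(1)]
  obtain g h where gh: "f = ev x y g / ev x y h"
    using assms(2) unfolding full_def quotients_def by blast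
  have "g \<noteq> 0" "h \<noteq> 0" using gh assms(3) by auto
  then obtain m n g' h' where *: "g = pX ^ m * g'" "h = pX ^ n * h'" "poly g' 0 \<noteq> 0" "poly h' 0 \<noteq> 0"
    by (metis pX_power_decomp)
  have u: "unit_in (dv x y) (ev x y g')" "unit_in (dv x y) (ev x y h')"
    using * unit_in_dv[OF assms(1)] by auto
  then have "unit_in (dv x y) (ev x y g' * inverse (ev x y h'))"
    using unit_in_mult_iff[OF local_subalgD[OF local_subalg_dv[OF assms(1)]]] unit_in_inverse
    by (metis unit_in_def)
  moreover have "f = (ev x y g' * inverse (ev x y h')) * x powi (int m - int n)"
    using x0 by (simp add: gh * power_int_diff divide_inverse)
  ultimately show ?thesis using that by blast
qed

lemma PIdl_ring_on: "PIdl\<^bsub>ring_on V\<^esub> z = {s * z | s. s \<in> V}"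
  by (auto simp: cgenideal_def)

lemma unit_in_mult: "subalg A \<Longrightarrow> unit_in A a \<Longrightarrow> unit_in A b \<Longrightarrow> unit_in A (a * b)"
  using subalgD(5) by (auto simp: unit_in_def)

lemma unit_in_powi: "subalg V \<Longrightarrow> unit_in V u \<Longrightarrow> unit_in V (u powi k)"
  using subalgD(8)[of V u] subalgD(8)[of V "inverse u"]
  by (auto simp: unit_in_def power_int_def power_inverse)

text \<open>Shows that the description in \<open>order_along\<close> is unambiguous: two generators
  of the maximal ideal differ by a unit, so two exponents \<open>k\<close> and \<open>l\<close>
  would make \<open>z powi (k - l)\<close> a unit, which forces \<open>k = l\<close>.\<close>

lemma order_along_eq:
  assumes V: "subalg V" and z: "z \<in> V" "z \<noteq> 0" "max_ideal V = {s * z | s. s \<in> V}" and u: "unit_in V u"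
  shows "order_along V (u * z powi k) = k"
  unfolding order_along_def
proof (rule the_equality)
  show "\<exists>z' u'. z' \<in> V \<and> PIdl\<^bsub>ring_on V\<^esub> z' = max_ideal V \<and> u' \<in> Units (ring_on V) \<and>
      u * z powi k = u' * z' powi k"
    using z u by (auto simp: PIdl_ring_on Units_ring_on[OF V])
  fix l
  assume "\<exists>z' u'. z' \<in> V \<and> PIdl\<^bsub>ring_on V\<^esub> z' = max_ideal V \<and> u' \<in> Units (ring_on V) \<and>
      u * z powi k = u' * z' powi l"
  then obtain z' u' where z': "z' \<in> V" "{s * z' | s. s \<in> V} = {s * z | s. s \<in> V}"
    and u': "unit_in V u'" and e: "u * z powi k = u' * z' powi l"
    by (auto simp: PIdl_ring_on Units_ring_on[OF V] z)
  have "z' \<in> {s * z | s. s \<in> V}" "z \<in> {s * z' | s. s \<in> V}"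
    using z' subalgD(3)[OF V] by (metis (mono_tags, lifting) mem_Collect_eq mult_1)+
  then obtain a b where ab: "a \<in> V" "b \<in> V" "z' = a * z" "z = b * z'" by blast
  have "(b * a) * z = b * (a * z)" by (rule mult.assoc)
  also have "\<dots> = 1 * z" using ab(3,4) by (metis mult_1)
  finally have "b * a = 1" using z by simp
  then have ua: "unit_in V a" using ab by (metis inverse_unique mult.commute mult_zero_left unit_in_def zero_neq_one)
  have nz: "\<not> unit_in V z"
  proof -
    have "z \<in> max_ideal V" using z subalgD(3)[OF V] by (metis (mono_tags, lifting) mem_Collect_eq mult_1)
    then show ?thesis by (simp add: max_ideal_eq[OF V])
  qed
  define v where "v = u' * a powi l * inverse u"
  have uv: "unit_in V v"
    unfolding v_def by (intro unit_in_mult[OF V] unit_in_powi[OF V] unit_in_inverse u u' ua)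
  have "u * z powi k = u' * (a powi l * z powi l)"
    using e by (simp add: ab(3) power_int_mult_distrib)
  then have "z powi (k - l) = v"
    using z u by (simp add: v_def power_int_diff unit_in_def field_simps)
  moreover have "z powi (l - k) = inverse (z powi (k - l))"
    by (simp flip: power_int_minus)
  ultimately have unit: "unit_in V (z powi (k - l))" "unit_in V (z powi (l - k))"
    using uv unit_in_inverse[OF uv] by simp_all
  have pos: "\<not> unit_in V (z powi j)" if "j > 0" for j
  proof -
    have "j = int (Suc (nat (j - 1)))" using that by simp
    then obtain i where "j = int (Suc i)" by blast
    then have "z powi j = z * z ^ i" by (simp only: power_int_of_nat power_Suc)
    then show ?thesis
      using nz unit_in_mult_iff[OF V z(1) subalgD(8)[OF V z(1)], of i] by simp
  qed
  show "l = k"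
    using pos[of "k - l"] pos[of "l - k"] unit by linarith
qed

lemma dv_valuation:
  assumes xy: "indep x y" "full x y" and \<nu>: "\<And>f. f \<noteq> 0 \<Longrightarrow> \<nu> f = order_along (dv x y) f"
  shows "const_valuation \<nu>" "f \<noteq> 0 \<Longrightarrow> f \<in> dv x y \<longleftrightarrow> 0 \<le> \<nu> f"
    "f \<noteq> 0 \<Longrightarrow> unit_in (dv x y) f \<longleftrightarrow> \<nu> f = 0"
proof -
  let ?V = "dv x y"
  note x0 = indep_nonzero(1)[OF xy(1)]
  note sub = local_subalgD[OF local_subalg_dv[OF xy(1)]]
  have xV: "x \<in> ?V" "\<not> unit_in ?V x"
    using gen_in_max_dv[OF xy(1)] by (auto simp: max_ideal_eq[OF sub])
  have val: "\<nu> (u * x powi k) = k" if "unit_in ?V u" for u k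
    using order_along_eq[OF sub xV(1) x0 max_ideal_dv[OF xy(1)] that, of k] that x0
    by (subst \<nu>) (auto simp: unit_in_def)
  have unit_mult: "unit_in ?V (u * v)" if "unit_in ?V u" "unit_in ?V v" for u v
    using unit_in_mult_iff[OF sub] that by (metis unit_in_def)
  have mult: "\<nu> (f * g) = \<nu> f + \<nu> g" if fg: "f \<noteq> 0" "g \<noteq> 0" for f g
  proof -
    obtain u k where f: "unit_in ?V u" "f = u * x powi k" using dv_uniformize[OF xy fg(1)] .
    obtain v l where g: "unit_in ?V v" "g = v * x powi l" using dv_uniformize[OF xy fg(2)] .
    have "f * g = (u * v) * x powi (k + l)" using f g x0 by (simp add: power_int_add)
    then show ?thesis using f g val unit_mult by metis
  qed
  have mem: "f \<in> ?V \<longleftrightarrow> 0 \<le> \<nu> f" if f0: "f \<noteq> 0" for f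
  proof -
    obtain u k where f: "unit_in ?V u" "f = u * x powi k" using dv_uniformize[OF xy f0] .
    have "f \<in> ?V \<longleftrightarrow> 0 \<le> k"
    proof
      assume "0 \<le> k"
      then show "f \<in> ?V"
        using f subalgD(5,8)[OF sub] xV by (auto simp: power_int_def unit_in_def)
    next
      assume fV: "f \<in> ?V"
      show "0 \<le> k"
      proof (rule ccontr)
        assume "\<not> 0 \<le> k"
        then have "k = - int (Suc (nat (- k - 1)))" by simp
        then obtain i where "k = - int (Suc i)" by blast
        then have "f = u * inverse (x ^ Suc i)"
          using f(2) by (simp only: power_int_minus power_int_of_nat)
        then have "u = f * x ^ i * x" using x0 by (simp add: field_simps)
        then show False
          using f(1) xV unit_in_mult_iff[OF sub subalgD(5)[OF sub fV subalgD(8)[OF sub xV(1)]] xV(1)]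
          by metis
      qed
    qed
    then show ?thesis using f val by simp
  qed
  then show "f \<noteq> 0 \<Longrightarrow> f \<in> ?V \<longleftrightarrow> 0 \<le> \<nu> f" .
  have inv: "\<nu> (inverse f) = - \<nu> f" if "f \<noteq> 0" for f
    using mult[of f "inverse f"] that val[of 1 0] subalgD(3)[OF sub] by (simp add: unit_in_def)
  then show unit: "f \<noteq> 0 \<Longrightarrow> unit_in ?V f \<longleftrightarrow> \<nu> f = 0"
    using mem[of f] mem[of "inverse f"] by (auto simp: unit_in_def)
  show "const_valuation \<nu>"
  proof
    show "\<nu> (const c) = 0" if "c \<noteq> 0" for c
      using val[of "const c" 0] unit_in_const[OF sub that] by simp
    show "min (\<nu> f) (\<nu> g) \<le> \<nu> (f + g)" if "f \<noteq> 0" "g \<noteq> 0" "f + g \<noteq> 0" for f g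
    proof -
      have *: "\<nu> f \<le> \<nu> (f + g)" if "f \<noteq> 0" "g \<noteq> 0" "f + g \<noteq> 0" "\<nu> f \<le> \<nu> g" for f g
      proof -
        have "\<nu> (g * inverse f) \<ge> 0" using that by (subst mult) (auto simp: inv)
        then have "g * inverse f \<in> ?V" using that by (subst mem) auto
        then have "1 + g * inverse f \<in> ?V" by (intro subalgD(3,4)[OF sub])
        moreover have "1 + g * inverse f = (f + g) * inverse f" using that by (simp add: field_simps)
        ultimately have "\<nu> ((f + g) * inverse f) \<ge> 0" using mem[of "(f + g) * inverse f"] that by simp
        then show ?thesis using that by (subst (asm) mult) (auto simp: inv)
      qed
      have "\<nu> f \<le> \<nu> (f + g) \<or> \<nu> g \<le> \<nu> (f + g)"
        using *[of f g] *[of g f] that by (simp add: add.commute) linarith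
      then show ?thesis by linarith
    qed
  qed (fact mult)
qed

section \<open>Curves through a configuration\<close>

text \<open>Coordinates are carried along the sequence of blowups. The surface just formed contains
  the whole new exceptional divisor, so a closed point on it is the origin of a shifted
  chart.\<close>

lemma configuration_points:
  fixes p :: "nat \<Rightarrow> 'k::alg_closed_field point"
  assumes conf: "simple_configuration n p"
  shows "Suc i \<le> n \<Longrightarrow> \<exists>x y. indep x y \<and> full x y \<and> p (Suc i) = pt x y"
proof (induction i)
  case 0
  then have cp: "closed_point proj_plane (p 1)"
    using conf unfolding simple_configuration_def by (metis One_nat_def atLeastAtMost_iff diff_self_eq_0 order_refl surface.simps(1))
  then obtain i where i: "i < 3" "p 1 \<in> affine_model (chart_ring i)"
    unfolding closed_point_def proj_plane_def by blast
  obtain s t where st: "plane_coords i = (s, t :: 'k ratfun)" by fastforce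
  obtain a b where "p 1 = pt (s - const a) (t - const b)"
    using closed_point_plane[OF cp i(2,1) st] .
  then show ?case
    using indep_shift full_shift plane_coords_indep[OF st] by (metis One_nat_def)
next
  case (Suc i)
  then obtain x y where xy: "indep x y" "full x y" "p (Suc i) = pt x y" by auto
  let ?S = "p (Suc (Suc i))"
  have "\<forall>j\<in>{1..<n}. p (j + 1) \<in> exceptional (p j)"
    using conf by (simp add: simple_configuration_def)
  then have S: "?S \<in> exceptional (pt x y)"
    using bspec[of "{1..<n}" _ "Suc i"] Suc(2) by (auto simp flip: xy(3))
  have "\<forall>j\<in>{1..n}. closed_point (surface p (j - 1)) (p j)"
    using conf by (simp add: simple_configuration_def)
  then have cp: "closed_point (surface p (Suc i)) ?S"
    using bspec[of "{1..n}" _ "Suc (Suc i)"] Suc(2) by force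
  have "exceptional (pt x y) \<subseteq> surface p (Suc i)"
    by (simp add: blowup_def xy(3))
  then obtain c where "?S = pt x (y / x - const c) \<or> ?S = pt y (x / y - const c)"
    using closed_point_exceptional[OF xy(1) S cp] by blast
  moreover have "indep x (y / x - const c) \<and> full x (y / x - const c)"
    "indep y (x / y - const c) \<and> full y (x / y - const c)"
    using indep_blowup full_blowup[of x y] full_blowup[of y x] full_shift[of _ _ 0 c]
      indep_swap[OF xy(1)] full_swap[OF xy(2)] xy indep_nonzero[OF xy(1)] by (metis const_simps(1) diff_zero)+
  ultimately show ?case by metis
qed

text \<open>Justifies the choice in \<open>exceptional_divisor\<close>: in each of the two charts
  the extended maximal ideal is generated by the first coordinate.\<close>

lemma PIdl_Idl_exceptional:
  assumes xy: "indep x y" and S: "S \<in> exceptional (pt x y)"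
  obtains e where "e \<in> S" "PIdl\<^bsub>ring_on S\<^esub> e = Idl\<^bsub>ring_on S\<^esub> (max_ideal (pt x y))"
proof -
  have *: "x \<in> S \<and> PIdl\<^bsub>ring_on S\<^esub> x = Idl\<^bsub>ring_on S\<^esub> (max_ideal (pt x y))"
    if xy: "indep x y" and L: "local_over (range (ev x (y / x))) S" and x: "x \<in> max_ideal S" for x y
  proof -
    note loc = local_over_localD[OF L]
    note sub = local_subalgD[OF loc]
    interpret cring "ring_on S" by (rule cring_ring_on[OF sub])
    have xS: "x \<in> S" using x by (simp add: max_ideal_eq[OF sub])
    note x0 = indep_nonzero(1)[OF xy]
    have w: "y / x \<in> S" using local_over_subset[OF L] gen_in_range_ev(2) by blast
    have RS: "pt x y \<subseteq> S" by (rule pt_subset[OF loc x w x0])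
    have mS: "max_ideal (pt x y) \<subseteq> S"
      using RS by (auto simp: max_ideal_def)
    have "max_ideal (pt x y) \<subseteq> PIdl\<^bsub>ring_on S\<^esub> x"
    proof
      fix z assume "z \<in> max_ideal (pt x y)"
      then obtain a b where ab: "a \<in> pt x y" "b \<in> pt x y" "z = x * a + y * b"
        using max_pt_decomp[OF xy] by blast
      have "z = (a + (y / x) * b) * x" using ab x0 by (simp add: field_simps)
      moreover have "a + (y / x) * b \<in> S" using RS ab(1,2) by (intro subalgD(4,5)[OF sub] w) auto
      ultimately show "z \<in> PIdl\<^bsub>ring_on S\<^esub> x" unfolding PIdl_ring_on by blast
    qed
    then have 1: "Idl\<^bsub>ring_on S\<^esub> (max_ideal (pt x y)) \<subseteq> PIdl\<^bsub>ring_on S\<^esub> x"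
      using genideal_minimal[OF cgenideal_ideal] xS by simp
    have "x \<in> Idl\<^bsub>ring_on S\<^esub> (max_ideal (pt x y))"
      using genideal_self[of "max_ideal (pt x y)"] mS gen_in_max_pt[OF xy] by auto
    then have "PIdl\<^bsub>ring_on S\<^esub> x \<subseteq> Idl\<^bsub>ring_on S\<^esub> (max_ideal (pt x y))"
      using cgenideal_minimal[OF genideal_ideal] mS by simp
    then show ?thesis using 1 xS by blast
  qed
  show ?thesis
    using exceptionalD[OF xy S] *[OF xy] *[OF indep_swap[OF xy]] that pt_swap[OF xy] by metis
qed

text \<open>The integers are not well-ordered, so \<open>LEAST\<close> is meaningful only for values
  bounded below; the minimum is found among the natural numbers.\<close>

lemma ideal_value_le:
  fixes \<nu> :: "'k::field ratfun \<Rightarrow> int"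
  assumes lower: "\<And>x. x \<in> I \<Longrightarrow> x \<noteq> 0 \<Longrightarrow> 0 \<le> \<nu> x" and x: "x \<in> I" "x \<noteq> 0"
  shows "ideal_value \<nu> I \<le> \<nu> x" "\<exists>y\<in>I - {0}. ideal_value \<nu> I = \<nu> y"
proof -
  define Q where "Q k \<longleftrightarrow> (\<exists>x\<in>I - {0}. k = \<nu> x)" for k
  define m where "m = (LEAST m. Q (int m))"
  have Qpos: "0 \<le> k" if "Q k" for k using that lower by (auto simp: Q_def)
  have "Q (int (nat (\<nu> x)))" using x lower by (auto simp: Q_def)
  then have "Q (int m)" unfolding m_def by (rule LeastI)
  moreover have min: "int m \<le> k" if "Q k" for k
  proof -
    have "Q (int (nat k))" using that Qpos by simp
    then have "m \<le> nat k" unfolding m_def by (rule Least_le)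
    then show ?thesis using Qpos[OF that] by linarith
  qed
  ultimately have "(LEAST k. Q k) = int m" by (intro Least_equality)
  then have *: "ideal_value \<nu> I = int m" by (simp add: ideal_value_def Q_def)
  show "ideal_value \<nu> I \<le> \<nu> x" unfolding * by (rule min) (use x in \<open>auto simp: Q_def\<close>)
  show "\<exists>y\<in>I - {0}. ideal_value \<nu> I = \<nu> y" using \<open>Q (int m)\<close> by (simp add: * Q_def)
qed

lemma contraction_self: "contraction p n n S = S"
  by (cases n) auto

text \<open>In a simple configuration each center lies on the exceptional divisor of its
  predecessor, so blowing down runs backwards through the centers.\<close>

lemma contraction_step:
  assumes "\<And>j. 1 \<le> j \<Longrightarrow> j \<le> n \<Longrightarrow> p (Suc j) \<in> exceptional (p j)" "i \<le> n"
  shows "contraction p i n (p (Suc n)) = p (Suc i)"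
  using assms
proof (induction n)
  case (Suc n)
  show ?case
  proof (cases "Suc n \<le> i")
    case False
    have "blowdown (p (Suc n)) (p (Suc (Suc n))) = p (Suc n)"
      using Suc(2)[of "Suc n"] by (simp add: blowdown_def)
    then show ?thesis using False Suc by simp
  next
    case True
    then have "i = Suc n" using Suc(3) by simp
    then show ?thesis by (simp only: contraction_self)
  qed
qed simp

lemma contraction_center:
  assumes "\<And>j. 1 \<le> j \<Longrightarrow> j < n \<Longrightarrow> p (Suc j) \<in> exceptional (p j)"
    and "S \<in> exceptional (p n)" "i < n"
  shows "contraction p i n S = p (Suc i)"
proof -
  obtain n' where n: "n = Suc n'" using assms(3) by (cases n) auto
  then have "contraction p i n S = contraction p i n' (p (Suc n'))"
    using assms(2,3) by (simp add: blowdown_def)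
  then show ?thesis using contraction_step[of n' p i] assms(1,3) n by simp
qed

section \<open>The valuation and its centers\<close>

locale divisorial =
  fixes n :: nat and p :: "nat \<Rightarrow> 'k::alg_closed_field point" and \<nu> :: "'k ratfun \<Rightarrow> int"
  assumes divisorial: "divisorial_valuation n p \<nu>"
begin

lemma n_ge_1: "1 \<le> n"
  and points: "1 \<le> i \<Longrightarrow> i \<le> n \<Longrightarrow> \<exists>x y. indep x y \<and> full x y \<and> p i = pt x y"
  and next_exceptional: "1 \<le> i \<Longrightarrow> i < n \<Longrightarrow> p (Suc i) \<in> exceptional (p i)"
proof -
  have c: "simple_configuration n p"
    using divisorial by (simp add: divisorial_valuation_def)
  show "1 \<le> n" using c by (simp add: simple_configuration_def)
  show "1 \<le> i \<Longrightarrow> i \<le> n \<Longrightarrow> \<exists>x y. indep x y \<and> full x y \<and> p i = pt x y"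
    using configuration_points[OF c, of "i - 1"] by simp
  have "\<forall>i\<in>{1..<n}. p (i + 1) \<in> exceptional (p i)"
    using c by (simp add: simple_configuration_def)
  then show "1 \<le> i \<Longrightarrow> i < n \<Longrightarrow> p (Suc i) \<in> exceptional (p i)" by auto
qed

definition V :: "'k point" where
  "V = generic_point (exceptional (p n))"

lemma V_eq: obtains x y where "indep x y" "full x y" "indep x (y / x)" "full x (y / x)"
    "p n = pt x y" "V = dv x (y / x)"
proof -
  obtain x y where xy: "indep x y" "full x y" "p n = pt x y" using points n_ge_1 by blast
  moreover have "indep x (y / x)" "full x (y / x)"
    using indep_blowup[OF xy(1), of 0] full_blowup[OF xy(2) indep_nonzero(1)[OF xy(1)]] by simp_all
  moreover have "V = dv x (y / x)" using generic_point_exceptional[OF xy(1)] by (simp add: V_def xy(3))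
  ultimately show ?thesis using that by blast
qed

lemma val_V: "f \<noteq> 0 \<Longrightarrow> f \<in> V \<longleftrightarrow> 0 \<le> \<nu> f" "f \<noteq> 0 \<Longrightarrow> unit_in V f \<longleftrightarrow> \<nu> f = 0"
  and valuation: "const_valuation \<nu>"
  and local_V: "local_subalg V"
  and V_exceptional: "V \<in> exceptional (p n)"
  and residue: "\<exists>w. \<forall>q. q \<noteq> 0 \<longrightarrow> hev const w q \<noteq> 0 \<and> \<nu> (hev const w q) = 0"
proof -
  obtain x y where xy: "indep x y" "full x y" "indep x (y / x)" "full x (y / x)"
    "p n = pt x y" "V = dv x (y / x)" using V_eq .
  have \<nu>: "\<And>f. f \<noteq> 0 \<Longrightarrow> \<nu> f = order_along (dv x (y / x)) f"
    using divisorial by (simp add: divisorial_valuation_def V_def flip: xy(6))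
  note * = dv_valuation[OF xy(3,4) \<nu>]
  show "const_valuation \<nu>" by (rule *)
  show "f \<noteq> 0 \<Longrightarrow> f \<in> V \<longleftrightarrow> 0 \<le> \<nu> f" unfolding xy(6) by (rule *)
  show u: "f \<noteq> 0 \<Longrightarrow> unit_in V f \<longleftrightarrow> \<nu> f = 0" for f unfolding xy(6) by (rule *)
  show "local_subalg V" unfolding xy(6) by (rule local_subalg_dv[OF xy(3)])
  show "V \<in> exceptional (p n)" unfolding xy(5,6) by (rule dv_in_exceptional[OF xy(1)])
  \<comment> \<open>\<open>y / x\<close> is a coordinate on the last exceptional curve: nonzero
    polynomials in it are units along that curve, which makes its residue transcendental.\<close>
  have "hev const (y / x) q \<noteq> 0 \<and> \<nu> (hev const (y / x) q) = 0" if "q \<noteq> 0" for q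
  proof -
    have "unit_in V (ev x (y / x) [:q:])"
      unfolding xy(6) by (subst unit_in_dv[OF xy(3)]) (use that in simp)
    then show ?thesis using u by (auto simp: ev_inner unit_in_def)
  qed
  then show "\<exists>w. \<forall>q. q \<noteq> 0 \<longrightarrow> hev const w q \<noteq> 0 \<and> \<nu> (hev const w q) = 0" by blast
qed

sublocale const_valuation \<nu>
  by (rule valuation)

lemma dominates_V:
  assumes "1 \<le> i" "i \<le> n"
  shows "dominates V (p i)"
  using assms(2,1)
proof (induction i rule: inc_induct)
  case base
  show ?case using V_exceptional by (simp add: exceptional_def)
next
  case (step j)
  then have "dominates V (p (Suc j))" by simp
  moreover have "dominates (p (Suc j)) (p j)"
    using next_exceptional[of j] step by (simp add: exceptional_def)
  ultimately show ?case by (auto simp: dominates_def)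
qed

lemma val_nonneg: "1 \<le> i \<Longrightarrow> i \<le> n \<Longrightarrow> z \<in> p i \<Longrightarrow> z \<noteq> 0 \<Longrightarrow> 0 \<le> \<nu> z"
  using dominates_V[of i] val_V(1)[of z] by (auto simp: dominates_def)

lemma val_pos:
  assumes "1 \<le> i" "i \<le> n" "z \<in> max_ideal (p i)" "z \<noteq> 0"
  shows "0 < \<nu> z"
proof -
  have "z \<in> max_ideal V" using dominates_V[of i] assms by (auto simp: dominates_def)
  then have "z \<in> V" "\<not> unit_in V z" by (auto simp: max_ideal_eq[OF local_subalgD[OF local_V]])
  then show ?thesis using val_V[OF assms(4)] by linarith
qed

lemma multiplicity_le:
  assumes "1 \<le> i" "i \<le> n" "z \<in> max_ideal (p i)" "z \<noteq> 0"
  shows "multiplicity_at \<nu> p i \<le> \<nu> z"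
  unfolding multiplicity_at_def
proof (rule ideal_value_le(1))
  show "0 \<le> \<nu> x" if "x \<in> max_ideal (p i)" "x \<noteq> 0" for x
    using val_pos[OF assms(1,2) that] by simp
qed fact+

text \<open>The elements of \<open>S\<close> of value at least the multiplicity form an ideal that
  contains the maximal ideal of the center, hence also a generator of its extension to
  \<open>S\<close>.\<close>

lemma val_exceptional_divisor:
  assumes i: "1 \<le> i" "i \<le> n" and S: "S \<in> exceptional (p i)" "S \<subseteq> V"
  shows "exceptional_divisor (p i) S \<noteq> 0"
    "multiplicity_at \<nu> p i \<le> \<nu> (exceptional_divisor (p i) S)"
proof -
  obtain x y where xy: "indep x y" "full x y" "p i = pt x y" using points[OF i] by blast
  define e where "e = exceptional_divisor (p i) S"
  have "\<exists>e. e \<in> S \<and> PIdl\<^bsub>ring_on S\<^esub> e = Idl\<^bsub>ring_on S\<^esub> (max_ideal (p i))"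
    using PIdl_Idl_exceptional[of x y S] xy S by metis
  then have "e \<in> S \<and> PIdl\<^bsub>ring_on S\<^esub> e = Idl\<^bsub>ring_on S\<^esub> (max_ideal (p i))"
    unfolding e_def exceptional_divisor_def if_P[OF S(1)] by (rule someI_ex)
  then have e: "e \<in> S" "PIdl\<^bsub>ring_on S\<^esub> e = Idl\<^bsub>ring_on S\<^esub> (max_ideal (p i))" by auto
  have sub: "subalg S"
    using exceptionalD[OF xy(1), of S] S(1) local_subalgD local_over_localD by (metis xy(3))
  interpret cring "ring_on S" by (rule cring_ring_on[OF sub])
  have dom: "dominates S (p i)" using S by (simp add: exceptional_def)
  have mS: "max_ideal (p i) \<subseteq> S" using dom by (auto simp: dominates_def max_ideal_def)
  have "x \<in> Idl\<^bsub>ring_on S\<^esub> (max_ideal (p i))"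
    using genideal_self[of "max_ideal (p i)"] mS gen_in_max_pt[OF xy(1)] by (auto simp: xy(3))
  then have "x \<in> {s * e | s. s \<in> S}" using e by (simp add: PIdl_ring_on)
  then show "e \<noteq> 0" using indep_nonzero(1)[OF xy(1)] by auto
  let ?I = "{s \<in> S. vge (multiplicity_at \<nu> p i) s}"
  have "ideal ?I (ring_on S)"
    unfolding ideal_ring_on_iff[OF sub]
  proof (intro conjI ballI)
    fix a b assume a: "a \<in> S" and b: "b \<in> ?I"
    have "vge 0 a" using val_V(1)[of a] a S by (auto simp: vge_def)
    then show "a * b \<in> ?I" using a b vge_mult[of 0 a _ b] subalgD(5)[OF sub] by auto
  qed (use subalgD[OF sub] vge_add in auto)
  moreover have "max_ideal (p i) \<subseteq> ?I"
    using mS multiplicity_le[OF i] by (auto simp: vge_def)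
  ultimately have "Idl\<^bsub>ring_on S\<^esub> (max_ideal (p i)) \<subseteq> ?I"
    by (rule genideal_minimal)
  moreover have "1 * e \<in> PIdl\<^bsub>ring_on S\<^esub> e"
    using subalgD(3)[OF sub] by (auto simp: PIdl_ring_on)
  ultimately have "vge (multiplicity_at \<nu> p i) e" using e(2) by auto
  then show "multiplicity_at \<nu> p i \<le> \<nu> e" using \<open>e \<noteq> 0\<close> by (simp add: vge_def)
qed

lemma passes_through_val:
  assumes pass: "passes_through d F n p m" and nz: "curve_divisor d F (p 1) \<noteq> 0"
  shows "(\<Sum>i=1..n. multiplicity_at \<nu> p i * int (m i)) \<le> \<nu> (curve_divisor d F (p 1))"
proof -
  define S where "S i = contraction p i n V" for i
  define e where "e i = exceptional_divisor (p i) (S i)" for i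
  obtain n' where n: "n = Suc n'" using n_ge_1 by (cases n) auto
  have "V \<in> surface p n" using V_exceptional by (simp add: n blowup_def)
  moreover have "contraction p 0 n V = p 1"
    using contraction_center[OF next_exceptional V_exceptional, of 0] n by simp
  moreover have "\<forall>S\<in>surface p n. curve_divisor d F (contraction p 0 n S) /
      (\<Prod>i=1..n. exceptional_divisor (p i) (contraction p i n S) ^ m i) \<in> S"
    using pass unfolding passes_through_def effective_def total_transform_def o_def .
  ultimately have *: "curve_divisor d F (p 1) / (\<Prod>i=1..n. e i ^ m i) \<in> V"
    unfolding e_def S_def by (auto dest!: bspec[of _ _ V])
  \<comment> \<open>The image of the generic point of the last divisor on the i-th surface is
    \<open>V\<close> itself for \<open>i = n\<close> and the next center otherwise; either way it
    lies on the i-th exceptional divisor.\<close>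
  have "S i \<in> exceptional (p i) \<and> S i \<subseteq> V" if "i \<in> {1..n}" for i
  proof (cases "i = n")
    case True then show ?thesis using V_exceptional by (simp add: S_def contraction_self)
  next
    case False
    then have "S i = p (Suc i)"
      unfolding S_def using that by (intro contraction_center next_exceptional V_exceptional) auto
    then show ?thesis using next_exceptional[of i] dominates_V[of "Suc i"] that False
      by (auto simp: dominates_def)
  qed
  then have e: "e i \<noteq> 0" "multiplicity_at \<nu> p i \<le> \<nu> (e i)" if "i \<in> {1..n}" for i
    using val_exceptional_divisor[of i "S i"] that by (auto simp: e_def)
  then have nz': "(\<Prod>i=1..n. e i ^ m i) \<noteq> 0" by (subst prod_zero_iff) auto
  have "(\<Sum>i=1..n. multiplicity_at \<nu> p i * int (m i)) \<le> (\<Sum>i=1..n. int (m i) * \<nu> (e i))"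
    using e by (intro sum_mono) (simp add: mult.commute mult_left_mono)
  also have "\<dots> = \<nu> (\<Prod>i=1..n. e i ^ m i)"
    using e by (subst val_prod) (auto simp: val_power intro!: sum.cong)
  also have "\<dots> \<le> \<nu> (curve_divisor d F (p 1))"
    using * val_V(1)[of "curve_divisor d F (p 1) / (\<Prod>i=1..n. e i ^ m i)"] nz nz'
    by (simp add: val_divide)
  finally show ?thesis .
qed

end

section \<open>Local equations of plane curves\<close>

definition tdeg_le :: "nat \<Rightarrow> 'k::field poly poly \<Rightarrow> bool" where
  "tdeg_le d g \<longleftrightarrow> (\<forall>i j. Polynomial.coeff (Polynomial.coeff g i) j \<noteq> 0 \<longrightarrow> i + j \<le> d)"

lemma tdeg_le_add: "tdeg_le d g \<Longrightarrow> tdeg_le d h \<Longrightarrow> tdeg_le d (g + h)"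
  unfolding tdeg_le_def by (metis add.right_neutral coeff_add)

lemma tdeg_le_mult:
  assumes "tdeg_le d g" "tdeg_le e h"
  shows "tdeg_le (d + e) (g * h)"
  unfolding tdeg_le_def
proof safe
  fix i j assume "Polynomial.coeff (Polynomial.coeff (g * h) i) j \<noteq> 0"
  then have "(\<Sum>a\<le>i. \<Sum>b\<le>j. Polynomial.coeff (Polynomial.coeff g a) b *
      Polynomial.coeff (Polynomial.coeff h (i - a)) (j - b)) \<noteq> 0"
    by (simp add: coeff_mult coeff_sum)
  then obtain a b where "a \<le> i" "b \<le> j" "Polynomial.coeff (Polynomial.coeff g a) b \<noteq> 0"
    "Polynomial.coeff (Polynomial.coeff h (i - a)) (j - b) \<noteq> 0"
    by (metis (no_types, lifting) atMost_iff mult_eq_0_iff sum.neutral)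
  then have "a + b \<le> d" "(i - a) + (j - b) \<le> e" using assms unfolding tdeg_le_def by blast+
  then show "i + j \<le> d + e" using \<open>a \<le> i\<close> \<open>b \<le> j\<close> by linarith
qed

lemma tdeg_le_mono: "tdeg_le d g \<Longrightarrow> d \<le> e \<Longrightarrow> tdeg_le e g"
  by (fastforce simp: tdeg_le_def)

lemma tdeg_le_gen: "tdeg_le 0 (pC c)" "tdeg_le 1 pX" "tdeg_le 1 pY"
  by (auto simp: tdeg_le_def pC_def pX_def pY_def coeff_pCons split: nat.splits)

text \<open>The possible local equations of curves of degree \<open>d\<close>. An affine-linear
  change of coordinates preserves this set, so the degree can still be read off in coordinates
  adapted to the tangent line.\<close>

definition Tpol :: "nat \<Rightarrow> 'k::field ratfun \<Rightarrow> 'k ratfun \<Rightarrow> 'k ratfun set" where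
  "Tpol d s t = ev s t ` {g. tdeg_le d g}"

lemma Tpol_add: "y \<in> Tpol d s t \<Longrightarrow> z \<in> Tpol d s t \<Longrightarrow> y + z \<in> Tpol d s t"
  unfolding Tpol_def using tdeg_le_add by (auto simp flip: ev_simps(3) intro!: imageI)

lemma Tpol_mult: "y \<in> Tpol d s t \<Longrightarrow> z \<in> Tpol e s t \<Longrightarrow> y * z \<in> Tpol (d + e) s t"
  unfolding Tpol_def using tdeg_le_mult by (auto simp flip: ev_simps(4) intro!: imageI)

lemma Tpol_mono: "y \<in> Tpol d s t \<Longrightarrow> d \<le> e \<Longrightarrow> y \<in> Tpol e s t"
  unfolding Tpol_def using tdeg_le_mono by auto

lemma Tpol_const: "const c \<in> Tpol d s t"
  unfolding Tpol_def using tdeg_le_mono[OF tdeg_le_gen(1)[of c]] by (force intro: image_eqI[of _ _ "pC c"])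

lemma Tpol_0_1: "0 \<in> Tpol d s t" "1 \<in> Tpol d s t"
  using Tpol_const[of 0] Tpol_const[of 1] by auto

lemma Tpol_gen: "s \<in> Tpol 1 s t" "t \<in> Tpol 1 s t"
  unfolding Tpol_def using tdeg_le_gen
  by (force intro: image_eqI[of _ _ pX], force intro: image_eqI[of _ _ pY])

lemma Tpol_power: "y \<in> Tpol 1 s t \<Longrightarrow> y ^ n \<in> Tpol n s t"
  by (induction n) (use Tpol_mult[of y 1 s t] Tpol_0_1 in auto)

text \<open>Reduces membership of an evaluated polynomial to its monomials. It is applied once per
  variable, with the remaining powers absorbed into the set \<open>A\<close>.\<close>

lemma hev_closure:
  assumes "rhom \<phi>" "0 \<in> A" "\<And>y z. y \<in> A \<Longrightarrow> z \<in> A \<Longrightarrow> y + z \<in> A"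
    and "\<And>i. \<phi> (Polynomial.coeff p i) * x ^ i \<in> A"
  shows "hev \<phi> x p \<in> A"
proof -
  have "(\<And>i. \<phi> (Polynomial.coeff p i) * x ^ (i + k) \<in> A) \<Longrightarrow> hev \<phi> x p * x ^ k \<in> A" for k
  proof (induction p arbitrary: k)
    case (pCons a p)
    have "\<phi> a * x ^ k + hev \<phi> x p * x ^ Suc k \<in> A"
      using assms(3) pCons(3)[of 0] pCons(2)[of "Suc k"] pCons(3)[of "Suc _"] by simp
    then show ?case by (simp add: hev_pCons assms(1) algebra_simps)
  qed (use assms in simp)
  from this[of 0] show ?thesis using assms(4) by simp
qed

lemma Tpol_change:
  assumes "s \<in> Tpol 1 u v" "t \<in> Tpol 1 u v"
  shows "Tpol d s t \<subseteq> Tpol d u v"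
proof
  fix z assume "z \<in> Tpol d s t"
  then obtain g where g: "tdeg_le d g" "z = ev s t g" by (auto simp: Tpol_def)
  have "hev const t (Polynomial.coeff g i) \<in> {z. z * s ^ i \<in> Tpol d u v}" for i
  proof (rule hev_closure[OF rhom_const])
    fix j
    let ?c = "Polynomial.coeff (Polynomial.coeff g i) j"
    have "const ?c * t ^ j * s ^ i \<in> Tpol (0 + j + i) u v"
      by (intro Tpol_mult Tpol_const Tpol_power assms)
    moreover have "?c \<noteq> 0 \<Longrightarrow> 0 + j + i \<le> d" using g(1) by (auto simp: tdeg_le_def add.commute)
    ultimately show "const ?c * t ^ j \<in> {z. z * s ^ i \<in> Tpol d u v}"
      using Tpol_mono Tpol_0_1 by (cases "?c = 0") auto
  qed (auto simp: Tpol_0_1 Tpol_add distrib_right)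
  then show "z \<in> Tpol d u v"
    unfolding g ev_def by (intro hev_closure rhom_hev rhom_const Tpol_0_1 Tpol_add) auto
qed

lemma generic_value_eq: "generic_value F = hev (ev (hcoord 1) (hcoord 2)) (hcoord 0) F"
  by (simp add: generic_value_def ev_def hev_def[abs_def])

text \<open>Setting the first homogeneous coordinate to 1 causes no cancellation: in a form of
  degree \<open>d\<close> the exponents \<open>j\<close> and \<open>l\<close> determine the
  remaining one.\<close>

lemma generic_value_nonzero:
  assumes "plane_curve d F"
  shows "generic_value F \<noteq> 0"
proof -
  let ?c = "\<lambda>i j l. Polynomial.coeff (Polynomial.coeff (Polynomial.coeff F i) j) l"
  have hom: "?c i j l \<noteq> 0 \<Longrightarrow> i + j + l = d" for i j l
    using assms by (simp add: plane_curve_def)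
  have "hev \<phi> 1 F = \<phi> (poly F 1)" if "rhom \<phi>" for \<phi> :: "'a poly poly \<Rightarrow> 'a ratfun"
    by (induction F) (simp_all add: hev_pCons that rhom_simps[OF that])
  then have "generic_value F = ev (hcoord 1) (hcoord 2) (poly F 1)"
    by (simp only: generic_value_eq hcoord_0 rhom_ev)
  moreover have "poly F 1 \<noteq> 0"
  proof
    assume 0: "poly F 1 = 0"
    have "F \<noteq> 0" using assms by (simp add: plane_curve_def)
    then obtain i j l where ijl: "?c i j l \<noteq> 0"
      by (metis leading_coeff_0_iff)
    have "(\<Sum>k\<le>degree F. ?c k j l) = Polynomial.coeff (Polynomial.coeff (poly F 1) j) l"
      by (simp add: poly_altdef coeff_sum)
    also have "(\<Sum>k\<le>degree F. ?c k j l) = (\<Sum>k\<in>{i}. ?c k j l)"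
    proof (rule sum.mono_neutral_right)
      show "{i} \<subseteq> {..degree F}" using ijl by (auto intro: le_degree)
      show "\<forall>k\<in>{..degree F} - {i}. ?c k j l = 0"
        using hom[of i j l] hom[of _ j l] ijl by fastforce
    qed auto
    finally show False using ijl 0 by simp
  qed
  ultimately show ?thesis by (metis indep_ev_eq_0_iff[OF indep_coords])
qed

lemma generic_value_Tpol:
  fixes s t :: "'k::field ratfun"
  assumes F: "plane_curve d F" and i: "i < 3" and st: "plane_coords i = (s, t)"
  shows "generic_value F / hcoord i ^ d \<in> Tpol d s t"
proof -
  let ?X = "hcoord i :: 'k ratfun" and ?c = "\<lambda>i j l. Polynomial.coeff (Polynomial.coeff (Polynomial.coeff F i) j) l"
  have quot: "hcoord j / ?X \<in> Tpol 1 s t" if "j < 3" for j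
  proof -
    have "hcoord j / ?X \<in> {1, s, t}"
      using lt_3_cases[OF i] lt_3_cases[OF that] st
      by (auto simp: plane_coords_def inverse_eq_divide)
    then show ?thesis using Tpol_gen(1)[of s t] Tpol_gen(2)[of t s] Tpol_0_1(2)[of 1 s t]
      by (elim insertE) (simp_all only: empty_iff)
  qed
  have monomial: "const (?c a b l) * hcoord 2 ^ l * hcoord 1 ^ b * hcoord 0 ^ a / ?X ^ d \<in> Tpol d s t" for a b l
  proof (cases "?c a b l = 0")
    case True then show ?thesis by (simp add: Tpol_0_1)
  next
    case False
    then have d: "a + b + l = d" using F by (simp add: plane_curve_def)
    have "const (?c a b l) * (hcoord 2 / ?X) ^ l * (hcoord 1 / ?X) ^ b * (hcoord 0 / ?X) ^ a
        \<in> Tpol (0 + l + b + a) s t"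
      by (intro Tpol_mult Tpol_const Tpol_power quot) auto
    moreover have "0 + l + b + a = d" using d by simp
    moreover have "const (?c a b l) * (hcoord 2 / ?X) ^ l * (hcoord 1 / ?X) ^ b * (hcoord 0 / ?X) ^ a
        = const (?c a b l) * hcoord 2 ^ l * hcoord 1 ^ b * hcoord 0 ^ a / ?X ^ d"
      by (simp add: power_divide power_add flip: d)
    ultimately show ?thesis by metis
  qed
  let ?A = "{z. z / ?X ^ d \<in> Tpol d s t}"
  have A: "0 \<in> ?A" "y \<in> ?A \<Longrightarrow> z \<in> ?A \<Longrightarrow> y + z \<in> ?A" for y z
    by (auto simp: Tpol_0_1 add_divide_distrib Tpol_add)
  have 1: "hev const (hcoord 2) (Polynomial.coeff (Polynomial.coeff F a) b) \<in>
      {z. z * hcoord 1 ^ b * hcoord 0 ^ a \<in> ?A}" for a b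
    using monomial by (intro hev_closure rhom_const)
      (auto simp: Tpol_0_1 add_divide_distrib Tpol_add distrib_right)
  have 2: "hev (hev const (hcoord 2)) (hcoord 1) (Polynomial.coeff F a) \<in> {z. z * hcoord 0 ^ a \<in> ?A}" for a
    using 1 by (intro hev_closure rhom_hev rhom_const)
      (auto simp: Tpol_0_1 add_divide_distrib Tpol_add distrib_right)
  have "generic_value F \<in> ?A"
    unfolding generic_value_eq ev_def using 2 A
    by (intro hev_closure rhom_hev rhom_const) auto
  then show ?thesis by simp
qed

text \<open>Puts the value of a coordinate vanishing at the center among those maximized in
  \<open>tangency\<close>, so the maximum is positive and at least \<open>beta0\<close>.\<close>

lemma line_exists:
  assumes i: "i < 3" and st: "plane_coords i = (s, t)"
  obtains L where "plane_curve 1 L" "generic_value L / hcoord i ^ 1 = s - const a"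
proof -
  define lin :: "'a \<Rightarrow> 'a \<Rightarrow> 'a \<Rightarrow> 'a poly poly poly" where
    "lin c0 c1 c2 = [:[:[:0, c2:], [:c1:]:], [:[:c0:]:]:]" for c0 c1 c2
  have gv: "generic_value (lin c0 c1 c2) = const c0 + const c1 * hcoord 1 + const c2 * hcoord 2" for c0 c1 c2
    by (simp add: lin_def generic_value_eq ev_def hev_pCons rhom_hev rhom_const algebra_simps)
  have pc: "plane_curve 1 (lin c0 c1 c2)" if "c0 \<noteq> 0 \<or> c1 \<noteq> 0 \<or> c2 \<noteq> 0" for c0 c1 c2
    using that by (auto simp: plane_curve_def lin_def coeff_pCons split: nat.splits)
  have "\<exists>c0 c1 c2. (c0 \<noteq> 0 \<or> c1 \<noteq> 0 \<or> c2 \<noteq> 0) \<and> generic_value (lin c0 c1 c2) / hcoord i = s - const a"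
  proof -
    consider "i = 0" | "i = 1" | "i = 2" using lt_3_cases[OF i] by blast
    then show ?thesis
    proof cases
      case 1 then show ?thesis using st
        by (intro exI[of _ "- a"] exI[of _ 1] exI[of _ 0]) (auto simp: gv plane_coords_def)
    next
      case 2 then show ?thesis using st
        by (intro exI[of _ 1] exI[of _ "- a"] exI[of _ 0]) (auto simp: gv plane_coords_def field_simps)
    next
      case 3 then show ?thesis using st
        by (intro exI[of _ 1] exI[of _ 0] exI[of _ "- a"]) (auto simp: gv plane_coords_def field_simps)
    qed
  qed
  then show ?thesis using that pc by (metis power_one_right)
qed

section \<open>Values of the lines through the center\<close>

lemma solve_linear:
  assumes "a \<noteq> 0"
  shows "u = const (inverse a) * (const a * u + const b * v) + const (- inverse a * b) * v"
proof -
  have "const (inverse a) * const a = const (inverse a * a)" by (simp only: const_simps)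
  then have "const (inverse a) * const a = 1" using assms by simp
  then have "const (inverse a) * (const a * u) = u" by (simp flip: mult.assoc)
  then show ?thesis by (simp add: distrib_left)
qed

context const_valuation
begin

lemma val_span_neq:
  assumes "u \<noteq> 0" "v \<noteq> 0" "\<nu> u \<noteq> \<nu> v" "const a * u + const b * v \<noteq> 0"
  shows "\<nu> (const a * u + const b * v) \<in> {\<nu> u, \<nu> v}"
proof -
  have *: "c \<noteq> 0 \<Longrightarrow> z \<noteq> 0 \<Longrightarrow> \<nu> (const c * z) = \<nu> z" for c z
    by (simp add: val_mult val_const)
  consider "a = 0" | "b = 0" | "a \<noteq> 0" "b \<noteq> 0" "\<nu> u < \<nu> v" | "a \<noteq> 0" "b \<noteq> 0" "\<nu> v < \<nu> u"
    using assms(3) by linarith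
  then show ?thesis
  proof cases
    case 3 then show ?thesis
      using val_add_eq(2)[of "const a * u" "const b * v"] assms * by simp
  next
    case 4 then show ?thesis
      using val_add_eq(2)[of "const b * v" "const a * u"] assms * by (simp add: add.commute)
  qed (use assms * in auto)
qed

text \<open>A valuation trivial on constants takes at most two values on a two-dimensional space:
  unless all nonzero elements have the value of \<open>v\<close>, the space has a basis
  \<open>h\<close>, \<open>v\<close> of different values, and no other value then occurs. Finiteness
  is what gives \<open>Max\<close> in \<open>tangency\<close> its meaning.\<close>

lemma finite_val_span:
  assumes "u \<noteq> 0" "v \<noteq> 0"
  shows "finite {\<nu> (const a * u + const b * v) | a b. const a * u + const b * v \<noteq> 0}"
proof -
  have neq: "finite {\<nu> (const a * u + const b * v) | a b. const a * u + const b * v \<noteq> 0}"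
    if "u \<noteq> 0" "\<nu> u \<noteq> \<nu> v" for u
    by (rule finite_subset[of _ "{\<nu> u, \<nu> v}"]) (use val_span_neq that assms in blast, simp)
  show ?thesis
  proof (cases "\<exists>a b. const a * u + const b * v \<noteq> 0 \<and> \<nu> (const a * u + const b * v) \<noteq> \<nu> v")
    case False
    then have "{\<nu> (const a * u + const b * v) | a b. const a * u + const b * v \<noteq> 0} \<subseteq> {\<nu> v}"
      by blast
    then show ?thesis by (rule finite_subset) simp
  next
    case True
    then obtain a b where h: "const a * u + const b * v \<noteq> 0" "\<nu> (const a * u + const b * v) \<noteq> \<nu> v"
      by blast
    define h where "h = const a * u + const b * v"
    have "a \<noteq> 0" using h assms by (auto simp: val_mult val_const)
    then have u: "u = const (inverse a) * h + const (- inverse a * b) * v"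
      unfolding h_def by (rule solve_linear)
    have "const c * u + const e * v = const (c * inverse a) * h + const (e - c * inverse a * b) * v" for c e
      by (subst u) (simp add: algebra_simps)
    then have "{\<nu> (const a * u + const b * v) | a b. const a * u + const b * v \<noteq> 0} \<subseteq>
      {\<nu> (const a * h + const b * v) | a b. const a * h + const b * v \<noteq> 0}"
      unfolding subset_iff mem_Collect_eq by metis
    then show ?thesis using neq[of h] h finite_subset by (auto simp: h_def)
  qed
qed

end

lemma Tpol_1_iff: "z \<in> Tpol 1 u v \<longleftrightarrow> (\<exists>c a b. z = const c + const a * u + const b * v)"
proof
  assume "z \<in> Tpol 1 u v"
  then obtain g where g: "tdeg_le 1 g" "z = ev u v g" by (auto simp: Tpol_def)
  let ?c = "\<lambda>i j. Polynomial.coeff (Polynomial.coeff g i) j"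
  have "g = pC (?c 0 0) + pC (?c 1 0) * pX + pC (?c 0 1) * pY"
  proof (intro poly_eqI)
    fix i j
    have "i + j > 1 \<Longrightarrow> ?c i j = 0" using g(1) by (fastforce simp: tdeg_le_def)
    then show "?c i j = Polynomial.coeff (Polynomial.coeff (pC (?c 0 0) + pC (?c 1 0) * pX + pC (?c 0 1) * pY) i) j"
      by (auto simp: pC_def pX_def pY_def coeff_pCons split: nat.splits)
  qed
  then have "ev u v g = ev u v (pC (?c 0 0) + pC (?c 1 0) * pX + pC (?c 0 1) * pY)" by simp
  then have "z = const (?c 0 0) + const (?c 1 0) * u + const (?c 0 1) * v"
    using g(2) by (simp only: ev_gen ev_simps(3,4))
  then show "\<exists>c a b. z = const c + const a * u + const b * v" by blast
next
  have "const c + const a * u + const b * v \<in> Tpol 1 u v" for a b c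
    using Tpol_mult[OF Tpol_const[of a 0] Tpol_gen(1)[of u v]]
      Tpol_mult[OF Tpol_const[of b 0] Tpol_gen(2)[of v u]]
    by (intro Tpol_add Tpol_const) auto
  then show "\<exists>c a b. z = const c + const a * u + const b * v \<Longrightarrow> z \<in> Tpol 1 u v" by auto
qed

context divisorial
begin

text \<open>A line missing \<open>p\<close> has value 0, and one through \<open>p\<close> has an
  equation \<open>a x + b y\<close>, so the maximum is attained by such a form \<open>u\<close>.
  Completed by \<open>x\<close> or \<open>y\<close>, it is again a coordinate system at
  \<open>p\<close>, and the curve equations keep their degree.\<close>

lemma tangent_coordinates:
  obtains u v where "indep u v" "full u v" "p 1 = pt u v" "\<nu> u = tangency \<nu> (p 1)"
    "\<And>d F. plane_curve d F \<Longrightarrow> curve_divisor d F (p 1) \<in> Tpol d u v - {0}"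
    "beta0 \<nu> (p 1) \<le> \<nu> u"
proof -
  note goal = that
  \<comment> \<open>The chart that \<open>SOME\<close> selects in \<open>curve_divisor\<close>, so
    that local equations unfold in these coordinates.\<close>
  define i where "i = (SOME i. i < 3 \<and> p 1 \<in> affine_model (chart_ring i))"
  have cp: "closed_point proj_plane (p 1)"
    using divisorial n_ge_1 unfolding divisorial_valuation_def simple_configuration_def
    by (metis atLeastAtMost_iff diff_self_eq_0 order_refl surface.simps(1))
  then have "\<exists>i. i < 3 \<and> p 1 \<in> affine_model (chart_ring i)"
    unfolding closed_point_def proj_plane_def by blast
  then have i: "i < 3" "p 1 \<in> affine_model (chart_ring i)"
    unfolding i_def by (metis (mono_tags, lifting) someI_ex)+
  obtain s t where st: "plane_coords i = (s, t :: 'k ratfun)" by fastforce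
  obtain a b where p1: "p 1 = pt (s - const a) (t - const b)"
    using closed_point_plane[OF cp i(2,1) st] .
  define x where "x = s - const a"
  define y where "y = t - const b"
  have xy: "indep x y" "full x y" "p 1 = pt x y"
    unfolding x_def y_def p1 using plane_coords_indep[OF st]
    by (auto intro: indep_shift full_shift)
  have x0: "x \<noteq> 0" "y \<noteq> 0" using indep_nonzero[OF xy(1)] by auto
  have cd: "curve_divisor d F (p 1) = generic_value F / hcoord i ^ d" for d F
    by (simp add: curve_divisor_def i_def)
  have "s = const a + 1 * x" "t = const b + 1 * y" by (simp_all add: x_def y_def)
  then have "s \<in> Tpol 1 x y" "t \<in> Tpol 1 x y"
    using Tpol_gen[of x y] Tpol_gen[of y x] by (auto intro: Tpol_add Tpol_const Tpol_gen)
  then have sub: "Tpol d s t \<subseteq> Tpol d x y" for d by (rule Tpol_change)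
  have curve: "curve_divisor d F (p 1) \<in> Tpol d x y - {0}" if "plane_curve d F" for d F
    using generic_value_Tpol[OF that i(1) st] generic_value_nonzero[OF that] sub cd by auto
  let ?Z = "{\<nu> (curve_divisor 1 L (p 1)) | L. plane_curve 1 L}"
  note loc = local_subalg_pt[OF xy(1)]
  note subR = local_subalgD[OF loc]
  have lin_max: "const a * x + const b * y \<in> max_ideal (pt x y)" for a b
    by (intro max_ideal_closed[OF loc] gen_in_max_pt xy subalgD(1)[OF subR])
  have unit0: "\<nu> z = 0" if "unit_in (p 1) z" for z
  proof -
    have "p 1 \<subseteq> V" using dominates_V[of 1] n_ge_1 by (simp add: dominates_def)
    then have "unit_in V z" using unit_in_mono that by blast
    then show ?thesis using val_V(2)[of z] by (auto simp: unit_in_def)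
  qed
  have lin: "\<nu> z = 0 \<or> (\<exists>a b. z = const a * x + const b * y)" if zT: "z \<in> Tpol 1 x y" for z
  proof -
    obtain c a b where z: "z = const c + const a * x + const b * y"
      using zT Tpol_1_iff[of z x y] by blast
    show ?thesis
    proof (cases "c = 0")
      case False
      then have "unit_in (p 1) (const c + (const a * x + const b * y))"
        unfolding xy(3) by (intro unit_plus_max[OF loc] unit_in_const subR lin_max)
      then show ?thesis using unit0 by (simp add: z add.assoc)
    qed (use z in auto)
  qed
  have "?Z \<subseteq> insert 0 {\<nu> (const a * x + const b * y) | a b. const a * x + const b * y \<noteq> 0}"
    using curve lin by fastforce
  then have fin: "finite ?Z"
    using finite_val_span[OF x0] finite_subset by blast
  obtain L where L: "plane_curve 1 L" "curve_divisor 1 L (p 1) = x"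
    using line_exists[OF i(1) st, of a] cd by (metis x_def)
  then have xZ: "\<nu> x \<in> ?Z" by force
  have T: "tangency \<nu> (p 1) = Max ?Z" by (simp add: tangency_def)
  have Tx: "\<nu> x \<le> tangency \<nu> (p 1)" unfolding T using fin xZ by simp
  have "tangency \<nu> (p 1) \<in> ?Z" unfolding T using fin xZ by (intro Max_in) auto
  then obtain u where u: "u \<in> Tpol 1 x y" "u \<noteq> 0" "\<nu> u = tangency \<nu> (p 1)"
    using curve by force
  have "\<nu> x > 0"
    using val_pos[of 1 x] n_ge_1 gen_in_max_pt[OF xy(1)] x0 by (simp flip: xy(3))
  then obtain a b where ab: "u = const a * x + const b * y" using lin[OF u(1)] u(3) Tx by auto
  have beta: "beta0 \<nu> (p 1) \<le> \<nu> u"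
  proof -
    have "beta0 \<nu> (p 1) \<le> \<nu> x"
      unfolding beta0_def
    proof (rule ideal_value_le(1))
      show "0 \<le> \<nu> z" if "z \<in> max_ideal (p 1)" "z \<noteq> 0" for z
        using val_pos[of 1 z] n_ge_1 that by simp
    qed (use gen_in_max_pt[OF xy(1)] xy(3) x0 in auto)
    then show ?thesis using Tx u(3) by simp
  qed
  \<comment> \<open>Stated for arbitrary coordinates so that it can be reused with \<open>x\<close>
    and \<open>y\<close> exchanged when \<open>u\<close> is a multiple of \<open>y\<close>.\<close>
  have main: thesis if xy: "indep x y" "full x y" "p 1 = pt x y" and u_eq: "u = const a * x + const b * y"
    and a: "a \<noteq> 0"
    and curve: "\<And>d F. plane_curve d F \<Longrightarrow> curve_divisor d F (p 1) \<in> Tpol d x y - {0}" for x y a b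
  proof -
    have uy: "indep u y" "full u y"
      unfolding u_eq using indep_linear[OF xy(1) a] full_linear[OF xy(2) a] by auto
    have x: "x = const 0 + const (inverse a) * u + const (- inverse a * b) * y"
      using solve_linear[OF a, of x b y] by (simp add: u_eq)
    then have "x \<in> Tpol 1 u y" unfolding Tpol_1_iff by blast
    moreover have "y \<in> Tpol 1 u y" by (rule Tpol_gen)
    ultimately have "Tpol d x y \<subseteq> Tpol d u y" for d by (rule Tpol_change)
    then have c: "curve_divisor d F (p 1) \<in> Tpol d u y - {0}" if "plane_curve d F" for d F
      using curve that by blast
    have "pt u y = pt x y"
    proof
      note loc = local_subalg_pt[OF xy(1)] and loc' = local_subalg_pt[OF uy(1)]
      note c = subalgD(1)[OF local_subalgD[OF loc]] subalgD(1)[OF local_subalgD[OF loc']]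
      have "u \<in> max_ideal (pt x y)" unfolding u_eq
        by (intro max_ideal_closed[OF loc] gen_in_max_pt xy c)
      then show "pt u y \<subseteq> pt x y" by (intro pt_minimal loc gen_in_max_pt xy)
      have "const (inverse a) * u + const (- inverse a * b) * y \<in> max_ideal (pt u y)"
        by (intro max_ideal_closed[OF loc'] gen_in_max_pt uy c)
      then have "x \<in> max_ideal (pt u y)" using x by simp
      then show "pt x y \<subseteq> pt u y" by (intro pt_minimal loc' gen_in_max_pt uy)
    qed
    then show thesis using goal[OF uy] xy(3) u(3) c beta by metis
  qed
  show thesis
  proof (cases "a = 0")
    case False
    then show thesis using main[OF xy ab _ curve] by blast
  next
    case True
    have b: "b \<noteq> 0" using True ab u(2) by auto
    have u_eq: "u = const b * y + const a * x" using ab by simp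
    have p1: "p 1 = pt y x" using pt_swap[OF xy(1)] xy(3) by simp
    have "Tpol d x y \<subseteq> Tpol d y x" for d by (intro Tpol_change Tpol_gen)
    then have "curve_divisor d F (p 1) \<in> Tpol d y x - {0}" if "plane_curve d F" for d F
      using curve[OF that] by blast
    then show thesis
      by (rule main[OF indep_swap[OF xy(1)] full_swap[OF xy(2)] p1 u_eq b])
  qed
qed

end

section \<open>Lengths of quotients\<close>

lemma ideal_subset_Union_quot:
  assumes "cring Q" "ideal I Q" "ideal J (Q Quot I)"
  shows "I \<subseteq> \<Union>J"
  using additive_subgroup.zero_closed[OF ideal.axioms(1)[OF assms(3)]] unfolding FactRing_def by auto

text \<open>By the correspondence of ideals, lengths of quotients are measured from here on by
  chains of ideals of \<open>Q\<close> above \<open>I\<close>.\<close>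

lemma ring_length_quot_ge:
  assumes Q: "cring Q" and I: "ideal I Q"
    and W: "\<And>i. i \<le> r \<Longrightarrow> ideal (W i) Q \<and> I \<subseteq> W i" "\<And>i. i < r \<Longrightarrow> W i \<subset> W (Suc i)"
  shows "enat r \<le> ring_length (Q Quot I)"
proof -
  interpret cring Q by fact
  let ?J = "\<lambda>i. (+>\<^bsub>Q\<^esub>) I ` W i"
  have U: "\<Union>(?J i) = W i" if "i \<le> r" for i
    using ideal_incl_iff[OF I, of "W i"] W(1)[OF that] by auto
  have 1: "\<forall>i\<le>r. ideal (?J i) (Q Quot I)"
    using ring_ideal_imp_quot_ideal[OF I] W(1) by blast
  have 2: "\<forall>i<r. ?J i \<subset> ?J (Suc i)"
  proof (intro allI impI)
    fix i assume i: "i < r"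
    show "?J i \<subset> ?J (Suc i)"
    proof
      show "?J i \<subseteq> ?J (Suc i)" using W(2)[OF i] by blast
      show "?J i \<noteq> ?J (Suc i)"
      proof
        assume "?J i = ?J (Suc i)"
        then have "\<Union>(?J i) = \<Union>(?J (Suc i))" by (rule arg_cong)
        then have "W i = W (Suc i)" unfolding U[OF less_imp_le[OF i]] U[OF Suc_leI[OF i]] .
        then show False using W(2)[OF i] by blast
      qed
    qed
  qed
  show ?thesis
    unfolding ring_length_def
    by (intro Sup_upper CollectI exI[of _ r] conjI[OF refl] exI[of _ ?J] conjI[OF 1 2])
qed

lemma ring_length_quot_le:
  assumes Q: "cring Q" and I: "ideal I Q"
    and N: "\<And>r W. (\<And>i. i \<le> r \<Longrightarrow> ideal (W i) Q \<and> I \<subseteq> W i) \<Longrightarrow>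
      (\<And>i. i < r \<Longrightarrow> W i \<subset> W (Suc i)) \<Longrightarrow> r \<le> N"
  shows "ring_length (Q Quot I) \<le> enat N"
  unfolding ring_length_def
proof (rule Sup_least, safe)
  interpret cring Q by fact
  fix r and J :: "nat \<Rightarrow> 'a set set"
  assume J: "\<forall>i\<le>r. ideal (J i) (Q Quot I)" "\<forall>i<r. J i \<subset> J (Suc i)"
  have inj: "J i = (+>\<^bsub>Q\<^esub>) I ` (\<Union>(J i))" if i: "i \<le> r" for i
  proof -
    have "J i \<in> (\<lambda>J. (+>\<^bsub>Q\<^esub>) I ` J) ` {J. ideal J Q \<and> I \<subseteq> J}"
      using bij_betw_imp_surj_on[OF quot_ideal_correspondence[OF I]] J(1) i by blast
    then obtain K where K: "ideal K Q" "I \<subseteq> K" "J i = (+>\<^bsub>Q\<^esub>) I ` K" by blast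
    then have "\<Union>(J i) = K" using ideal_incl_iff[OF I K(1)] by auto
    then show ?thesis using K by simp
  qed
  have "r \<le> N"
  proof (rule N[of r "\<lambda>i. \<Union>(J i)"])
    show "ideal (\<Union>(J i)) Q \<and> I \<subseteq> \<Union>(J i)" if "i \<le> r" for i
      using quot_ideal_imp_ring_ideal[OF I] ideal_subset_Union_quot[OF Q I] J(1) that by blast
    show "\<Union>(J i) \<subset> \<Union>(J (Suc i))" if i: "i < r" for i
    proof
      show "\<Union>(J i) \<subseteq> \<Union>(J (Suc i))" using J(2) i by blast
      show "\<Union>(J i) \<noteq> \<Union>(J (Suc i))"
      proof
        assume "\<Union>(J i) = \<Union>(J (Suc i))"
        then have "J i = J (Suc i)"
          by (subst inj[OF less_imp_le[OF i]], subst inj[OF Suc_leI[OF i]]) (rule arg_cong)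
        then show False using J(2) i by blast
      qed
    qed
  qed
  then show "enat r \<le> enat N" by simp
qed

text \<open>Ideals of a local ring over \<open>k\<close> are \<open>k\<close>-subspaces, so linear
  algebra bounds lengths from above.\<close>

interpretation ratfun: vector_space "\<lambda>c (z :: 'k::field ratfun). const c * z"
  by unfold_locales (simp_all add: algebra_simps)

text \<open>Each strict step of the chain contains a new element, which can be corrected by an
  element of \<open>I\<close>, already present in every \<open>W i\<close>, so as to lie in the span
  of \<open>E\<close>. The elements chosen this way are independent.\<close>

lemma subspace_chain_bound:
  fixes W :: "nat \<Rightarrow> 'k::field ratfun set"
  assumes sub: "\<And>i. i \<le> r \<Longrightarrow> ratfun.subspace (W i)" and strict: "\<And>i. i < r \<Longrightarrow> W i \<subset> W (Suc i)"
    and E: "finite E" and I: "I \<subseteq> W 0" and gen: "\<And>z. z \<in> W r \<Longrightarrow> \<exists>e\<in>ratfun.span E. z - e \<in> I"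
  shows "r \<le> card E"
proof -
  have mono: "W i \<subseteq> W j" if "i \<le> j" "j \<le> r" for i j
    using that
  proof (induction j rule: dec_induct)
    case (step n)
    then show ?case using strict[of n] by auto
  qed simp
  have "\<exists>b. b \<in> W (Suc i) - W i \<and> b \<in> ratfun.span E" if i: "i < r" for i
  proof -
    obtain z where z: "z \<in> W (Suc i)" "z \<notin> W i" using strict[OF i] by blast
    then obtain e where e: "e \<in> ratfun.span E" "z - e \<in> I"
      using gen[of z] mono[of "Suc i" r] i by auto
    then have ze: "z - e \<in> W i" "z - e \<in> W (Suc i)"
      using I mono[of 0 i] mono[of 0 "Suc i"] i by auto
    have "z - (z - e) \<in> W (Suc i)" using ratfun.subspace_diff[OF sub z(1) ze(2)] i by simp
    moreover have "e \<notin> W i" using ratfun.subspace_add[OF sub ze(1), of e] z(2) i by auto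
    ultimately show ?thesis using e by auto
  qed
  then obtain b where b: "\<And>i. i < r \<Longrightarrow> b i \<in> W (Suc i) - W i" "\<And>i. i < r \<Longrightarrow> b i \<in> ratfun.span E"
    by metis
  have "k \<le> r \<Longrightarrow> ratfun.independent (b ` {..<k}) \<and> card (b ` {..<k}) = k \<and> b ` {..<k} \<subseteq> W k" for k
  proof (induction k)
    case (Suc k)
    then have IH: "ratfun.independent (b ` {..<k})" "card (b ` {..<k}) = k" "b ` {..<k} \<subseteq> W k"
      by auto
    have span: "ratfun.span (b ` {..<k}) \<subseteq> W k"
      using ratfun.span_minimal[OF IH(3) sub] Suc by simp
    have bk: "b k \<notin> W k" "b k \<in> W (Suc k)" using b(1)[of k] Suc by auto
    have "b ` {..<Suc k} = insert (b k) (b ` {..<k})" by (auto simp: lessThan_Suc)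
    moreover have "ratfun.independent (insert (b k) (b ` {..<k}))"
      using ratfun.independent_insertI[OF _ IH(1)] span bk by blast
    moreover have "card (insert (b k) (b ` {..<k})) = Suc k"
      using IH(2,3) bk by (subst card_insert_disjoint) auto
    ultimately show ?case using IH(3) strict[of k] Suc bk by auto
  qed (simp add: ratfun.independent_empty)
  from this[of r] have "ratfun.independent (b ` {..<r})" "card (b ` {..<r}) = r" by auto
  moreover have "b ` {..<r} \<subseteq> ratfun.span E" using b(2) by auto
  ultimately show ?thesis using ratfun.independent_span_bound[OF E] by metis
qed

lemma subspace_ideal:
  assumes "subalg R" "ideal W (ring_on R)"
  shows "ratfun.subspace W"
  using assms(2) subalgD(1)[OF assms(1)] unfolding ideal_ring_on_iff[OF assms(1)]
  by (intro ratfun.subspaceI) auto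

lemma valuation_ideal_eq:
  assumes "const_valuation \<nu>" "0 \<in> R"
  shows "valuation_ideal \<nu> R m = {h \<in> R. const_valuation.vge \<nu> (int m) h}"
  using assms(2) by (auto simp: valuation_ideal_def const_valuation.vge_def[OF assms(1)])

text \<open>The points lie in a triangle of area \<open>m^2 / (2 A B)\<close>. The induction removes
  the row \<open>j = 0\<close>, which has at most \<open>m / A + 1\<close> points; the shift by
  \<open>A + B\<close> is chosen so that \<open>(m + A)^2 + 2 (m + A) B \<le> (m + A + B)^2\<close>
  closes the step.\<close>

lemma count_lattice_points:
  fixes A B :: nat
  assumes "A \<ge> 1" "B \<ge> 1"
  shows "finite {(i, j). i * A + j * B < m}"
    "real (card {(i, j). i * A + j * B < m}) \<le> (real m + A + B)\<^sup>2 / (2 * A * B)"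
proof -
  let ?S = "\<lambda>m. {(i, j). i * A + j * B < m}"
  have fin: "finite (?S m)" for m
  proof (rule finite_subset)
    show "?S m \<subseteq> {..<m} \<times> {..<m}"
    proof safe
      fix i j assume *: "i * A + j * B < m"
      have "i * 1 \<le> i * A" "j * 1 \<le> j * B" using assms by (intro mult_le_mono; simp)+
      then show "i < m" "j < m" using * by linarith+
    qed
  qed simp
  then show "finite (?S m)" .
  show "real (card (?S m)) \<le> (real m + A + B)\<^sup>2 / (2 * A * B)"
  proof (induction m rule: less_induct)
    case (less m)
    have AB: "real A \<ge> 1" "real B \<ge> 1" using assms by auto
    show ?case
    proof (cases "m = 0")
      case False
      let ?T = "{i. i * A < m}"
      have T: "?T \<subseteq> {..m div A}"
        using assms by (auto simp: less_eq_div_iff_mult_less_eq)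
      then have "card ?T \<le> m div A + 1"
        using card_mono[OF finite_atMost T] by simp
      moreover have "real (m div A) \<le> real m / A" by (rule of_nat_div_le_of_nat)
      ultimately have cT: "real (card ?T) \<le> real m / A + 1" by linarith
      have finT: "finite ?T" using T finite_subset by blast
      have "?S m \<subseteq> (\<lambda>i. (i, 0)) ` ?T \<union> (\<lambda>(i, j). (i, Suc j)) ` ?S (m - B)"
      proof safe
        fix i j assume ij: "i * A + j * B < m"
          and n: "(i, j) \<notin> (\<lambda>(i, j). (i, Suc j)) ` ?S (m - B)"
        show "(i, j) \<in> (\<lambda>i. (i, 0)) ` ?T"
        proof (cases j)
          case (Suc j')
          then have "(i, j') \<in> ?S (m - B)" using ij by auto
          then show ?thesis using n Suc by force
        qed (use ij in auto)
      qed
      then have "card (?S m) \<le> card ((\<lambda>i. (i, 0)) ` ?T \<union> (\<lambda>(i, j). (i, Suc j)) ` ?S (m - B))"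
        using finT fin by (intro card_mono) auto
      also have "\<dots> \<le> card ((\<lambda>i. (i, 0::nat)) ` ?T) + card ((\<lambda>(i, j). (i, Suc j)) ` ?S (m - B))"
        by (rule card_Un_le)
      also have "\<dots> \<le> card ?T + card (?S (m - B))"
        using finT fin by (intro add_mono card_image_le)
      finally have "real (card (?S m)) \<le> real (card ?T) + real (card (?S (m - B)))"
        unfolding of_nat_add[symmetric] by (rule of_nat_mono)
      then have le: "real (card (?S m)) \<le> real m / A + 1 + real (card (?S (m - B)))"
        using cT by linarith
      show ?thesis
      proof (cases "m \<le> B")
        case True
        then have "card (?S (m - B)) = 0" by simp
        then have "real (card (?S m)) \<le> (real m + A) / A" using le AB by (simp add: field_simps)
        also have "\<dots> = (4 * (real m + A) * B) / (4 * A * B)" using AB by (simp add: field_simps)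
        also have "\<dots> \<le> (real m + A + B)\<^sup>2 / (2 * A * B)"
        proof -
          have "4 * (real m + A) * B \<le> (real m + A + B)\<^sup>2"
            using zero_le_power2[of "real m + A - B"] by (simp add: power2_eq_square algebra_simps)
          then have "(4 * (real m + A) * B) / (4 * A * B) \<le> (real m + A + B)\<^sup>2 / (4 * A * B)"
            using AB by (intro divide_right_mono) auto
          also have "\<dots> \<le> (real m + A + B)\<^sup>2 / (2 * A * B)"
            using AB by (intro divide_left_mono) auto
          finally show ?thesis .
        qed
        finally show ?thesis .
      next
        case False
        have "real (card (?S (m - B))) \<le> (real (m - B) + A + B)\<^sup>2 / (2 * A * B)"
          using less[of "m - B"] \<open>m \<noteq> 0\<close> assms by simp
        also have "real (m - B) + A + B = real m + A" using False by (simp add: of_nat_diff)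
        finally have IH: "real (card (?S (m - B))) \<le> (real m + A)\<^sup>2 / (2 * A * B)" .
        have "real m / A + 1 + (real m + A)\<^sup>2 / (2 * A * B) =
            (2 * (real m + A) * B + (real m + A)\<^sup>2) / (2 * A * B)"
          using AB by (simp add: field_simps)
        also have "\<dots> \<le> (real m + A + B)\<^sup>2 / (2 * A * B)"
          using AB by (intro divide_right_mono) (auto simp: power2_eq_square algebra_simps)
        finally show ?thesis using le IH by linarith
      qed
    qed simp
  qed
qed

section \<open>An upper bound for the volume\<close>

text \<open>\<open>c\<close> is the power series of \<open>a / b\<close> at 0 cut off at order
  \<open>r\<close>; the constant \<open>k\<close> in the induction is its next coefficient.\<close>

lemma truncated_quotient:
  fixes a b :: "'k::field poly"
  assumes "poly b 0 \<noteq> 0"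
  shows "\<exists>c e. (\<forall>l\<ge>r. Polynomial.coeff c l = 0) \<and> a = c * b + [:0, 1:] ^ r * e"
proof (induction r)
  case 0 show ?case by (intro exI[of _ 0] exI[of _ a]) simp
next
  case (Suc r)
  then obtain c e where ce: "\<forall>l\<ge>r. Polynomial.coeff c l = 0" "a = c * b + [:0, 1:] ^ r * e" by blast
  define k where "k = poly e 0 / poly b 0"
  have "poly (e - [:k:] * b) 0 = 0" using assms by (simp add: k_def)
  then have "[:- 0, 1:] dvd e - [:k:] * b" by (simp only: poly_eq_0_iff_dvd)
  then obtain e' where e': "e - [:k:] * b = [:0, 1:] * e'" by (metis dvdE minus_zero)
  have "Polynomial.coeff (c + [:k:] * [:0, 1:] ^ r) l = 0" if "l \<ge> Suc r" for l
    using that ce(1) by (simp add: coeff_monom monom_altdef[symmetric])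
  moreover have "e = [:k:] * b + [:0, 1:] * e'" using e' by (metis diff_eq_eq add.commute)
  then have "a = (c + [:k:] * [:0, 1:] ^ r) * b + [:0, 1:] ^ Suc r * e'"
    unfolding ce(2) by (simp only: power_Suc algebra_simps)
  ultimately show ?case by blast
qed

lemma rhom_inner: "rhom (hev const y)"
  by (intro rhom_hev rhom_const)

lemma hev_X: "hev const y [:0, 1:] = y"
  by (simp add: hev_pCons rhom_const hev_1)

lemma ev_split: "\<exists>g'. ev u v g = hev const v (poly g 0) + u * ev u v g'"
proof (cases g)
  case (pCons a q)
  have "ev u v g = hev const v (poly g 0) + u * ev u v q"
    unfolding pCons ev_pCons[of u v a q] ev_inner by simp
  then show ?thesis by blast
qed

text \<open>Modulo \<open>u\<close> the ring becomes the localization of \<open>k[v]\<close> at 0,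
  where \<open>f\<close> is \<open>v ^ r\<close> times a unit; there a fraction agrees with its
  truncated power series up to a multiple of \<open>f\<close>.\<close>

lemma span_mod_two:
  assumes uv: "indep u v" and g0: "poly g 0 = [:0, 1:] ^ r * q" "poly q 0 \<noteq> 0" and h: "h \<in> pt u v"
  shows "\<exists>e\<in>ratfun.span {v ^ l | l. l < r}. \<exists>h1\<in>pt u v. \<exists>h2\<in>pt u v. h = e + ev u v g * h1 + u * h2"
proof -
  let ?R = "pt u v" and ?f = "ev u v g"
  note sub = local_subalgD[OF local_subalg_pt[OF uv]]
  note hom = rhom_simps[OF rhom_inner, of v]
  obtain a b where ab: "h = ev u v a / ev u v b" "poly (poly b 0) 0 \<noteq> 0"
    using h by (auto simp: pt_def loc_ev_def)
  obtain c e where ce: "\<forall>l\<ge>r. Polynomial.coeff c l = 0" "poly a 0 = c * poly b 0 + [:0, 1:] ^ r * e"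
    using truncated_quotient[OF ab(2)] by blast
  obtain a' b' g' where s: "ev u v a = hev const v (poly a 0) + u * ev u v a'"
    "ev u v b = hev const v (poly b 0) + u * ev u v b'"
    "?f = hev const v (poly g 0) + u * ev u v g'"
    using ev_split by metis
  have inner: "hev const v z \<in> ?R" for z
    using ev_in_pt[OF uv, of "[:z:]"] by (simp add: ev_inner)
  have "unit_in ?R (ev u v [:q:])" using unit_in_pt[OF uv, of "[:q:]"] g0(2) by simp
  then have q: "unit_in ?R (hev const v q)" by (simp add: ev_inner)
  have b: "unit_in ?R (ev u v b)" using unit_in_pt[OF uv] ab(2) by simp
  then have bnz: "ev u v b \<noteq> 0" and binv: "inverse (ev u v b) \<in> ?R" by (auto simp: unit_in_def)
  have qnz: "hev const v q \<noteq> 0" and qinv: "inverse (hev const v q) \<in> ?R"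
    using q by (auto simp: unit_in_def)
  define E where "E = hev const v e"
  define C where "C = hev const v c"
  define Q where "Q = hev const v q"
  \<comment> \<open>Both cofactors result from inserting \<open>v ^ r = (f - u g') / Q\<close> into
    \<open>a = C b + v ^ r E + u (a' - C b')\<close> and dividing by \<open>b\<close>.\<close>
  define h1 where "h1 = E * inverse Q * inverse (ev u v b)"
  define h2 where "h2 = (ev u v a' - C * ev u v b' - ev u v g' * (E * inverse Q)) * inverse (ev u v b)"
  have in_R: "h1 \<in> ?R" "h2 \<in> ?R"
    unfolding h1_def h2_def E_def C_def Q_def
    by (intro subalgD(5,7)[OF sub] inner qinv binv ev_in_pt uv)+
  have f: "?f = v ^ r * Q + u * ev u v g'"
    unfolding s(3) g0(1) hom hev_X Q_def by simp
  have va: "hev const v (poly a 0) = C * hev const v (poly b 0) + v ^ r * E"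
    unfolding ce(2) hom hev_X C_def E_def by simp
  have "ev u v a = C * ev u v b + (v ^ r * E + u * (ev u v a' - C * ev u v b'))"
    unfolding s(1) va unfolding s(2) by (simp add: algebra_simps)
  also have "v ^ r * E = (?f - u * ev u v g') * (E * inverse Q)"
    using qnz by (simp add: f Q_def)
  finally have "ev u v a = C * ev u v b + (?f * (E * inverse Q)
      + u * (ev u v a' - C * ev u v b' - ev u v g' * (E * inverse Q)))"
    by (simp add: algebra_simps)
  then have "h = C + ?f * h1 + u * h2"
    using bnz unfolding ab(1) h1_def h2_def by (simp add: field_simps)
  moreover have "C \<in> ratfun.span {v ^ l | l. l < r}"
    unfolding C_def
  proof (rule hev_closure[OF rhom_const])
    fix i
    show "const (Polynomial.coeff c i) * v ^ i \<in> ratfun.span {v ^ l | l. l < r}"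
    proof (cases "i < r")
      case True
      then show ?thesis by (intro ratfun.span_scale ratfun.span_base) auto
    next
      case False
      then show ?thesis using ce(1) by (simp add: ratfun.span_zero)
    qed
  qed (auto intro: ratfun.span_zero ratfun.span_add)
  ultimately show ?thesis using in_R by blast
qed

section \<open>From quadratic growth of lengths to the volume\<close>

lemma limsup_quadratic_le:
  fixes len :: "nat \<Rightarrow> enat"
  assumes "\<And>m. len m \<le> enat (K m)" "\<And>m. real (K m) \<le> U * (real m + c)\<^sup>2 / 2"
  shows "limsup (\<lambda>m. 2 * ereal_of_enat (len m) / ereal (real m ^ 2)) \<le> ereal U"
proof -
  let ?X = "\<lambda>m. 2 * ereal_of_enat (len m) / ereal (real m ^ 2)"
  let ?Y = "\<lambda>m. ereal (U * (1 + c / real m)\<^sup>2)"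
  have "\<forall>\<^sub>F m in sequentially. ?X m \<le> ?Y m"
  proof (rule eventually_sequentiallyI[of 1])
    fix m :: nat assume m: "1 \<le> m"
    obtain l where l: "len m = enat l" "l \<le> K m"
      using assms(1)[of m] by (cases "len m") auto
    have "2 * real l \<le> U * (real m + c)\<^sup>2"
      using l(2) assms(2)[of m] by (smt (verit) of_nat_mono field_sum_of_halves)
    then have "2 * real l / real m ^ 2 \<le> U * (real m + c)\<^sup>2 / real m ^ 2"
      by (intro divide_right_mono) auto
    also have "\<dots> = U * (1 + c / real m)\<^sup>2"
      using m by (simp add: power2_eq_square field_simps)
    finally have "ereal (2 * real l / real m ^ 2) \<le> ?Y m" by simp
    moreover have "?X m = ereal (2 * real l / real m ^ 2)"
      using m by (simp add: l(1))
    ultimately show "?X m \<le> ?Y m" by simp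
  qed
  then have "limsup ?X \<le> limsup ?Y" by (rule Limsup_mono)
  also have "limsup ?Y = ereal (U * (1 + 0)\<^sup>2)"
    by (intro lim_imp_Limsup tendsto_ereal tendsto_intros lim_const_over_n) simp
  finally show ?thesis by simp
qed

text \<open>A subsequence suffices for a lower bound on the limit superior. The constant 9 comes
  from \<open>2 * N * e + 1 \<le> 3 * (N * e)\<close>.\<close>

lemma limsup_quadratic_ge:
  fixes len :: "nat \<Rightarrow> enat"
  assumes e: "1 \<le> e" and len: "\<And>N. enat (N * N) \<le> len (2 * N * e + 1)"
  shows "ereal (2 / (9 * real e ^ 2)) \<le> limsup (\<lambda>m. 2 * ereal_of_enat (len m) / ereal (real m ^ 2))"
  unfolding limsup_INF_SUP
proof (rule INF_greatest)
  fix n :: nat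
  let ?X = "\<lambda>m. 2 * ereal_of_enat (len m) / ereal (real m ^ 2)"
  define N where "N = Suc n"
  define m where "m = 2 * N * e + 1"
  have "N * 1 \<le> N * e" using e by (intro mult_le_mono) auto
  moreover have "m = 2 * (N * e) + 1" by (simp add: m_def)
  moreover have "n < N" by (simp add: N_def)
  ultimately have mn: "n \<le> m" "m \<le> 3 * (N * e)" "0 < m" by linarith+
  have Ne: "real N > 0" "real e > 0" using e by (auto simp: N_def)
  have "2 / (9 * real e ^ 2) = 2 * real (N * N) / (3 * (real N * real e)) ^ 2"
    using Ne by (simp add: power2_eq_square field_simps)
  also have "\<dots> \<le> 2 * real (N * N) / real m ^ 2"
  proof (rule divide_left_mono)
    have "real m \<le> 3 * (real N * real e)"
      using mn(2) by (metis of_nat_le_iff of_nat_mult of_nat_numeral)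
    then show "real m ^ 2 \<le> (3 * (real N * real e)) ^ 2" by (intro power_mono) auto
  qed (use Ne mn in auto)
  finally have "ereal (2 / (9 * real e ^ 2)) \<le> ereal (2 * real (N * N) / real m ^ 2)" by simp
  also have "\<dots> = 2 * ereal_of_enat (enat (N * N)) / ereal (real m ^ 2)"
    using mn by simp
  also have "\<dots> \<le> ?X m"
  proof (intro ereal_divide_right_mono ereal_mult_left_mono)
    show "ereal_of_enat (enat (N * N)) \<le> ereal_of_enat (len m)"
      using len[of N] unfolding m_def ereal_of_enat_le_iff .
    show "0 < ereal (real m ^ 2)" using mn by simp
  qed simp
  also have "\<dots> \<le> Sup (?X ` {n..})"
    using mn by (intro SUP_upper) auto
  finally show "ereal (2 / (9 * real e ^ 2)) \<le> Sup (?X ` {n..})" .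
qed

context divisorial
begin

lemma one_le_n': "1 \<le> (1::nat)" "1 \<le> n"
  using n_ge_1 by auto

lemma subalg_center: "subalg (p 1)"
  using points[OF one_le_n'] local_subalgD[OF local_subalg_pt] by metis

lemma vge_center: "z \<in> p 1 \<Longrightarrow> vge 0 z"
  using val_nonneg[OF one_le_n'] by (auto simp: vge_def)

lemma vge_max_center: "z \<in> max_ideal (p 1) \<Longrightarrow> vge 1 z"
  using val_pos[OF one_le_n', of z] by (fastforce simp: vge_def)

lemma valuation_ideal_center: "valuation_ideal \<nu> (p 1) m = {h \<in> p 1. vge (int m) h}"
  by (rule valuation_ideal_eq[OF valuation subalgD(2)[OF subalg_center]])

lemma ideal_valuation_ideal: "ideal (valuation_ideal \<nu> (p 1) m) (ring_on (p 1))"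
  unfolding ideal_ring_on_iff[OF subalg_center] valuation_ideal_center
  using subalgD[OF subalg_center] vge_add vge_mult[OF vge_center] by auto

lemma length_upper_bound:
  fixes A B :: nat
  assumes uv: "indep u v" "p 1 = pt u v" and g0: "poly g 0 \<noteq> 0"
    and A: "\<nu> (ev u v g) = int A" "1 \<le> A" and B: "\<nu> u = int B" "1 \<le> B"
  shows "ring_length (ring_on (p 1) Quot valuation_ideal \<nu> (p 1) m)
    \<le> enat (degree (poly g 0) * card {(i, j). i * A + j * B < m})"
proof (rule ring_length_quot_le[OF cring_ring_on[OF subalg_center] ideal_valuation_ideal])
  let ?I = "valuation_ideal \<nu> (p 1) m" and ?f = "ev u v g"
  \<comment> \<open>The local intersection multiplicity at \<open>p\<close> of the curve with the
    line \<open>u = 0\<close>.\<close>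
  define r where "r = order 0 (poly g 0)"
  obtain q where q: "poly g 0 = [:0, 1:] ^ r * q" "poly q 0 \<noteq> 0"
    using order_decomp[OF g0, of 0] by (auto simp: r_def poly_eq_0_iff_dvd)
  have rd: "r \<le> degree (poly g 0)" unfolding r_def by (rule order_degree[OF g0])
  define S where "S = {(i, j). i * A + j * B < m}"
  have S: "finite S" using count_lattice_points(1)[OF A(2) B(2)] by (simp add: S_def)
  define E where "E = (\<lambda>(l, i, j). v ^ l * (?f ^ i * u ^ j)) ` ({..<r} \<times> S)"
  have finE: "finite E" using S by (simp add: E_def)
  have "card E \<le> card ({..<r} \<times> S)" unfolding E_def using S by (intro card_image_le) auto
  then have cE: "card E \<le> r * card S" by (simp add: card_cartesian_product)
  note sub = subalg_center
  have fR: "?f \<in> p 1" "u \<in> p 1" "v \<in> p 1"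
    using ev_in_pt[OF uv(1)] ev_in_pt[OF uv(1), of pX] ev_in_pt[OF uv(1), of pY] by (simp_all flip: uv(2))
  have nz: "?f \<noteq> 0" "u \<noteq> 0"
    using g0 indep_ev_eq_0_iff[OF uv(1), of g] indep_nonzero[OF uv(1)] by auto
  have val: "\<nu> (?f ^ i * u ^ j) = int (i * A + j * B)" for i j
    using nz A B by (simp add: val_mult val_power)
  \<comment> \<open>Induction on the distance of \<open>f ^ i * u ^ j\<close> from level
    \<open>m\<close>. At distance 0 the product lies in the valuation ideal; otherwise
    \<open>span_mod_two\<close> splits \<open>h\<close>, and since \<open>A\<close> and
    \<open>B\<close> are positive, the extra factor \<open>f\<close> or \<open>u\<close> lowers the
    distance.\<close>
  have gen: "h \<in> p 1 \<Longrightarrow> \<exists>e\<in>ratfun.span E. ?f ^ i * u ^ j * h - e \<in> ?I" for h i j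
  proof (induction "m - (i * A + j * B)" arbitrary: h i j rule: less_induct)
    case less
    show ?case
    proof (cases "i * A + j * B < m")
      case False
      then have "vge (int m) (?f ^ i * u ^ j)"
        unfolding vge_def val of_nat_le_iff by linarith
      then have "vge (int m) (?f ^ i * u ^ j * h)"
        using vge_mult[OF _ vge_center[OF less(2)], of "int m"] by simp
      moreover have "?f ^ i * u ^ j * h \<in> p 1"
        by (intro subalgD(5,8)[OF sub] fR less)
      ultimately show ?thesis
        unfolding valuation_ideal_center by (intro bexI[of _ 0] ratfun.span_zero) simp
    next
      case True
      obtain e h1 h2 where *: "e \<in> ratfun.span {v ^ l | l. l < r}" "h1 \<in> p 1" "h2 \<in> p 1"
        "h = e + ?f * h1 + u * h2"
        using span_mod_two[OF uv(1) q, of h] less(2) unfolding uv(2) by blast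
      have 1: "\<exists>e\<in>ratfun.span E. ?f ^ Suc i * u ^ j * h1 - e \<in> ?I"
        using True A(2) *(2) by (intro less) auto
      have 2: "\<exists>e\<in>ratfun.span E. ?f ^ i * u ^ Suc j * h2 - e \<in> ?I"
        using True B(2) *(3) by (intro less) auto
      obtain e1 e2 where e12: "e1 \<in> ratfun.span E" "?f ^ Suc i * u ^ j * h1 - e1 \<in> ?I"
        "e2 \<in> ratfun.span E" "?f ^ i * u ^ Suc j * h2 - e2 \<in> ?I"
        using 1 2 by blast
      have "?f ^ i * u ^ j * e \<in> ratfun.span E"
        using *(1)
      proof (induction rule: ratfun.span_induct_alt)
        case base then show ?case by (simp add: ratfun.span_zero)
      next
        case (step c x y)
        then obtain l where l: "l < r" "x = v ^ l" by blast
        have "v ^ l * (?f ^ i * u ^ j) \<in> E"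
          unfolding E_def using l True by (intro image_eqI[of _ _ "(l, i, j)"]) (auto simp: S_def)
        then have "const c * (v ^ l * (?f ^ i * u ^ j)) + ?f ^ i * u ^ j * y \<in> ratfun.span E"
          using step by (intro ratfun.span_add ratfun.span_scale) (auto intro: ratfun.span_base)
        then show ?case by (simp add: l algebra_simps)
      qed
      then have "?f ^ i * u ^ j * e + e1 + e2 \<in> ratfun.span E"
        by (intro ratfun.span_add e12)
      moreover have "(?f ^ Suc i * u ^ j * h1 - e1) + (?f ^ i * u ^ Suc j * h2 - e2) \<in> ?I"
        using e12 ideal_valuation_ideal unfolding ideal_ring_on_iff[OF sub] by blast
      moreover have "(?f ^ Suc i * u ^ j * h1 - e1) + (?f ^ i * u ^ Suc j * h2 - e2) =
          ?f ^ i * u ^ j * h - (?f ^ i * u ^ j * e + e1 + e2)"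
        unfolding *(4) by (simp add: algebra_simps)
      ultimately show ?thesis by metis
    qed
  qed
  fix k and W :: "nat \<Rightarrow> 'k ratfun set"
  assume W: "\<And>i. i \<le> k \<Longrightarrow> ideal (W i) (ring_on (p 1)) \<and> ?I \<subseteq> W i" "\<And>i. i < k \<Longrightarrow> W i \<subset> W (Suc i)"
  have "k \<le> card E"
  proof (rule subspace_chain_bound[where W = W and I = ?I])
    show "ratfun.subspace (W i)" if "i \<le> k" for i
      using subspace_ideal[OF sub] W(1)[OF that] by blast
    show "\<exists>e\<in>ratfun.span E. z - e \<in> ?I" if "z \<in> W k" for z
    proof -
      have "W k \<subseteq> p 1" using W(1)[of k] unfolding ideal_ring_on_iff[OF sub] by blast
      then show ?thesis using gen[of z 0 0] that by auto
    qed
  qed (use W finE in auto)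
  also have "\<dots> \<le> degree (poly g 0) * card S"
    using cE rd mult_le_mono1[OF rd, of "card S"] by linarith
  finally show "k \<le> degree (poly g 0) * card {(i, j). i * A + j * B < m}" by (simp add: S_def)
qed

section \<open>Positivity of the volume\<close>

text \<open>If the residue of \<open>g\<^sub>1 / g\<^sub>2\<close> is transcendental, then all nontrivial linear combinations of the
  \<open>g\<^sub>1\<^sup>i g\<^sub>2\<^sup>M\<^sup>-\<^sup>i\<close> have the same value; they refine the filtration by valuation ideals.\<close>

lemma length_lower_bound:
  obtains e :: nat where "1 \<le> e" "\<And>N. enat (N * N) \<le>
    ring_length (ring_on (p 1) Quot valuation_ideal \<nu> (p 1) (2 * N * e + 1))"
proof -
  note sub = subalg_center
  obtain u v where uv: "indep u v" "full u v" "p 1 = pt u v" using points[OF one_le_n'] by blast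
  note loc = local_subalg_pt[OF uv(1), folded uv(3)]
  note umax = gen_in_max_pt(1)[OF uv(1), folded uv(3)]
  have u0: "u \<noteq> 0" by (rule indep_nonzero(1)[OF uv(1)])
  obtain w where w: "\<And>q. q \<noteq> 0 \<Longrightarrow> hev const w q \<noteq> 0" "\<And>q. q \<noteq> 0 \<Longrightarrow> \<nu> (hev const w q) = 0"
    using residue by blast
  note hom = rhom_simps[OF rhom_inner, of w]
  have w0: "w \<noteq> 0" using w(1)[of "[:0, 1:]"] by (simp add: hev_X)
  have "w \<in> quotients (range (ev u v))" using uv(2) by (simp add: full_def)
  then obtain a b where ab: "w = ev u v a / ev u v b" by (auto simp: quotients_def)
  \<comment> \<open>The common factor \<open>u\<close> leaves the quotient \<open>w\<close>
    unchanged but puts the denominator into the maximal ideal, so that its value \<open>e\<close> is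
    positive.\<close>
  define g1 where "g1 = ev u v a * u"
  define g2 where "g2 = ev u v b * u"
  have evR: "ev u v z \<in> p 1" for z using ev_in_pt[OF uv(1)] by (simp flip: uv(3))
  have gmax: "g2 \<in> max_ideal (p 1)"
    unfolding g2_def by (intro max_ideal_closed[OF loc] umax evR)
  have uR: "u \<in> p 1" using umax by (simp add: max_ideal_def)
  have gR: "g1 \<in> p 1" "g2 \<in> p 1" unfolding g1_def g2_def by (intro subalgD(5)[OF sub] evR uR)+
  have g2nz: "g2 \<noteq> 0" using w0 ab u0 by (auto simp: g2_def)
  have g1: "g1 = w * g2" using w0 ab by (auto simp: g1_def g2_def)
  define e where "e = nat (\<nu> g2)"
  have e: "\<nu> g2 = int e" "1 \<le> e"
    using val_pos[OF one_le_n' gmax g2nz] by (auto simp: e_def)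
  have val: "\<nu> (g2 ^ M * hev const w q) = int (M * e)" if "q \<noteq> 0" for M q
    using w[OF that] g2nz e by (simp add: val_mult val_power)
  have vge: "vge (int (M * e)) (g2 ^ M * hev const w q)" for M q
    using val[of q M] by (cases "q = 0") (auto simp: vge_def)
  \<comment> \<open>Elements that agree, up to value greater than \<open>M * e\<close>, with
    \<open>g2 ^ M\<close> times a polynomial in \<open>w\<close> of degree less than
    \<open>i\<close>. For \<open>i = 0\<close> this is the valuation ideal of level
    \<open>M * e + 1\<close>.\<close>
  define W where "W M i = {z \<in> p 1. \<exists>q. (\<forall>l\<ge>i. Polynomial.coeff q l = 0) \<and>
      vge (int (M * e) + 1) (z - g2 ^ M * hev const w q)}" for M i :: nat
  have W_ideal: "ideal (W M i) (ring_on (p 1))" for M i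
    unfolding ideal_ring_on_iff[OF sub]
  proof (intro conjI ballI)
    show "0 \<in> W M i" using subalgD(2)[OF sub] by (auto simp: W_def intro!: exI[of _ 0])
    show "y + z \<in> W M i" if yz: "y \<in> W M i" "z \<in> W M i" for y z
    proof -
      obtain q1 q2 where q: "\<forall>l\<ge>i. Polynomial.coeff q1 l = 0" "\<forall>l\<ge>i. Polynomial.coeff q2 l = 0"
        "vge (int (M * e) + 1) (y - g2 ^ M * hev const w q1)"
        "vge (int (M * e) + 1) (z - g2 ^ M * hev const w q2)"
        using yz by (auto simp: W_def)
      have "y + z - g2 ^ M * hev const w (q1 + q2) =
          (y - g2 ^ M * hev const w q1) + (z - g2 ^ M * hev const w q2)"
        by (simp add: hom algebra_simps)
      then have "vge (int (M * e) + 1) (y + z - g2 ^ M * hev const w (q1 + q2))"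
        using vge_add[OF q(3,4)] by (simp only:)
      moreover have "\<forall>l\<ge>i. Polynomial.coeff (q1 + q2) l = 0" using q by simp
      moreover have "y + z \<in> p 1" using yz subalgD(4)[OF sub] by (auto simp: W_def)
      ultimately show ?thesis unfolding W_def by blast
    qed
    show "y * z \<in> W M i" if y: "y \<in> p 1" and z: "z \<in> W M i" for y z
    proof -
      obtain q where q: "\<forall>l\<ge>i. Polynomial.coeff q l = 0"
        "vge (int (M * e) + 1) (z - g2 ^ M * hev const w q)"
        using z by (auto simp: W_def)
      \<comment> \<open>Modulo higher value, \<open>y\<close> acts on these leading terms as the
        constant \<open>c\<close>: the difference \<open>y - const c\<close> lies in the maximal
        ideal and has value at least 1.\<close>
      obtain c a b where cab: "a \<in> p 1" "b \<in> p 1" "y = const c + u * a + v * b"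
        using pt_decomp[OF uv(1), of y] y by (metis uv(3))
      have "a * u + b * v \<in> max_ideal (p 1)"
        by (intro max_ideal_closed[OF loc] cab gen_in_max_pt[OF uv(1), folded uv(3)])
      then have 1: "vge 1 (a * u + b * v)" by (rule vge_max_center)
      have "vge (int (M * e) + 1) ((a * u + b * v) * (g2 ^ M * hev const w q))"
        using vge_mult[OF 1 vge[of M q]] by (simp add: add.commute)
      moreover have "vge (int (M * e) + 1) (y * (z - g2 ^ M * hev const w q))"
        using vge_mult[OF vge_center[OF y] q(2)] by simp
      ultimately have "vge (int (M * e) + 1) (y * (z - g2 ^ M * hev const w q)
          + (a * u + b * v) * (g2 ^ M * hev const w q))" using vge_add by blast
      moreover have "y * (z - g2 ^ M * hev const w q) + (a * u + b * v) * (g2 ^ M * hev const w q)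
          = y * z - g2 ^ M * hev const w (Polynomial.smult c q)"
        by (simp add: cab(3) hev_smult[OF rhom_const] algebra_simps)
      ultimately have "vge (int (M * e) + 1) (y * z - g2 ^ M * hev const w (Polynomial.smult c q))"
        by (simp only:)
      moreover have "\<forall>l\<ge>i. Polynomial.coeff (Polynomial.smult c q) l = 0" using q by simp
      moreover have "y * z \<in> p 1" using y z subalgD(5)[OF sub] by (auto simp: W_def)
      ultimately show ?thesis unfolding W_def by blast
    qed
  qed (auto simp: W_def)
  have W_mono: "W M i \<subseteq> W M (Suc i)" for M i
    unfolding W_def by (blast intro: Suc_leD)
  have W_next: "W (Suc M) i \<subseteq> W M 0" for M i
  proof
    fix z assume "z \<in> W (Suc M) i"
    then obtain q where q: "z \<in> p 1" "vge (int (Suc M * e) + 1) (z - g2 ^ Suc M * hev const w q)"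
      unfolding W_def by blast
    have le: "int (M * e) + 1 \<le> int (Suc M * e)" using e(2) by simp
    have "vge (int (Suc M * e)) (z - g2 ^ Suc M * hev const w q)"
      by (rule vge_mono[OF q(2)]) simp
    then have "vge (int (Suc M * e)) ((z - g2 ^ Suc M * hev const w q) + g2 ^ Suc M * hev const w q)"
      by (intro vge_add vge)
    then have "vge (int (M * e) + 1) z" using le vge_mono by simp
    then show "z \<in> W M 0" using q(1) by (auto simp: W_def intro!: exI[of _ 0])
  qed
  have new: "\<exists>z. z \<in> W M (Suc i) \<and> z \<notin> W M i" if i: "i \<le> M" for M i
  proof -
    \<comment> \<open>In terms of \<open>w\<close> this is \<open>w ^ i * g2 ^ M\<close>; the bound
      \<open>i \<le> M\<close> keeps it inside the ring. By transcendence of the residue of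
      \<open>w\<close>, no polynomial of smaller degree has the same leading term.\<close>
    define z where "z = g1 ^ i * g2 ^ (M - i)"
    have z: "z = g2 ^ M * hev const w (Polynomial.monom 1 i)"
    proof -
      have "hev const w (Polynomial.monom 1 i) = w ^ i"
        by (simp add: hev_def map_poly_monom poly_monom)
      moreover have "g2 ^ M = g2 ^ i * g2 ^ (M - i)" using i by (simp flip: power_add)
      ultimately show ?thesis by (simp add: z_def g1 power_mult_distrib)
    qed
    have zR: "z \<in> p 1" unfolding z_def by (intro subalgD(5,8)[OF sub] gR)
    have "z \<in> W M (Suc i)"
      using zR by (auto simp: W_def z intro!: exI[of _ "Polynomial.monom 1 i"])
    moreover have "z \<notin> W M i"
    proof
      assume "z \<in> W M i"
      then obtain q where q: "\<forall>l\<ge>i. Polynomial.coeff q l = 0"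
        "vge (int (M * e) + 1) (z - g2 ^ M * hev const w q)"
        unfolding W_def by blast
      define q' where "q' = Polynomial.monom 1 i - q"
      have "Polynomial.coeff q' i \<noteq> 0" using q(1) by (simp add: q'_def)
      then have q': "q' \<noteq> 0" by auto
      have "z - g2 ^ M * hev const w q = g2 ^ M * hev const w q'"
        by (simp add: z q'_def hom algebra_simps)
      moreover have "g2 ^ M * hev const w q' \<noteq> 0" using w(1)[OF q'] g2nz by simp
      ultimately show False using q(2) val[OF q', of M] by (auto simp: vge_def)
    qed
    ultimately show ?thesis by blast
  qed
  have "enat (N * N) \<le> ring_length (ring_on (p 1) Quot valuation_ideal \<nu> (p 1) (2 * N * e + 1))" for N
  proof (rule ring_length_quot_ge[OF cring_ring_on[OF sub] ideal_valuation_ideal])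
    \<comment> \<open>The chain has \<open>N\<close> blocks of \<open>N\<close> steps, and the level
      descends from \<open>2 * N\<close> to \<open>N\<close>. Every block in use has level above
      \<open>N\<close>, which provides the condition \<open>i \<le> M\<close> of
      \<open>new\<close>.\<close>
    let ?W = "\<lambda>k. W (2 * N - k div N) (k mod N)"
    fix k
    show "ideal (?W k) (ring_on (p 1)) \<and> valuation_ideal \<nu> (p 1) (2 * N * e + 1) \<subseteq> ?W k"
    proof
      show "valuation_ideal \<nu> (p 1) (2 * N * e + 1) \<subseteq> ?W k"
      proof
        fix z assume z: "z \<in> valuation_ideal \<nu> (p 1) (2 * N * e + 1)"
        have "(2 * N - k div N) * e \<le> 2 * N * e" by (intro mult_le_mono) auto
        then have "int ((2 * N - k div N) * e) + 1 \<le> int (2 * N * e + 1)" by linarith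
        then have "vge (int ((2 * N - k div N) * e) + 1) z"
          using z vge_mono unfolding valuation_ideal_center by blast
        moreover have "z \<in> p 1" using z unfolding valuation_ideal_center by blast
        ultimately show "z \<in> ?W k" by (auto simp: W_def intro!: exI[of _ 0])
      qed
    qed (rule W_ideal)
  next
    let ?W = "\<lambda>k. W (2 * N - k div N) (k mod N)"
    fix k assume k: "k < N * N"
    then have N: "N > 0" by (cases N) auto
    have kN: "k div N < N" using k by (simp add: less_mult_imp_div_less)
    define M where "M = 2 * N - k div N"
    define i where "i = k mod N"
    have "i < N" using N by (simp add: i_def)
    then have "i \<le> M" using kN by (simp add: M_def)
    then obtain z where z: "z \<in> W M (Suc i)" "z \<notin> W M i" using new by blast
    have "W M (Suc i) \<subseteq> ?W (Suc k)"
    proof (cases "Suc i = N")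
      case False
      then have "Suc k mod N = Suc i" "Suc k div N = k div N"
        by (simp_all add: mod_Suc div_Suc i_def)
      then show ?thesis by (simp add: M_def)
    next
      case True
      then have "Suc k mod N = 0" "Suc k div N = Suc (k div N)"
        by (simp_all add: mod_Suc div_Suc i_def)
      moreover have "M = Suc (2 * N - Suc (k div N))" using kN by (simp add: M_def)
      ultimately show ?thesis using W_next by simp
    qed
    then show "?W k \<subset> ?W (Suc k)"
      using z W_mono[of M i] unfolding M_def i_def by blast
  qed
  then show ?thesis using that e(2) by blast
qed

lemma volume_bounds:
  assumes uv: "indep u v" "p 1 = pt u v" and g0: "poly g 0 \<noteq> 0"
    and pos: "0 < \<nu> (ev u v g)" "0 < \<nu> u"
  shows "0 < volume \<nu> (p 1)"
    "volume \<nu> (p 1) * (\<nu> (ev u v g) * \<nu> u) \<le> degree (poly g 0)"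
proof -
  define A where "A = nat (\<nu> (ev u v g))"
  define B where "B = nat (\<nu> u)"
  have A: "\<nu> (ev u v g) = int A" "1 \<le> A" and B: "\<nu> u = int B" "1 \<le> B"
    using pos by (auto simp: A_def B_def)
  define D where "D = degree (poly g 0)"
  let ?len = "\<lambda>m. ring_length (ring_on (p 1) Quot valuation_ideal \<nu> (p 1) m)"
  let ?L = "limsup (\<lambda>m. 2 * ereal_of_enat (?len m) / ereal (real m ^ 2))"
  define U where "U = real D / (A * B)"
  have "?L \<le> ereal U"
  proof (rule limsup_quadratic_le)
    show "?len m \<le> enat (D * card {(i, j). i * A + j * B < m})" for m
      unfolding D_def by (rule length_upper_bound[OF uv g0 A B])
    fix m
    have "real (D * card {(i, j). i * A + j * B < m}) \<le> real D * ((real m + A + B)\<^sup>2 / (2 * A * B))"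
      using count_lattice_points(2)[OF A(2) B(2), of m]
      unfolding of_nat_mult by (intro mult_left_mono) simp_all
    then show "real (D * card {(i, j). i * A + j * B < m}) \<le> U * (real m + (real A + real B))\<^sup>2 / 2"
      by (simp add: U_def add.assoc mult_ac)
  qed
  moreover obtain e where e: "1 \<le> e" "\<And>N. enat (N * N) \<le> ?len (2 * N * e + 1)"
    using length_lower_bound by blast
  moreover note limsup_quadratic_ge[of e ?len, OF e]
  \<comment> \<open>The two bounds make the limit superior finite, so \<open>real_of_ereal\<close>
    in \<open>volume\<close> returns it and not its default value.\<close>
  ultimately obtain l where l: "?L = ereal l" "l \<le> U" "2 / (9 * real e ^ 2) \<le> l"
    by (cases ?L) auto
  have vol: "volume \<nu> (p 1) = l" by (simp only: volume_def l(1) real_of_ereal.simps)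
  have "0 < 2 / (9 * real e ^ 2)" using e(1) by simp
  then show "0 < volume \<nu> (p 1)" using l(3) vol by linarith
  have "l * (real A * real B) \<le> U * (real A * real B)" using l(2) by (intro mult_right_mono) auto
  also have "\<dots> = D" using A B by (simp add: U_def)
  finally show "volume \<nu> (p 1) * (\<nu> (ev u v g) * \<nu> u) \<le> degree (poly g 0)"
    unfolding vol A(1) B(1) D_def[symmetric] by simp
qed

end

section \<open>Bounding the value of a curve\<close>

text \<open>\<open>subst pX (pX * pY)\<close> pulls a polynomial back to a chart of the blowup of the origin, so the
  multiplicity of \<open>g\<close> at the origin is the exponent of \<open>pX\<close> in \<open>subst pX (pX * pY) g\<close>.\<close>

lemma subst_blowup_dvd:
  assumes "poly (poly g 0) 0 = 0"
  shows "pX dvd subst pX (pX * pY) g"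
proof -
  obtain g1 g2 where g: "g = pC (poly (poly g 0) 0) + pX * g1 + pY * g2"
    using bipoly_decomp by blast
  have "g = pX * g1 + pY * g2" using g unfolding assms by (simp only: pC_simps add_0)
  then have "subst pX (pX * pY) g = subst pX (pX * pY) (pX * g1 + pY * g2)" by (rule arg_cong)
  also have "\<dots> = pX * (subst pX (pX * pY) g1 + pY * subst pX (pX * pY) g2)"
    by (simp add: algebra_simps)
  finally show ?thesis by simp
qed

lemma subst_blowup_at_0: "poly (poly (subst pX (pX * pY) h) 0) 0 = poly (poly h 0) 0"
  using poly2_subst[of pX "pX * pY" h 0 0] by simp

text \<open>The substitution sends \<open>pX ^ i * pY ^ j\<close> to
  \<open>pX ^ (i + j) * pY ^ j\<close>, so total degree becomes degree in the outer
  variable.\<close>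

lemma subst_blowup_degree:
  assumes "tdeg_le d g"
  shows "degree (subst pX (pX * pY) g) \<le> d"
proof -
  let ?A = "{z :: 'a poly poly. degree z \<le> d}"
  have deg1: "degree (pX :: 'a poly poly) \<le> 1" "degree (pX * pY :: 'a poly poly) \<le> 1"
    by (auto simp: pX_def pY_def)
  have *: "pC c * (pX * pY) ^ j * pX ^ i \<in> ?A" if "c \<noteq> 0 \<longrightarrow> i + j \<le> d" for c :: 'a and i j
  proof (cases "c = 0")
    case False
    have "degree (pC c * (pX * pY) ^ j * pX ^ i) \<le> degree (pC c * (pX * pY) ^ j) + degree (pX ^ i :: 'a poly poly)"
      by (rule degree_mult_le)
    also have "\<dots> \<le> degree (pC c) + degree ((pX * pY) ^ j :: 'a poly poly) + degree (pX ^ i :: 'a poly poly)"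
      by (intro add_mono degree_mult_le order_refl)
    also have "\<dots> \<le> 0 + 1 * j + 1 * i"
      by (intro add_mono order_trans[OF degree_power_le] mult_le_mono1 deg1) (simp add: pC_def)
    finally show ?thesis using that False by simp
  qed simp
  have A: "0 \<in> ?A" "y \<in> ?A \<Longrightarrow> z \<in> ?A \<Longrightarrow> y + z \<in> ?A" for y z
    using degree_add_le by auto
  have "hev pC (pX * pY) (Polynomial.coeff g i) \<in> {z. z * pX ^ i \<in> ?A}" for i
    using A * assms unfolding tdeg_le_def
    by (intro hev_closure[OF rhom_pC]) (auto simp: distrib_right)
  then have "subst pX (pX * pY) g \<in> ?A"
    unfolding subst_def using A by (intro hev_closure rhom_hev rhom_pC) auto
  then show ?thesis by simp
qed

context divisorial
begin

text \<open>Each factor from the maximal ideal has a numerator without constant term and contributes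
  one \<open>pX\<close> after pulling back to the blowup chart.\<close>

lemma center_power_subset:
  assumes uv: "indep u v" "p 1 = pt u v"
  shows "ideal_pow (ring_on (p 1)) (max_ideal (p 1)) k \<subseteq>
    {ev u v g / ev u v h | g h. pX ^ k dvd subst pX (pX * pY) g \<and> poly (poly h 0) 0 \<noteq> 0}"
    (is "_ \<subseteq> ?M k")
proof (induction k)
  case 0 show ?case unfolding uv(2) by (auto simp: pt_def loc_ev_def)
next
  case (Suc k)
  have "z \<in> ?M (Suc k)" if "z \<in> max_ideal (p 1) \<cdot>\<^bsub>ring_on (p 1)\<^esub> ideal_pow (ring_on (p 1)) (max_ideal (p 1)) k" for z
    using that
  proof (induction rule: ideal_prod.induct)
    case (prod a b)
    have "b \<in> ?M k" using prod(2) Suc by blast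
    then obtain g h where gh: "b = ev u v g / ev u v h" "pX ^ k dvd subst pX (pX * pY) g"
      "poly (poly h 0) 0 \<noteq> 0" by blast
    have sub: "subalg (pt u v)" using local_subalgD[OF local_subalg_pt[OF uv(1)]] .
    have a: "a \<in> pt u v" "\<not> unit_in (pt u v) a"
      using prod(1) unfolding uv(2) max_ideal_eq[OF sub] by auto
    then obtain g' h' where gh': "a = ev u v g' / ev u v h'" "poly (poly h' 0) 0 \<noteq> 0"
      by (auto simp: pt_def loc_ev_def)
    have u: "unit_in (pt u v) (ev u v h')" using gh'(2) unit_in_pt[OF uv(1)] by simp
    have "ev u v g' = ev u v h' * a" using gh'(1) u by (simp add: unit_in_def)
    then have "\<not> unit_in (pt u v) (ev u v g')"
      using a(2) unit_in_mult_iff[OF sub, of "ev u v h'" a] u a(1) by (auto simp: unit_in_def)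
    then have "pX dvd subst pX (pX * pY) g'"
      using unit_in_pt[OF uv(1)] subst_blowup_dvd by blast
    then have "pX ^ Suc k dvd subst pX (pX * pY) (g' * g)"
      using gh(2) by (simp add: mult_dvd_mono)
    moreover have "poly (poly (h' * h) 0) 0 \<noteq> 0" using gh(3) gh'(2) by simp
    moreover have "a \<otimes>\<^bsub>ring_on (p 1)\<^esub> b = ev u v (g' * g) / ev u v (h' * h)" by (simp add: gh gh')
    ultimately show ?case by blast
  next
    case (sum a b)
    then obtain g h g' h' where *: "a = ev u v g / ev u v h" "pX ^ Suc k dvd subst pX (pX * pY) g"
      "poly (poly h 0) 0 \<noteq> 0" "b = ev u v g' / ev u v h'" "pX ^ Suc k dvd subst pX (pX * pY) g'"
      "poly (poly h' 0) 0 \<noteq> 0" by blast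
    have "pX ^ Suc k dvd subst pX (pX * pY) (g * h' + g' * h)"
      using *(2,5) by (simp del: power_Suc)
    moreover have "poly (poly (h * h') 0) 0 \<noteq> 0" using * by simp
    moreover have "ev u v h \<noteq> 0" "ev u v h' \<noteq> 0"
      using *(3,6) indep_ev_eq_0_iff[OF uv(1)] by auto
    then have "a \<oplus>\<^bsub>ring_on (p 1)\<^esub> b = ev u v (g * h' + g' * h) / ev u v (h * h')"
      by (simp add: *(1,4) field_simps)
    ultimately show ?case by blast
  qed
  then show ?case by auto
qed

text \<open>For the adic valuation, \<open>\<nu> f = k\<close> puts \<open>f\<close> into the k-th
  power of the maximal ideal, so \<open>pX ^ k\<close> divides the pullback of \<open>g * h\<close>.
  The denominator \<open>h\<close> is nonzero at the origin and contributes no factor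
  \<open>pX\<close>; all \<open>k\<close> of them divide the pullback of \<open>g\<close>, whose
  degree is at most \<open>d\<close>.\<close>

lemma val_le_adic:
  assumes uv: "indep u v" "p 1 = pt u v" and f: "f \<in> Tpol d u v" "f \<noteq> 0" and adic: "is_adic \<nu> (p 1)"
  shows "\<nu> f \<le> int d"
proof (cases "0 \<le> \<nu> f")
  case True
  obtain g where g: "f = ev u v g" "tdeg_le d g" using f(1) by (auto simp: Tpol_def)
  have fR: "f \<in> p 1" using ev_in_pt[OF uv(1)] by (simp add: g flip: uv(2))
  define k where "k = nat (\<nu> f)"
  let ?\<psi> = "subst pX (pX * pY)"
  have "f \<in> ideal_pow (ring_on (p 1)) (max_ideal (p 1)) k"
    using adic fR f(2) True unfolding is_adic_def k_def by (metis DiffI empty_iff insert_iff int_nat_eq order_refl)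
  then obtain g' h where gh: "f = ev u v g' / ev u v h" "pX ^ k dvd ?\<psi> g'" "poly (poly h 0) 0 \<noteq> 0"
    using center_power_subset[OF uv, of k] by blast
  have "ev u v h \<noteq> 0" using gh(3) indep_ev_eq_0_iff[OF uv(1)] by auto
  then have "ev u v (g * h) = ev u v g'" using gh(1) g(1) by (simp add: field_simps)
  then have "g * h = g'" using indep_ev_eq_iff[OF uv(1)] by blast
  then have dvd: "pX ^ k dvd ?\<psi> g * ?\<psi> h" using gh(2) by auto
  have g0: "?\<psi> g \<noteq> 0"
  proof
    assume "?\<psi> g = 0"
    moreover have "ev u (v / u) (?\<psi> g) = ev u v g"
      using indep_nonzero(1)[OF uv(1)] by (simp add: ev_subst)
    ultimately show False using f(2) g(1) by simp
  qed
  have h0: "poly (?\<psi> h) 0 \<noteq> 0" using gh(3) subst_blowup_at_0[of h] by auto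
  then have "?\<psi> g * ?\<psi> h \<noteq> 0" using g0 by auto
  moreover have "order 0 (?\<psi> h) = 0" using h0 by (rule order_0I)
  ultimately have "k \<le> order 0 (?\<psi> g)"
    using dvd order_divides[of 0 k "?\<psi> g * ?\<psi> h"] by (simp add: order_mult pX_def)
  also have "\<dots> \<le> degree (?\<psi> g)" by (rule order_degree[OF g0])
  also have "\<dots> \<le> d" by (rule subst_blowup_degree[OF g(2)])
  finally show ?thesis using True by (simp add: k_def)
qed simp

section \<open>The bound for valuations that are not adic\<close>

lemma beta0_pos: "0 < beta0 \<nu> (p 1)"
proof -
  obtain u v where uv: "indep u v" "p 1 = pt u v" using points[OF one_le_n'] by blast
  have "u \<in> max_ideal (p 1)" "u \<noteq> 0"
    using gen_in_max_pt(1)[OF uv(1)] indep_nonzero(1)[OF uv(1)] by (simp_all flip: uv(2))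
  then obtain y where "y \<in> max_ideal (p 1) - {0}" "beta0 \<nu> (p 1) = \<nu> y"
    using ideal_value_le(2)[of "max_ideal (p 1)" \<nu> u] val_pos[OF one_le_n']
    unfolding beta0_def by fastforce
  then show ?thesis using val_pos[OF one_le_n', of y] by simp
qed

lemma ceiling_plus_ge: "x \<le> real_of_int (ceiling_plus x)" "0 \<le> ceiling_plus x"
  by (auto simp: ceiling_plus_def)

lemma val_le_nonadic:
  assumes uv: "indep u v" "p 1 = pt u v" and f: "f \<in> Tpol d u v" "f \<noteq> 0"
    and t: "\<nu> u = tangency \<nu> (p 1)" and beta: "beta0 \<nu> (p 1) \<le> \<nu> u" and nonadic: "\<not> is_adic \<nu> (p 1)"
  shows "real_of_int (\<nu> f) \<le>
    real d * real_of_int (beta0 \<nu> (p 1) + (1 + delta0 \<nu> (p 1)) * tangency \<nu> (p 1))"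
proof -
  define b where "b = real_of_int (beta0 \<nu> (p 1))"
  define T where "T = real_of_int (tangency \<nu> (p 1))"
  define \<delta> where "\<delta> = real_of_int (delta0 \<nu> (p 1))"
  define C where "C = b + (1 + \<delta>) * T"
  have bT: "0 < b" "b \<le> T" "0 < T" "real_of_int (\<nu> u) = T"
    using beta0_pos beta t by (auto simp: b_def T_def)
  have \<delta>: "0 \<le> \<delta>" "(inverse (volume \<nu> (p 1)) - 2 * b * T) / T\<^sup>2 \<le> \<delta>"
    unfolding \<delta>_def delta0_def b_def T_def using nonadic ceiling_plus_ge by simp_all
  have "T \<le> (1 + \<delta>) * T" using \<delta>(1) bT by (simp add: algebra_simps)
  then have CT: "T \<le> C" "0 \<le> C" using bT(1,3) unfolding C_def by linarith+
  have vol: "inverse (volume \<nu> (p 1)) \<le> (2 * b + \<delta> * T) * T"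
    using \<delta>(2) bT by (simp add: field_simps power2_eq_square)
  obtain g where g: "f = ev u v g" "tdeg_le d g" using f(1) by (auto simp: Tpol_def)
  have "g \<noteq> 0" using f(2) g(1) by auto
  then obtain k g' where g': "g = pX ^ k * g'" "poly g' 0 \<noteq> 0" using pX_power_decomp by blast
  define D where "D = degree (poly g' 0)"
  \<comment> \<open>\<open>g\<close> contains the monomial \<open>pX ^ k * pY ^ D\<close>. The
    \<open>k\<close> copies of the line and the intersection number \<open>D\<close> of the
    remaining factor therefore share the degree: \<open>k + D \<le> d\<close>.\<close>
  have "Polynomial.coeff (pX ^ k * g') k = poly g' 0"
    by (induction k) (simp_all add: poly_0_coeff_0 pX_mult mult.assoc)
  then have "Polynomial.coeff g k = poly g' 0" by (simp only: g'(1))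
  then have "Polynomial.coeff (Polynomial.coeff g k) D \<noteq> 0" using g'(2) by (simp add: D_def)
  then have kD: "k + D \<le> d" using g(2) by (simp add: tdeg_le_def)
  have nz: "u \<noteq> 0" "ev u v g' \<noteq> 0"
    using indep_nonzero(1)[OF uv(1)] indep_ev_eq_0_iff[OF uv(1)] g'(2) by auto
  have le: "real_of_int (\<nu> (ev u v g')) \<le> real D * C"
  \<comment> \<open>The remaining factor need not pass through \<open>p\<close>; then its value is
    not positive and the volume estimate does not apply, but the bound is immediate.\<close>
  proof (cases "0 < \<nu> (ev u v g')")
    case False
    then have "real_of_int (\<nu> (ev u v g')) \<le> 0" by simp
    also have "0 \<le> real D * C" using CT by simp
    finally show ?thesis .
  next
    case True
    define a where "a = real_of_int (\<nu> (ev u v g'))"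
    have "0 < \<nu> u" using bT by simp
    then have v: "0 < volume \<nu> (p 1)" "volume \<nu> (p 1) * (a * T) \<le> D"
      using volume_bounds[OF uv g'(2) True] bT(4) by (simp_all add: a_def D_def)
    then have "a * T \<le> D * inverse (volume \<nu> (p 1))" by (simp add: field_simps)
    also have "\<dots> \<le> D * ((2 * b + \<delta> * T) * T)" using vol by (intro mult_left_mono) auto
    finally have "a * T \<le> (D * (2 * b + \<delta> * T)) * T" by (simp add: mult.assoc)
    then have "a \<le> D * (2 * b + \<delta> * T)" using bT(3) by simp
    also have "\<dots> \<le> D * C"
      using bT(2) by (intro mult_left_mono) (auto simp: C_def algebra_simps)
    finally show ?thesis by (simp add: a_def)
  qed
  have "\<nu> f = int k * \<nu> u + \<nu> (ev u v g')"
    using nz by (simp add: g(1) g'(1) val_mult val_power)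
  then have "real_of_int (\<nu> f) = real k * T + real_of_int (\<nu> (ev u v g'))" using bT(4) by simp
  also have "\<dots> \<le> real k * C + real D * C"
    using le CT by (intro add_mono mult_left_mono) auto
  also have "\<dots> = real (k + D) * C" by (simp add: algebra_simps)
  also have "\<dots> \<le> real d * C" using kD CT by (intro mult_right_mono) auto
  finally show ?thesis by (simp add: C_def b_def T_def \<delta>_def)
qed

end

theorem theoremA:
  fixes \<nu> :: "'k::alg_closed_field ratfun \<Rightarrow> int"
    and p :: "nat \<Rightarrow> 'k point"
    and n d :: nat
    and m :: "nat \<Rightarrow> nat"
    and F :: "'k poly poly poly"
  assumes "divisorial_valuation n p \<nu>"
    and "plane_curve d F"
    and "passes_through d F n p m"
  shows "real d \<ge>
    1 / real_of_int (beta0 \<nu> (p 1) + (1 + delta0 \<nu> (p 1)) * tangency \<nu> (p 1))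
      * (\<Sum>i=1..n. real_of_int (multiplicity_at \<nu> p i) * real (m i))"
proof -
  interpret divisorial n p \<nu> by unfold_locales fact
  obtain u v where uv: "indep u v" "p 1 = pt u v" and t: "\<nu> u = tangency \<nu> (p 1)"
    and curve: "\<And>d F. plane_curve d F \<Longrightarrow> curve_divisor d F (p 1) \<in> Tpol d u v - {0}"
    and beta: "beta0 \<nu> (p 1) \<le> \<nu> u"
    using tangent_coordinates by metis
  define f where "f = curve_divisor d F (p 1)"
  have f: "f \<in> Tpol d u v" "f \<noteq> 0" using curve[OF assms(2)] by (auto simp: f_def)
  define C where "C = real_of_int (beta0 \<nu> (p 1) + (1 + delta0 \<nu> (p 1)) * tangency \<nu> (p 1))"
  have val: "real_of_int (\<nu> f) \<le> real d * C" and C: "0 < C"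
  proof -
    show "real_of_int (\<nu> f) \<le> real d * C"
    proof (cases "is_adic \<nu> (p 1)")
      case True
      \<comment> \<open>Here \<open>delta0\<close> is -1, so \<open>C\<close> reduces to
        \<open>beta0\<close>, a positive integer.\<close>
      have "1 \<le> C" using True beta0_pos by (simp add: C_def delta0_def)
      then have "real d * 1 \<le> real d * C" by (intro mult_left_mono) auto
      then show ?thesis using val_le_adic[OF uv f True] by linarith
    next
      case False
      then show ?thesis unfolding C_def by (rule val_le_nonadic[OF uv f t beta])
    qed
    have "0 \<le> (1 + delta0 \<nu> (p 1)) * tangency \<nu> (p 1)"
      using beta0_pos beta t ceiling_plus_ge by (intro mult_nonneg_nonneg) (simp_all add: delta0_def)
    then have "0 < beta0 \<nu> (p 1) + (1 + delta0 \<nu> (p 1)) * tangency \<nu> (p 1)"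
      using beta0_pos by linarith
    then show "0 < C" unfolding C_def of_int_0_less_iff .
  qed
  have "(\<Sum>i=1..n. real_of_int (multiplicity_at \<nu> p i) * real (m i)) =
      real_of_int (\<Sum>i=1..n. multiplicity_at \<nu> p i * int (m i))"
    by simp
  also have "\<dots> \<le> real_of_int (\<nu> f)"
    unfolding of_int_le_iff using passes_through_val[OF assms(3)] f(2) unfolding f_def by blast
  also have "\<dots> \<le> real d * C" by (rule val)
  finally show ?thesis using C unfolding C_def[symmetric] by (simp add: field_simps)
qed

end
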